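(* Let $T\subset\mathbb{R}^3$ be a convex polyhedron satisfying the assumptions in the context, with $\#V$ vertices, $\#E$ edges and $\#F$ faces, and let $\mathcal{M}\Lambda^k(T)$, $k=0,1,2$, be the spaces defined in the context. Then the sequence $$0\to\mathbb{R}\xrightarrow{\ \subset\ }\mathcal{M}\Lambda^0(T)\xrightarrow{\ \mathrm{grad}\ }\mathcal{M}\Lambda^1(T)\xrightarrow{\ \mathrm{curl}\ }\mathcal{M}\Lambda^2(T)\xrightarrow{\ \mathrm{div}\ }\mathbb{R}\to0$$ is exact, with $\dim\mathcal{M}\Lambda^0(T)=\#V$, $\dim\mathcal{M}\Lambda^1(T)=\#E$ and $\dim\mathcal{M}\Lambda^2(T)=\#F$.
   Context: $T\subset\mathbb{R}^3$ is a (closed) convex polyhedron with vertices $\mathbf{v}_1,\dots,\mathbf{v}_n$. Generalized barycentric coordinates on $T$ are functions $\lambda_1,\dots,\lambda_n$ on $T$, non-negative, with $L(\mathbf{x})=\sum_i L(\mathbf{v}_i)\lambda_i(\mathbf{x})$ for every affine $L$ and all $\mathbf{x}\in T$. Assumption 1: $\lambda_i(\mathbf{v}_j)=\delta_{ij}$; $\lambda_i\in C^1(T)$ (up to the boundary); on each face $f$, the $\lambda_i$ with $\mathbf{v}_i\in f$ restrict to 2D generalized barycentric coordinates of the polygon $f$ which again satisfy the Lagrange property, are $C^1$ on $f$ and are linear on each edge of $f$, while $\lambda_i|_f=0$ if $\mathbf{v}_i\notin f$. Assumption 2: every face $f$ is a triangle or a parallelogram, and if its vertices are $\mathbf{v}_{i_1},\mathbf{v}_{i_2},\dots$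 in counterclockwise order seen from outside $T$, $D_{ab}:=(\nabla\lambda_{i_a}\times\nabla\lambda_{i_b})\cdot\mathbf{n}_f|_f$, and $|f|$ is the area, then $D_{12}=D_{23}=D_{31}=\frac1{2|f|}$ for a triangle, and $D_{12}+D_{34}=D_{23}+D_{41}=\frac1{|f|}$ for a parallelogram. Here $\mathbf{n}_f$ is the unit outward normal on $f$. Whitney 1-forms: $W_{ij}=\lambda_i\nabla\lambda_j-\lambda_j\nabla\lambda_i$; $\mathrm{curl}\,W_{ij}=2\nabla\lambda_i\times\nabla\lambda_j$ (derivatives understood weakly where needed). For $i\ne j$, $e_{ij}$ is the directed segment from $\mathbf{v}_i$ to $\mathbf{v}_j$ and $\boldsymbol{\tau}_{ij}=\mathbf{v}_j-\mathbf{v}_i$. $\mathcal{E}$ is the set of $e_{ij}$ that are edges of $T$ (both directions included), $\mathcal{E}_F$ the set of $e_{ij}$ lying on $\partial T$ but not in $\mathcal{E}$, $\mathcal{E}_I$ the set of remaining $e_{ij}$ (not lying on $\partial T$). For $e_{ij}\in\mathcal{E}$, $\mathcal{V}_{ij}$ is the set of all vertices of the two faces sharing $e_{ij}$. For each $e_{ik}\in\mathcal{E}_I$ fix once and for all coefficients $C^{ik}_{ij}$ with $\boldsymbol{\tau}_{ik}=\sum_{j,\,e_{ij}\in\mathcal{E}}C^{ik}_{ij}\boldsymbol{\tau}_{ij}$. For $e_{ij}\in\mathcal{E}$ define $$\tilde W_{ij}=W_{ij}+\tfrac12\Big(\sum_{\mathbf{v}_k\in\mathcal{V}_{ij},\,e_{ik}\in\mathcal{E}_F}W_{ik}-\sum_{\mathbf{v}_k\in\mathcal{V}_{ij},\,e_{jk}\in\mathcal{E}_F}W_{jk}\Big)+\tfrac12\Big(\sum_{k,\,e_{ik}\in\mathcal{E}_I}C^{ik}_{ij}W_{ik}-\sum_{k,\,e_{jk}\in\mathcal{E}_I}C^{jk}_{ji}W_{jk}\Big).$$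 $\mathcal{F}$ is the set of faces of $T$; $\partial f$ is the boundary of $f$ oriented by the right-hand rule with $\mathbf{n}_f$; $e_{ij}\in\partial f$ means that $e_{ij}$ is an edge of $f$ directed according to this orientation. Define $\tilde W_f=\sum_{e_{ij}\in\partial f}\tilde W_{ij}$ and, for a fixed point $\mathbf{x}_*$ in the interior of $T$, $$\mathcal{M}\Lambda^0(T)=\mathrm{span}\{\lambda_i,\ 1\le i\le n\},\qquad \mathcal{M}\Lambda^1(T)=\mathrm{span}\{\nabla\lambda_i,\ 1\le i\le n\}+\mathrm{span}\{\tilde W_f,\ f\in\mathcal{F}\},$$ $$\mathcal{M}\Lambda^2(T)=\mathrm{span}\{\mathrm{curl}\,\tilde W_f,\ f\in\mathcal{F}\}+\mathrm{span}\{\mathbf{x}-\mathbf{x}_*\}.$$ $\mathbb{R}$ denotes the constant functions on $T$. *)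

theory Defs
  imports "HOL-Analysis.Analysis" "HOL-Library.Function_Algebras"
begin

section \<open>Function spaces on a set\<close>

instantiation "fun" :: (type, real_vector) real_vector
begin

definition scaleR_fun_def: "scaleR c f = (\<lambda>x. c *\<^sub>R f x)"

instance
  by standard (simp_all add: scaleR_fun_def fun_eq_iff algebra_simps)

end

text \<open>A function on \<open>S\<close> is represented by its extension by zero, so that equality, \<open>span\<close>
  and \<open>dim\<close> of functions refer to their values on \<open>S\<close> only.\<close>

definition zext :: "'a set \<Rightarrow> ('a \<Rightarrow> 'b::zero) \<Rightarrow> 'a \<Rightarrow> 'b" where
  "zext S f = (\<lambda>x. if x \<in> S then f x else 0)"

definition consts_on :: "'a set \<Rightarrow> ('a \<Rightarrow> real) set" where
  "consts_on S = range (\<lambda>c. zext S (\<lambda>_. c))"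

definition linear_map_on ::
    "'a::real_vector set \<Rightarrow> 'b::real_vector set \<Rightarrow> ('a \<Rightarrow> 'b) \<Rightarrow> bool" where
  "linear_map_on U V d \<longleftrightarrow> subspace U \<and> subspace V \<and> d ` U \<subseteq> V \<and>
     (\<forall>u\<in>U. \<forall>v\<in>U. d (u + v) = d u + d v) \<and> (\<forall>c. \<forall>u\<in>U. d (c *\<^sub>R u) = c *\<^sub>R d u)"

text \<open>Exactness of \<open>U \<rightarrow> V \<rightarrow> W\<close> at \<open>V\<close>.\<close>

definition exact_at :: "'a::real_vector set \<Rightarrow> ('a \<Rightarrow> 'b) \<Rightarrow> 'b::real_vector set \<Rightarrow>
    ('b \<Rightarrow> 'c) \<Rightarrow> 'c::real_vector set \<Rightarrow> bool" where
  "exact_at U d V d' W \<longleftrightarrow>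
     linear_map_on U V d \<and> linear_map_on V W d' \<and> d ` U = {v \<in> V. d' v = 0}"


section \<open>Gradient, weak curl and weak divergence\<close>

text \<open>Derivatives are taken within \<open>S\<close>, so that boundary points are included. If \<open>S\<close> is convex
  with nonempty interior then the gradient is unique at every point of \<open>S\<close>; if \<open>S\<close> is a planar
  polygon then only its tangential part is.\<close>

definition C1_on :: "'a::euclidean_space set \<Rightarrow> ('a \<Rightarrow> real) \<Rightarrow> bool" where
  "C1_on S f \<longleftrightarrow> (\<exists>g. continuous_on S g \<and>
     (\<forall>x\<in>S. (f has_derivative (\<lambda>h. g x \<bullet> h)) (at x within S)))"

definition grad :: "'a::euclidean_space set \<Rightarrow> ('a \<Rightarrow> real) \<Rightarrow> 'a \<Rightarrow> 'a" where
  "grad S f = zext S (\<lambda>x. THE g. (f has_derivative (\<lambda>h. g \<bullet> h)) (at x within S))"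

primrec Ck :: "nat \<Rightarrow> ('a::euclidean_space \<Rightarrow> 'b::euclidean_space) \<Rightarrow> bool" where
  "Ck 0 f \<longleftrightarrow> continuous_on UNIV f"
| "Ck (Suc k) f \<longleftrightarrow>
     (\<exists>f'. (\<forall>x. (f has_derivative f' x) (at x)) \<and> (\<forall>h. Ck k (\<lambda>x. f' x h)))"

definition test_function ::
    "'a::euclidean_space set \<Rightarrow> ('a \<Rightarrow> 'b::euclidean_space) \<Rightarrow> bool" where
  "test_function \<Omega> \<phi> \<longleftrightarrow> (\<forall>k. Ck k \<phi>) \<and> (\<exists>K. compact K \<and> K \<subseteq> \<Omega> \<and> (\<forall>x. x \<notin> K \<longrightarrow> \<phi> x = 0))"

definition classical_curl :: "(real^3 \<Rightarrow> real^3) \<Rightarrow> real^3 \<Rightarrow> real^3" where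
  "classical_curl \<phi> x =
     (let D = (\<lambda>j. frechet_derivative \<phi> (at x) (axis j 1))
      in vector [D 2 $ 3 - D 3 $ 2, D 3 $ 1 - D 1 $ 3, D 1 $ 2 - D 2 $ 1])"

definition locally_integrable ::
    "'a::euclidean_space set \<Rightarrow> ('a \<Rightarrow> 'b::euclidean_space) \<Rightarrow> bool" where
  "locally_integrable \<Omega> u \<longleftrightarrow> (\<forall>K. compact K \<and> K \<subseteq> \<Omega> \<longrightarrow> u absolutely_integrable_on K)"

definition has_weak_curl :: "(real^3) set \<Rightarrow> (real^3 \<Rightarrow> real^3) \<Rightarrow> (real^3 \<Rightarrow> real^3) \<Rightarrow> bool" where
  "has_weak_curl \<Omega> u w \<longleftrightarrow> locally_integrable \<Omega> u \<and> locally_integrable \<Omega> w \<and>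
     (\<forall>\<phi>. test_function \<Omega> \<phi> \<longrightarrow>
        integral \<Omega> (\<lambda>x. u x \<bullet> classical_curl \<phi> x) = integral \<Omega> (\<lambda>x. w x \<bullet> \<phi> x))"

definition has_weak_div :: "(real^3) set \<Rightarrow> (real^3 \<Rightarrow> real^3) \<Rightarrow> (real^3 \<Rightarrow> real) \<Rightarrow> bool" where
  "has_weak_div \<Omega> u g \<longleftrightarrow> locally_integrable \<Omega> u \<and> locally_integrable \<Omega> g \<and>
     (\<forall>\<phi>. test_function \<Omega> \<phi> \<longrightarrow>
        integral \<Omega> (\<lambda>x. u x \<bullet> grad UNIV \<phi> x) = - integral \<Omega> (\<lambda>x. g x * \<phi> x))"

text \<open>Weak derivatives are determined only almost everywhere. Those that occur below have a
  representative that is continuous up to the boundary, and this is the one selected.\<close>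

definition curl :: "(real^3) set \<Rightarrow> (real^3 \<Rightarrow> real^3) \<Rightarrow> real^3 \<Rightarrow> real^3" where
  "curl T u = (THE w. continuous_on T w \<and> zext T w = w \<and> has_weak_curl (interior T) u w)"

definition divergence :: "(real^3) set \<Rightarrow> (real^3 \<Rightarrow> real^3) \<Rightarrow> real^3 \<Rightarrow> real" where
  "divergence T u = (THE g. continuous_on T g \<and> zext T g = g \<and> has_weak_div (interior T) u g)"


section \<open>Geometry of the polyhedron\<close>

text \<open>Vertices serve as their own indices: a directed segment is the pair of its end points.\<close>

definition verts :: "(real^3) set \<Rightarrow> (real^3) set" where
  "verts S = {p. p extreme_point_of S}"

definition edges :: "(real^3) set \<Rightarrow> (real^3) set set" where
  "edges S = {e. e edge_of S}"

definition faces :: "(real^3) set \<Rightarrow> (real^3) set set" where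
  "faces T = {f. f facet_of T}"

definition dir_edges :: "(real^3) set \<Rightarrow> ((real^3) \<times> (real^3)) set" where
  "dir_edges S = {(p, q). p \<in> verts S \<and> q \<in> verts S \<and> p \<noteq> q \<and> closed_segment p q \<in> edges S}"

definition face_diagonals :: "(real^3) set \<Rightarrow> ((real^3) \<times> (real^3)) set" where
  "face_diagonals T = {(p, q). p \<in> verts T \<and> q \<in> verts T \<and> p \<noteq> q \<and>
     closed_segment p q \<subseteq> frontier T} - dir_edges T"

definition inner_diagonals :: "(real^3) set \<Rightarrow> ((real^3) \<times> (real^3)) set" where
  "inner_diagonals T = {(p, q). p \<in> verts T \<and> q \<in> verts T \<and> p \<noteq> q \<and>
     \<not> closed_segment p q \<subseteq> frontier T}"

definition adjacent_verts :: "(real^3) set \<Rightarrow> real^3 \<Rightarrow> real^3 \<Rightarrow> (real^3) set" where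
  "adjacent_verts T p q = (\<Union>f \<in> {f \<in> faces T. closed_segment p q \<subseteq> f}. verts f)"

definition outward_normal :: "(real^3) set \<Rightarrow> (real^3) set \<Rightarrow> real^3" where
  "outward_normal T f = (THE n. norm n = 1 \<and> (\<forall>x\<in>f. \<forall>y\<in>T. n \<bullet> y \<le> n \<bullet> x))"

text \<open>The right-hand rule: \<open>n\<^sub>f \<times> (q - p)\<close> points from the edge into \<open>f\<close>.\<close>

definition face_boundary :: "(real^3) set \<Rightarrow> (real^3) set \<Rightarrow> ((real^3) \<times> (real^3)) set" where
  "face_boundary T f = {(p, q) \<in> dir_edges f.
     \<forall>x\<in>f. cross3 (outward_normal T f) (q - p) \<bullet> (x - p) \<ge> 0}"

definition ccw_vertices :: "(real^3) set \<Rightarrow> (real^3) set \<Rightarrow> (real^3) list \<Rightarrow> bool" where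
  "ccw_vertices T f ps \<longleftrightarrow> distinct ps \<and> set ps = verts f \<and>
     (\<forall>i<length ps. (ps ! i, ps ! (Suc i mod length ps)) \<in> face_boundary T f)"

definition planar_area :: "(real^3) set \<Rightarrow> real" where
  "planar_area f = measure lebesgue
     ((SOME g :: real^2 \<Rightarrow> real^3. (\<forall>x y. dist (g x) (g y) = dist x y) \<and> f \<subseteq> range g) -` f)"

definition parallelogram :: "(real^3) set \<Rightarrow> bool" where
  "parallelogram f \<longleftrightarrow>
     (\<exists>a u w. \<not> collinear {0, u, w} \<and> f = convex hull {a, a + u, a + u + w, a + w})"


section \<open>Generalized barycentric coordinates\<close>

text \<open>For a planar polygon \<open>S\<close>, the affine functions on its plane are exactly the restrictions of
  the affine functions on the whole space, so the definition covers the two-dimensional case.\<close>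

definition gbc :: "(real^3) set \<Rightarrow> (real^3 \<Rightarrow> real^3 \<Rightarrow> real) \<Rightarrow> bool" where
  "gbc S lam \<longleftrightarrow> (\<forall>p\<in>verts S. \<forall>x\<in>S. lam p x \<ge> 0) \<and>
     (\<forall>a b. \<forall>x\<in>S. a \<bullet> x + b = (\<Sum>p\<in>verts S. (a \<bullet> p + b) * lam p x))"

definition C1_lagrange_gbc :: "(real^3) set \<Rightarrow> (real^3 \<Rightarrow> real^3 \<Rightarrow> real) \<Rightarrow> bool" where
  "C1_lagrange_gbc S lam \<longleftrightarrow> gbc S lam \<and>
     (\<forall>p\<in>verts S. \<forall>q\<in>verts S. lam p q = (if p = q then 1 else 0)) \<and>
     (\<forall>p\<in>verts S. C1_on S (lam p))"

definition regular_coordinates :: "(real^3) set \<Rightarrow> (real^3 \<Rightarrow> real^3 \<Rightarrow> real) \<Rightarrow> bool" where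
  "regular_coordinates T lam \<longleftrightarrow> C1_lagrange_gbc T lam \<and>
     (\<forall>f\<in>faces T. C1_lagrange_gbc f lam \<and>
        (\<forall>p\<in>verts f. \<forall>e\<in>edges f. \<exists>a b. \<forall>x\<in>e. lam p x = a \<bullet> x + b) \<and>
        (\<forall>p\<in>verts T - f. \<forall>x\<in>f. lam p x = 0))"

definition face_jacobian :: "(real^3) set \<Rightarrow> (real^3 \<Rightarrow> real^3 \<Rightarrow> real) \<Rightarrow> (real^3) set \<Rightarrow>
    real^3 \<Rightarrow> real^3 \<Rightarrow> real^3 \<Rightarrow> real" where
  "face_jacobian T lam f p q x =
     cross3 (grad T (lam p) x) (grad T (lam q) x) \<bullet> outward_normal T f"

definition face_conditions :: "(real^3) set \<Rightarrow> (real^3 \<Rightarrow> real^3 \<Rightarrow> real) \<Rightarrow> bool" where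
  "face_conditions T lam \<longleftrightarrow> (\<forall>f\<in>faces T.
     let D = face_jacobian T lam f in
       (2 simplex f \<and>
          (\<forall>p1 p2 p3. ccw_vertices T f [p1, p2, p3] \<longrightarrow>
             (\<forall>x\<in>f. D p1 p2 x = 1 / (2 * planar_area f) \<and>
                     D p2 p3 x = 1 / (2 * planar_area f) \<and>
                     D p3 p1 x = 1 / (2 * planar_area f)))) \<or>
       (parallelogram f \<and>
          (\<forall>p1 p2 p3 p4. ccw_vertices T f [p1, p2, p3, p4] \<longrightarrow>
             (\<forall>x\<in>f. D p1 p2 x + D p3 p4 x = 1 / planar_area f \<and>
                     D p2 p3 x + D p4 p1 x = 1 / planar_area f))))"


section \<open>Whitney forms and the spaces \<open>M\<Lambda>\<^sup>k(T)\<close>\<close>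

text \<open>All fields below vanish outside \<open>T\<close> because \<open>grad T\<close> does.\<close>

definition whitney :: "(real^3) set \<Rightarrow> (real^3 \<Rightarrow> real^3 \<Rightarrow> real) \<Rightarrow>
    real^3 \<Rightarrow> real^3 \<Rightarrow> real^3 \<Rightarrow> real^3" where
  "whitney T lam p q x = lam p x *\<^sub>R grad T (lam q) x - lam q x *\<^sub>R grad T (lam p) x"

text \<open>\<open>C i k j\<close> stands for the coefficient $C^{ik}_{ij}$.\<close>

definition diagonal_coeffs :: "(real^3) set \<Rightarrow> (real^3 \<Rightarrow> real^3 \<Rightarrow> real^3 \<Rightarrow> real) \<Rightarrow> bool" where
  "diagonal_coeffs T C \<longleftrightarrow> (\<forall>(i, k) \<in> inner_diagonals T.
     k - i = (\<Sum>j | (i, j) \<in> dir_edges T. C i k j *\<^sub>R (j - i)))"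

definition mod_whitney :: "(real^3) set \<Rightarrow> (real^3 \<Rightarrow> real^3 \<Rightarrow> real) \<Rightarrow>
    (real^3 \<Rightarrow> real^3 \<Rightarrow> real^3 \<Rightarrow> real) \<Rightarrow> real^3 \<Rightarrow> real^3 \<Rightarrow> real^3 \<Rightarrow> real^3" where
  "mod_whitney T lam C i j x = whitney T lam i j x
     + (1/2) *\<^sub>R
        ((\<Sum>k | k \<in> adjacent_verts T i j \<and> (i, k) \<in> face_diagonals T. whitney T lam i k x)
       - (\<Sum>k | k \<in> adjacent_verts T i j \<and> (j, k) \<in> face_diagonals T. whitney T lam j k x))
     + (1/2) *\<^sub>R
        ((\<Sum>k | (i, k) \<in> inner_diagonals T. C i k j *\<^sub>R whitney T lam i k x)
       - (\<Sum>k | (j, k) \<in> inner_diagonals T. C j k i *\<^sub>R whitney T lam j k x))"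

definition face_whitney :: "(real^3) set \<Rightarrow> (real^3 \<Rightarrow> real^3 \<Rightarrow> real) \<Rightarrow>
    (real^3 \<Rightarrow> real^3 \<Rightarrow> real^3 \<Rightarrow> real) \<Rightarrow> (real^3) set \<Rightarrow> real^3 \<Rightarrow> real^3" where
  "face_whitney T lam C f x = (\<Sum>(i, j) \<in> face_boundary T f. mod_whitney T lam C i j x)"

definition M0 :: "(real^3) set \<Rightarrow> (real^3 \<Rightarrow> real^3 \<Rightarrow> real) \<Rightarrow> (real^3 \<Rightarrow> real) set" where
  "M0 T lam = span ((\<lambda>p. zext T (lam p)) ` verts T)"

definition M1 :: "(real^3) set \<Rightarrow> (real^3 \<Rightarrow> real^3 \<Rightarrow> real) \<Rightarrow>
    (real^3 \<Rightarrow> real^3 \<Rightarrow> real^3 \<Rightarrow> real) \<Rightarrow> (real^3 \<Rightarrow> real^3) set" where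
  "M1 T lam C = span ((\<lambda>p. grad T (lam p)) ` verts T) + span (face_whitney T lam C ` faces T)"

definition M2 :: "(real^3) set \<Rightarrow> (real^3 \<Rightarrow> real^3 \<Rightarrow> real) \<Rightarrow>
    (real^3 \<Rightarrow> real^3 \<Rightarrow> real^3 \<Rightarrow> real) \<Rightarrow> real^3 \<Rightarrow> (real^3 \<Rightarrow> real^3) set" where
  "M2 T lam C xs = span ((\<lambda>f. curl T (face_whitney T lam C f)) ` faces T)
     + span {zext T (\<lambda>x. x - xs)}"

end

theory Submission
  imports Defs
begin

text \<open>
  The normal component of the curl of a modified Whitney form on a face \<open>f\<close> is constant: it is
  \<open>1/|f|\<close> or \<open>-1/|f|\<close> if the edge lies on the boundary of \<open>f\<close>, according to its direction, and \<open>0\<close>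
  otherwise. Indeed the gradient of a coordinate whose vertex is not on \<open>f\<close> is normal to \<open>f\<close>, so only
  products of two coordinates of \<open>f\<close> contribute, and those are governed by the assumption on the
  Jacobians. Hence a combination of the curls of the face forms that vanishes lies in the kernel of
  the graph Laplacian of the dual graph, which is connected, so its coefficients are all equal; on the
  other hand the face forms add up to zero, because every edge occurs in two faces with opposite
  directions. This settles exactness and gives dimension \<open>(#V - 1) + (#F - 1)\<close> for the space of
  1-forms, which is \<open>#E\<close> by Euler's formula.

  The weak curl and divergence are computed from the vanishing of the integral of a Jacobian of two
  continuously differentiable functions, one of them compactly supported.\<close>

section \<open>Hyperplane sections of polytopes\<close>

text \<open>The coordinates are merely C1, so curls cannot be differentiated again: derivatives are
  moved onto test functions, and continuity up to the boundary makes the weak curl unique at every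
  point, which is what allows its flux to be evaluated on a face. The factor 1/2 of the correction
  terms is what makes this flux constant: on a parallelogram with corners i, j, k, l the row sums of
  the Jacobians D vanish because the gradients sum to zero, whence D_ij + (D_ik - D_jl)/2 = (D_jk +
  D_li)/2, and the right-hand side is prescribed. Diagonals through the interior leave every face
  flux unchanged, since no face contains both their ends. The curls of the face forms satisfy one
  linear relation and have divergence zero; the position field, with divergence 3, supplies the
  missing dimension of the 2-forms and the surjectivity at the end of the sequence.\<close>

lemma rel_interior_Int_hyperplane:
  fixes S :: "'a::euclidean_space set"
  assumes "convex S" "rel_interior S \<inter> {y. a \<bullet> y = c} \<noteq> {}"
  shows "rel_interior (S \<inter> {y. a \<bullet> y = c}) = rel_interior S \<inter> {y. a \<bullet> y = c}"
proof -
  have "rel_interior {y. a \<bullet> y = c} = {y. a \<bullet> y = c}"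
    using affine_hyperplane rel_interior_affine by blast
  then show ?thesis
    using convex_rel_interior_inter_two[of S "{y. a \<bullet> y = c}"] assms convex_hyperplane by auto
qed

text \<open>The slice of the relative interior is open in the slice of the affine hull, so both have
  the same dimension; the latter is one less than that of the hull because \<open>y\<close> keeps
  the hull out of the hyperplane.\<close>

lemma aff_dim_Int_hyperplane:
  fixes S :: "'a::euclidean_space set"
  assumes "convex S" "rel_interior S \<inter> {y. a \<bullet> y = c} \<noteq> {}" "y \<in> S" "a \<bullet> y \<noteq> c"
  shows "aff_dim (S \<inter> {y. a \<bullet> y = c}) = aff_dim S - 1"
proof -
  let ?H = "{y. a \<bullet> y = c}" and ?A = "affine hull S"
  have sub: "rel_interior S \<inter> ?H \<subseteq> S \<inter> ?H" "S \<inter> ?H \<subseteq> ?A \<inter> ?H"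
    using rel_interior_subset hull_subset[of S affine] by fast+
  have dA: "aff_dim (?A \<inter> ?H) = aff_dim S - 1"
  proof -
    have "?A \<inter> ?H \<noteq> {}" using sub assms(2) by blast
    moreover have "\<not> ?A \<subseteq> ?H" using assms(3,4) hull_inc[of y S affine] by blast
    ultimately show ?thesis
      using aff_dim_affine_Int_hyperplane[OF affine_affine_hull[of S], of a c] by simp
  qed
  have "openin (top_of_set (?A \<inter> ?H)) (rel_interior S \<inter> ?H)"
  proof -
    have "openin (top_of_set ?A) (rel_interior S)" by (rule openin_rel_interior)
    then obtain U where "open U" "rel_interior S = U \<inter> ?A"
      by (auto simp: openin_open)
    then show ?thesis by (auto simp: openin_open)
  qed
  then have "aff_dim (rel_interior S \<inter> ?H) = aff_dim (?A \<inter> ?H)"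
    using aff_dim_openin assms(2) affine_Int[OF affine_affine_hull affine_hyperplane] by blast
  then show ?thesis
    using aff_dim_subset[OF sub(1)] aff_dim_subset[OF sub(2)] dA by linarith
qed

text \<open>A relative interior point of a facet of a hyperplane section lies in the relative boundary
  of the polytope, hence on some facet; that facet cuts out the given one.\<close>

lemma facet_of_hyperplane_section:
  fixes S :: "'a::euclidean_space set"
  assumes S: "polytope S" and ri: "rel_interior S \<inter> {y. a \<bullet> y = c} \<noteq> {}"
    and g: "g facet_of (S \<inter> {y. a \<bullet> y = c})"
  obtains f where "f facet_of S" "g = f \<inter> {y. a \<bullet> y = c}"
proof -
  let ?H = "{y. a \<bullet> y = c}"
  let ?Q = "S \<inter> ?H"
  have cS: "convex S" and cQ: "convex ?Q"
    using S polytope_imp_convex convex_Int convex_hyperplane by blast+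
  have gQ: "g face_of ?Q" "g \<noteq> {}" and dg: "aff_dim g = aff_dim ?Q - 1"
    using g by (auto simp: facet_of_def)
  have "convex g" using gQ(1) face_of_imp_convex by blast
  then obtain x where x: "x \<in> rel_interior g"
    using gQ(2) rel_interior_eq_empty[of g] by auto
  have xg: "x \<in> g" using x rel_interior_subset by blast
  have sub: "g \<subseteq> ?Q" using gQ(1) face_of_imp_subset by blast
  have "g \<noteq> ?Q" using dg by auto
  then have "g \<inter> rel_interior ?Q = {}" using gQ(1) face_of_disjoint_rel_interior by blast
  then have "x \<notin> rel_interior S"
    using xg sub rel_interior_Int_hyperplane[OF cS ri] by blast
  then have "x \<in> S - rel_interior S" using xg sub by blast
  then obtain f where f: "f facet_of S" "x \<in> f"
    using rel_boundary_of_polyhedron[OF polytope_imp_polyhedron[OF S]] by blast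
  have fS: "f face_of S" using f(1) facet_of_imp_face_of by blast
  \<comment> \<open>A face that meets the relative interior of a subset of \<open>S\<close> contains
    that subset.\<close>
  have gf: "g \<subseteq> f"
    using subset_of_face_of[OF fS, of g] sub f(2) x by blast
  have F: "(f \<inter> ?H) face_of ?Q" using face_of_slice[OF fS convex_hyperplane] .
  have "f \<inter> ?H \<noteq> ?Q"
  proof
    assume "f \<inter> ?H = ?Q"
    moreover have "f \<inter> rel_interior S = {}"
      using face_of_disjoint_rel_interior[OF fS] f(1) facet_of_irrefl by blast
    ultimately show False using ri rel_interior_subset[of S] by blast
  qed
  then have lt: "aff_dim (f \<inter> ?H) < aff_dim ?Q" using face_of_aff_dim_lt[OF cQ F] by blast
  have "g face_of (f \<inter> ?H)"
    by (rule face_of_subset[OF gQ(1)]) (use gf sub face_of_imp_subset[OF F] in auto)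
  \<comment> \<open>\<open>f \<inter> ?H\<close> is a proper face of the section, hence not larger
    in dimension than the facet \<open>g\<close>, whereas a proper face of it would be strictly
    smaller.\<close>
  then have "g = f \<inter> ?H"
    using face_of_aff_dim_lt[of "f \<inter> ?H" g] face_of_imp_convex[OF F] lt dg by fastforce
  then show ?thesis using that f(1) by blast
qed

lemma one_dim_polytope:
  fixes e :: "'a::euclidean_space set"
  assumes "polytope e" "aff_dim e = 1"
  obtains p q where "p \<noteq> q" "e = closed_segment p q"
    "{x. x extreme_point_of e} = {p, q}"
proof -
  have "e \<noteq> {}" using assms(2) by auto
  moreover have "compact e" "convex e" "collinear e"
    using assms collinear_aff_dim[of e] polytope_imp_compact polytope_imp_convex by auto
  ultimately obtain p q where pq: "e = closed_segment p q"
    using compact_convex_collinear_segment by metis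
  moreover have "p \<noteq> q" using assms(2) pq by auto
  moreover have "{x. x extreme_point_of e} = {p, q}"
    unfolding pq extreme_point_of_segment by auto
  ultimately show ?thesis using that by blast
qed

text \<open>The intersection is a proper face of at least one of the two facets, which costs a
  dimension.\<close>

lemma face_Int_distinct_facets:
  fixes S :: "'a::euclidean_space set"
  assumes "convex S" "f facet_of S" "f' facet_of S" "f \<noteq> f'"
  shows "(f \<inter> f') face_of S" "aff_dim (f \<inter> f') < aff_dim S - 1"
proof -
  have f: "f face_of S" "f' face_of S" "aff_dim f = aff_dim S - 1" "aff_dim f' = aff_dim S - 1"
    using assms(2,3) by (auto simp: facet_of_def)
  show *: "(f \<inter> f') face_of S" using face_of_Int f by blast
  have "f \<inter> f' \<noteq> f \<or> f \<inter> f' \<noteq> f'" using assms(4) by blast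
  moreover have "(f \<inter> f') face_of f" "(f \<inter> f') face_of f'"
    using * f face_of_subset face_of_imp_subset by (metis inf_le1 inf_le2)+
  ultimately show "aff_dim (f \<inter> f') < aff_dim S - 1"
    using face_of_aff_dim_lt face_of_imp_convex f by metis
qed

lemma polytope_face:
  fixes S :: "'a::euclidean_space set"
  assumes "polytope S" "f face_of S"
  shows "polytope f"
  by (rule face_of_polytope_polytope[OF assms])

lemma hull_extreme:
  fixes S :: "'a::euclidean_space set"
  assumes "polytope S"
  shows "S = convex hull {x. x extreme_point_of S}" "finite {x. x extreme_point_of S}"
  using Krein_Milman_Minkowski[OF polytope_imp_compact[OF assms] polytope_imp_convex[OF assms]] finite_polyhedron_extreme_points[OF polytope_imp_polyhedron[OF assms]]
  by auto

lemma extreme_le: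
  fixes S :: "'a::euclidean_space set"
  assumes "polytope S" "\<And>x. x extreme_point_of S \<Longrightarrow> a \<bullet> x \<le> c" "y \<in> S"
  shows "a \<bullet> y \<le> c"
proof -
  have "convex hull {x. x extreme_point_of S} \<subseteq> {x. a \<bullet> x \<le> c}"
    by (rule hull_minimal) (use assms(2) convex_halfspace_le in auto)
  then show ?thesis using hull_extreme(1)[OF assms(1)] assms(3) by blast
qed

lemma extreme_less:
  fixes S :: "'a::euclidean_space set"
  assumes "polytope S" "\<And>x. x extreme_point_of S \<Longrightarrow> a \<bullet> x > c" "y \<in> S"
  shows "a \<bullet> y > c"
proof -
  have "convex hull {x. x extreme_point_of S} \<subseteq> {x. a \<bullet> x > c}"
    by (rule hull_minimal) (use assms(2) convex_halfspace_gt in auto)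
  then show ?thesis using hull_extreme(1)[OF assms(1)] assms(3) by blast
qed

text \<open>The open half-spaces on both sides contain points of \<open>S\<close> and therefore
  points of its relative interior, which is dense in \<open>S\<close>; the segment between two such
  points crosses the hyperplane inside the relative interior.\<close>

lemma rel_interior_meets_hyperplane:
  fixes S :: "'a::euclidean_space set"
  assumes "convex S" "x \<in> S" "y \<in> S" "a \<bullet> x < c" "c < a \<bullet> y"
  shows "rel_interior S \<inter> {z. a \<bullet> z = c} \<noteq> {}"
proof -
  have cl: "S \<subseteq> closure (rel_interior S)"
    using assms(1) convex_closure_rel_interior closure_subset by blast
  have cr: "convex (rel_interior S)" using assms(1) convex_rel_interior by blast
  have "open {z. a \<bullet> z < c}" "open {z. c < a \<bullet> z}"
    by (rule open_halfspace_lt, rule open_halfspace_gt)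
  then obtain u w where u: "u \<in> rel_interior S" "a \<bullet> u < c" and w: "w \<in> rel_interior S" "c < a \<bullet> w"
    using cl assms open_Int_closure_eq_empty[of "{z. a \<bullet> z < c}" "rel_interior S"]
      open_Int_closure_eq_empty[of "{z. c < a \<bullet> z}" "rel_interior S"] by blast
  define t where "t = (c - a \<bullet> u) / (a \<bullet> w - a \<bullet> u)"
  have t: "0 \<le> t" "t \<le> 1" using u w by (auto simp: t_def divide_simps)
  have "a \<bullet> ((1 - t) *\<^sub>R u + t *\<^sub>R w) = a \<bullet> u + t * (a \<bullet> w - a \<bullet> u)"
    by (simp add: inner_add_right algebra_simps)
  also have "\<dots> = c" using u w by (simp add: t_def)
  finally have "a \<bullet> ((1 - t) *\<^sub>R u + t *\<^sub>R w) = c" .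
  moreover have "(1 - t) *\<^sub>R u + t *\<^sub>R w \<in> rel_interior S"
    using convexD_alt[OF cr u(1) w(1) t] .
  ultimately show ?thesis by blast
qed

lemma segment_meets_hyperplane:
  assumes "a \<bullet> x < c" "c < a \<bullet> y"
  obtains z where "z \<in> open_segment x y" "a \<bullet> z = c"
proof -
  define t where "t = (c - a \<bullet> x) / (a \<bullet> y - a \<bullet> x)"
  have t: "0 < t" "t < 1" using assms by (auto simp: t_def divide_simps)
  have "a \<bullet> ((1 - t) *\<^sub>R x + t *\<^sub>R y) = a \<bullet> x + t * (a \<bullet> y - a \<bullet> x)"
    by (simp add: inner_add_right algebra_simps)
  also have "\<dots> = c" using assms by (simp add: t_def)
  finally have "a \<bullet> ((1 - t) *\<^sub>R x + t *\<^sub>R y) = c" .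
  moreover have "x \<noteq> y" using assms by auto
  ultimately show ?thesis using that t by (auto simp: in_segment)
qed

text \<open>The edges at a vertex of a polygon are counted by the end points of the segment which a line
  close to the vertex cuts out.\<close>

lemma polygon_two_edges_at_vertex:
  fixes Q :: "'a::euclidean_space set"
  assumes Q: "polytope Q" and d: "aff_dim Q = 2" and v: "v extreme_point_of Q"
  shows "card {g. g facet_of Q \<and> v \<in> g} = 2"
proof -
  let ?V = "{x. x extreme_point_of Q}"
  have cQ: "convex Q" using Q polytope_imp_convex by blast
  have vQ: "v \<in> Q" using v by (simp add: extreme_point_of_def)
  have hV: "Q = convex hull ?V" "finite ?V" using hull_extreme[OF Q] by auto
  \<comment> \<open>An extreme point lies outside the hull of the other ones, so a hyperplane
    strictly separates it from them; its trace on \<open>Q\<close> is the cutting line.\<close>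
  have "v \<notin> convex hull (?V - {v})"
    using v extreme_point_of_stillconvex[of Q v] cQ hull_minimal[of "?V - {v}" "Q - {v}" convex]
    by (auto simp: extreme_point_of_def)
  moreover have "convex (convex hull (?V - {v}))" "compact (convex hull (?V - {v}))"
    using hV(2) finite_imp_compact_convex_hull by auto
  ultimately obtain a c where ac: "a \<bullet> v < c" "\<And>x. x \<in> convex hull (?V - {v}) \<Longrightarrow> c < a \<bullet> x"
    using separating_hyperplane_closed_point[of "convex hull (?V - {v})" v] compact_imp_closed by blast
  have gt: "c < a \<bullet> w" if "w extreme_point_of Q" "w \<noteq> v" for w
    using ac(2) that hull_inc[of w "?V - {v}"] by auto
  let ?H = "{y. a \<bullet> y = c}"
  have "?V \<noteq> {v}" using hV d by auto
  then obtain w0 where w0: "w0 extreme_point_of Q" "w0 \<noteq> v" using v by blast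
  have w0Q: "w0 \<in> Q" using w0 by (simp add: extreme_point_of_def)
  have ri: "rel_interior Q \<inter> ?H \<noteq> {}"
    using rel_interior_meets_hyperplane[OF cQ vQ w0Q ac(1) gt[OF w0]] .
  let ?R = "Q \<inter> ?H"
  have dR: "aff_dim ?R = 1" using aff_dim_Int_hyperplane[OF cQ ri vQ] ac(1) d by auto
  have pR: "polytope ?R"
    using polytope_Int_polyhedron[OF Q polyhedron_hyperplane] .
  obtain r s where rs: "r \<noteq> s" "{x. x extreme_point_of ?R} = {r, s}"
    using one_dim_polytope[OF pR dR] by metis
  have facetR: "{x} facet_of ?R \<longleftrightarrow> x extreme_point_of ?R" for x
    by (simp add: facet_of_def dR face_of_singleton)
  \<comment> \<open>An edge at \<open>v\<close> has its other end beyond the hyperplane and crosses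
    it exactly once; the crossing points turn out to be the end points of \<open>?R\<close>.\<close>
  define cut where "cut g = (THE x. g \<inter> ?H = {x})" for g
  have cut: "g \<inter> ?H = {cut g}" "cut g extreme_point_of ?R"
    if g: "g facet_of Q" "v \<in> g" for g
  proof -
    have gQ: "g face_of Q" "aff_dim g = 1" using g d by (auto simp: facet_of_def)
    obtain p q where pq: "p \<noteq> q" "g = closed_segment p q" "{x. x extreme_point_of g} = {p, q}"
      using one_dim_polytope[OF polytope_face[OF Q gQ(1)] gQ(2)] by metis
    have "v extreme_point_of g" using v g extreme_point_of_face[OF gQ(1)] by blast
    then have "v = p \<or> v = q" using pq(3) by blast
    then obtain w where w: "g = closed_segment v w" "w \<noteq> v" "w extreme_point_of g"
    proof
      assume "v = p"
      then show thesis using that[of q] pq by auto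
    next
      assume "v = q"
      then show thesis using that[of p] pq closed_segment_commute by auto
    qed
    then have "w extreme_point_of Q" using extreme_point_of_face[OF gQ(1)] by blast
    then have aw: "c < a \<bullet> w" using gt w(2) by blast
    obtain z where z: "z \<in> open_segment v w" "a \<bullet> z = c"
      using segment_meets_hyperplane[OF ac(1) aw] by blast
    have "g \<inter> ?H = {z}"
    proof -
      have "y = z" if y: "y \<in> g" "a \<bullet> y = c" for y
      proof -
        obtain t where t: "y = (1 - t) *\<^sub>R v + t *\<^sub>R w"
          using y(1) unfolding w(1) in_segment by blast
        obtain u where u: "z = (1 - u) *\<^sub>R v + u *\<^sub>R w"
          using z(1) by (auto simp: in_segment)
        have "a \<bullet> v + t * (a \<bullet> w - a \<bullet> v) = a \<bullet> v + u * (a \<bullet> w - a \<bullet> v)"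
          using y(2) z(2) unfolding t u by (simp add: inner_add_right algebra_simps)
        then have "t = u" using ac(1) aw by simp
        then show ?thesis using t u by simp
      qed
      then show ?thesis using z w(1) segment_open_subset_closed by auto
    qed
    then show *: "g \<inter> ?H = {cut g}" unfolding cut_def by auto
    have "(g \<inter> ?H) face_of ?R" using face_of_slice[OF gQ(1) convex_hyperplane] .
    then show "cut g extreme_point_of ?R" using * face_of_singleton by metis
  qed
  have "bij_betw cut {g. g facet_of Q \<and> v \<in> g} {r, s}"
  proof (rule bij_betwI')
    fix g g' assume g: "g \<in> {g. g facet_of Q \<and> v \<in> g}" "g' \<in> {g. g facet_of Q \<and> v \<in> g}"
    show "(cut g = cut g') = (g = g')"
    proof
      assume eq: "cut g = cut g'"
      show "g = g'"
      proof (rule ccontr)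
        \<comment> \<open>Two distinct edges meet in a set of dimension below one, which cannot
          contain both \<open>v\<close> and the crossing point.\<close>
        assume "g \<noteq> g'"
        then have I: "(g \<inter> g') face_of Q" "aff_dim (g \<inter> g') < 1"
          using face_Int_distinct_facets[OF cQ, of g g'] g d by auto
        have "v \<in> g \<inter> g'" "cut g \<in> g \<inter> g'" "a \<bullet> cut g = c"
          using g cut[of g] cut[of g'] eq by auto
        moreover have "v \<noteq> cut g" using ac(1) calculation(3) by auto
        ultimately have "aff_dim {v, cut g} \<le> aff_dim (g \<inter> g')"
          by (intro aff_dim_subset) auto
        then show False using I(2) \<open>v \<noteq> cut g\<close> by (simp add: aff_dim_2)
      qed
    qed auto
  next
    fix g assume g: "g \<in> {g. g facet_of Q \<and> v \<in> g}"
    then show "cut g \<in> {r, s}" using cut(2) rs(2) by blast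
  next
    fix x assume "x \<in> {r, s}"
    then have "{x} facet_of ?R" using rs(2) facetR by blast
    then obtain g where g: "g facet_of Q" "{x} = g \<inter> ?H"
      using facet_of_hyperplane_section[OF Q ri] by metis
    have gQ: "g face_of Q" using g facet_of_def by blast
    have "v \<in> g"
    proof (rule ccontr)
      \<comment> \<open>An edge avoiding \<open>v\<close> has all its vertices strictly beyond the
        hyperplane and cannot reach it.\<close>
      assume nv: "v \<notin> g"
      have "c < a \<bullet> x"
      proof (rule extreme_less[OF polytope_face[OF Q gQ]])
        show "x \<in> g" using g(2) by blast
        show "c < a \<bullet> y" if "y extreme_point_of g" for y
          using that extreme_point_of_face[OF gQ] gt nv by blast
      qed
      then show False using g(2) by auto
    qed
    moreover have "cut g = x" using cut(1)[OF g(1) calculation] g(2) by auto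
    ultimately show "\<exists>g\<in>{g. g facet_of Q \<and> v \<in> g}. x = cut g" using g(1) by auto
  qed
  then have "card {g. g facet_of Q \<and> v \<in> g} = card {r, s}" by (rule bij_betw_same_card)
  then show ?thesis using rs(1) by simp
qed

text \<open>Slicing turns the facets of \<open>T\<close> through \<open>x\<close> that meet the
  hyperplane in more than \<open>x\<close> into the edges of the polygon at its vertex
  \<open>x\<close>, of which there are two; \<open>dis\<close> makes slicing injective. It is
  applied with \<open>x\<close> the midpoint of an edge and with \<open>x\<close> a vertex of
  \<open>T\<close>.\<close>

lemma hyperplane_section_two_facets:
  fixes T :: "'a::euclidean_space set"
  assumes T: "polytope T" and d: "aff_dim T = 3"
    and pq: "p \<in> T" "q \<in> T" "a \<bullet> p < c" "c < a \<bullet> q"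
    and x: "x extreme_point_of (T \<inter> {y. a \<bullet> y = c})"
    and F: "\<F> = {f. f facet_of T \<and> x \<in> f \<and> f \<inter> {y. a \<bullet> y = c} \<noteq> {x}}"
    and dis: "\<And>f f'. f \<in> \<F> \<Longrightarrow> f' \<in> \<F> \<Longrightarrow> f \<noteq> f' \<Longrightarrow> f \<inter> f' \<inter> {y. a \<bullet> y = c} \<subseteq> {x}"
  shows "card \<F> = 2"
proof -
  let ?H = "{y. a \<bullet> y = c}"
  let ?Q = "T \<inter> ?H"
  have cT: "convex T" using T polytope_imp_convex by blast
  have ri: "rel_interior T \<inter> ?H \<noteq> {}"
    using rel_interior_meets_hyperplane[OF cT pq] .
  have dQ: "aff_dim ?Q = 2" using aff_dim_Int_hyperplane[OF cT ri pq(1)] pq(3) d by auto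
  have pQ: "polytope ?Q" using polytope_Int_polyhedron[OF T polyhedron_hyperplane] .
  have cQ: "convex ?Q" using pQ polytope_imp_convex by blast
  have xH: "a \<bullet> x = c" using x by (auto simp: extreme_point_of_def)
  have facet: "(f \<inter> ?H) facet_of ?Q" "aff_dim (f \<inter> ?H) = 1" if f: "f \<in> \<F>" for f
  proof -
    have fT: "f face_of T" "f facet_of T" and xf: "x \<in> f" and ne: "f \<inter> ?H \<noteq> {x}"
      using f F by (auto simp: facet_of_def)
    have *: "(f \<inter> ?H) face_of ?Q" using face_of_slice[OF fT(1) convex_hyperplane] .
    have "f \<inter> rel_interior T = {}"
      using face_of_disjoint_rel_interior[OF fT(1)] fT(2) facet_of_irrefl by blast
    then have "f \<inter> ?H \<noteq> ?Q" using ri rel_interior_subset[of T] by blast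
    then have lt: "aff_dim (f \<inter> ?H) < 2" using face_of_aff_dim_lt[OF cQ *] dQ by simp
    obtain y where y: "y \<in> f \<inter> ?H" "y \<noteq> x" using ne xf xH by auto
    then have "aff_dim {x, y} \<le> aff_dim (f \<inter> ?H)" using xf xH by (intro aff_dim_subset) auto
    then have "1 \<le> aff_dim (f \<inter> ?H)" using y(2) by (simp add: aff_dim_2)
    then show 1: "aff_dim (f \<inter> ?H) = 1" using lt by linarith
    show "(f \<inter> ?H) facet_of ?Q" using * y(1) 1 dQ by (auto simp: facet_of_def)
  qed
  have "bij_betw (\<lambda>f. f \<inter> ?H) \<F> {g. g facet_of ?Q \<and> x \<in> g}"
  proof (rule bij_betwI')
    fix f f' assume f: "f \<in> \<F>" "f' \<in> \<F>"
    show "(f \<inter> ?H = f' \<inter> ?H) = (f = f')"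
    proof
      assume eq: "f \<inter> ?H = f' \<inter> ?H"
      show "f = f'"
      proof (rule ccontr)
        assume "f \<noteq> f'"
        then have "f \<inter> ?H \<subseteq> {x}" using dis[OF f] eq by blast
        moreover have "x \<in> f \<inter> ?H" "f \<inter> ?H \<noteq> {x}" using f(1) F xH by auto
        ultimately show False by blast
      qed
    qed auto
  next
    fix f assume "f \<in> \<F>"
    then show "f \<inter> ?H \<in> {g. g facet_of ?Q \<and> x \<in> g}" using facet F xH by blast
  next
    fix g assume g: "g \<in> {g. g facet_of ?Q \<and> x \<in> g}"
    then obtain f where f: "f facet_of T" "g = f \<inter> ?H"
      using facet_of_hyperplane_section[OF T ri] by blast
    have "aff_dim g = 1" using g dQ by (auto simp: facet_of_def)
    then have "g \<noteq> {x}" by auto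
    then have "f \<in> \<F>" using f g F by blast
    then show "\<exists>f\<in>\<F>. g = f \<inter> ?H" using f(2) by blast
  qed
  then have "card \<F> = card {g. g facet_of ?Q \<and> x \<in> g}" by (rule bij_betw_same_card)
  then show ?thesis using polygon_two_edges_at_vertex[OF pQ dQ x] by simp
qed

text \<open>Double counting of incidences: an edge has two vertices and a vertex lies on two
  edges.\<close>

lemma polygon_card_verts_eq_edges:
  fixes Q :: "'a::euclidean_space set"
  assumes Q: "polytope Q" and d: "aff_dim Q = 2"
  shows "card {e. e facet_of Q} = card {v. v extreme_point_of Q}"
proof -
  have cQ: "convex Q" using Q polytope_imp_convex by blast
  have fin: "finite {e. e facet_of Q}" "finite {v. v extreme_point_of Q}"
    using finite_polytope_facets[OF Q] hull_extreme(2)[OF Q] by auto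
  have "card {v \<in> {v. v extreme_point_of Q}. v \<in> e} = 2" if "e facet_of Q" for e
  proof -
    have e: "e face_of Q" "aff_dim e = 1" using that d by (auto simp: facet_of_def)
    have "{v \<in> {v. v extreme_point_of Q}. v \<in> e} = {v. v extreme_point_of e}"
      using extreme_point_of_face[OF e(1)] by blast
    moreover obtain p q where "p \<noteq> q" "{v. v extreme_point_of e} = {p, q}"
      using one_dim_polytope[OF polytope_face[OF Q e(1)] e(2)] by metis
    ultimately show ?thesis by simp
  qed
  then have "(\<Sum>v\<in>{v. v extreme_point_of Q}. card {e \<in> {e. e facet_of Q}. v \<in> e})
      = (\<Sum>e\<in>{e. e facet_of Q}. 2)"
    by (intro sum_multicount_gen[OF fin(2,1)]) auto
  moreover have "card {e \<in> {e. e facet_of Q}. v \<in> e} = 2" if "v extreme_point_of Q" for v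
    using polygon_two_edges_at_vertex[OF Q d that] by simp
  ultimately show ?thesis by simp
qed

section \<open>Euler's formula\<close>

text \<open>Only the minimum and the maximum of \<open>h\<close> fail to have values on both sides;
  injectivity makes each of them unique, and \<open>2 \<le> card A\<close> makes them
  distinct.\<close>

lemma card_nonmiddle:
  fixes h :: "'a \<Rightarrow> real"
  assumes "finite A" "inj_on h A" "2 \<le> card A"
  shows "card {v \<in> A. \<not> (\<exists>p\<in>A. \<exists>q\<in>A. h p < h v \<and> h v < h q)} = 2"
proof -
  have ne: "A \<noteq> {}" using assms(3) by auto
  have "Min (h ` A) \<in> h ` A" "Max (h ` A) \<in> h ` A" using assms(1) ne by auto
  then obtain m M where "m \<in> A" "h m = Min (h ` A)" "M \<in> A" "h M = Max (h ` A)" by (metis imageE)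
  then have m: "m \<in> A" "\<And>x. x \<in> A \<Longrightarrow> h m \<le> h x" and M: "M \<in> A" "\<And>x. x \<in> A \<Longrightarrow> h x \<le> h M"
    using assms(1) by auto
  have "m \<noteq> M"
  proof
    assume "m = M"
    then have "A \<subseteq> {m}" using m M assms(2) by (metis inj_onD order_antisym singletonI subsetI)
    then show False using assms(3) card_mono[of "{m}" A] by auto
  qed
  moreover have "{v \<in> A. \<not> (\<exists>p\<in>A. \<exists>q\<in>A. h p < h v \<and> h v < h q)} = {m, M}" (is "?L = _")
  proof
    show "?L \<subseteq> {m, M}"
    proof
      fix v assume "v \<in> ?L"
      then have v: "v \<in> A" "\<not> (h m < h v \<and> h v < h M)" using m(1) M(1) by blast+
      then have "h m = h v \<or> h v = h M" using m M by force
      then show "v \<in> {m, M}" using assms(2) v(1) m(1) M(1) by (auto dest: inj_onD)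
    qed
    show "{m, M} \<subseteq> ?L" using m M by (auto simp: not_less)
  qed
  ultimately show ?thesis by simp
qed

text \<open>Each pair of distinct points rules out a hyperplane of functionals, and finitely many
  hyperplanes form a null set.\<close>

lemma generic_functional:
  fixes V :: "'a::euclidean_space set"
  assumes "finite V"
  obtains h :: 'a where "inj_on (\<lambda>x. h \<bullet> x) V"
proof -
  let ?P = "{z \<in> V \<times> V. fst z \<noteq> snd z}" and ?H = "\<lambda>z. {h. (fst z - snd z) \<bullet> h = 0}"
  have fin: "finite (?H ` ?P)" using assms by simp
  have "negligible (\<Union>(?H ` ?P))"
  proof (rule negligible_Union[OF fin])
    fix H assume "H \<in> ?H ` ?P"
    then obtain z where z: "z \<in> ?P" "H = ?H z" by (rule imageE)
    have "fst z - snd z \<noteq> 0" using z(1) by simp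
    then show "negligible H" unfolding z(2) by (intro negligible_hyperplane) simp
  qed
  then have "\<Union>(?H ` ?P) \<noteq> UNIV" using non_negligible_UNIV by metis
  then obtain h where h: "h \<notin> \<Union>(?H ` ?P)" by blast
  have "inj_on (\<lambda>x. h \<bullet> x) V"
  proof (rule inj_onI, rule ccontr)
    fix x y assume "x \<in> V" "y \<in> V" and eq: "h \<bullet> x = h \<bullet> y" and "x \<noteq> y"
    then have "(x, y) \<in> ?P" by simp
    then have "h \<notin> ?H (x, y)" using h by blast
    then have "(x - y) \<bullet> h \<noteq> 0" by simp
    then show False using eq by (simp add: inner_diff_left inner_diff_right inner_commute[of _ h])
  qed
  then show ?thesis using that by blast
qed

section \<open>Incidence of faces, edges and vertices\<close>

locale solid_polytope =
  fixes T :: "(real^3) set"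
  assumes polytope: "polytope T" and interior_nonempty: "interior T \<noteq> {}"
begin

lemma convex: "convex T" and compact: "compact T" and closed: "closed T" and bounded: "bounded T"
  using polytope polytope_imp_convex polytope_imp_compact polytope_imp_closed polytope_imp_bounded
  by auto

lemma aff_dim: "aff_dim T = 3"
  using aff_dim_nonempty_interior[OF interior_nonempty] by simp

lemma rel_interior: "rel_interior T = interior T"
  using interior_nonempty rel_interior_nonempty_interior by blast

lemma finite_verts: "finite (verts T)" and finite_faces: "finite (faces T)"
  and finite_edges: "finite (edges T)"
proof -
  show "finite (verts T)" using hull_extreme(2)[OF polytope] by (simp add: verts_def)
  show "finite (faces T)" using finite_polytope_facets[OF polytope] by (simp add: faces_def)
  have "edges T \<subseteq> {e. e face_of T}" by (auto simp: edges_def edge_of_def)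
  then show "finite (edges T)" using finite_polytope_faces[OF polytope] finite_subset by blast
qed

lemma verts_subset: "verts T \<subseteq> T"
  by (auto simp: verts_def extreme_point_of_def)

lemma faceD:
  assumes "f \<in> faces T"
  shows "f facet_of T" "f face_of T" "polytope f" "aff_dim f = 2" "f \<subseteq> T" "f \<noteq> {}" "convex f" "f \<noteq> T"
proof -
  show 1: "f facet_of T" using assms by (simp add: faces_def)
  then show 2: "f face_of T" "aff_dim f = 2" "f \<noteq> {}" using aff_dim by (auto simp: facet_of_def)
  then show "polytope f" "f \<subseteq> T" using polytope_face[OF polytope] face_of_imp_subset by blast+
  then show "convex f" using polytope_imp_convex by blast
  show "f \<noteq> T" using 2(2) aff_dim by auto
qed

lemma verts_face: "f \<in> faces T \<Longrightarrow> verts f = verts T \<inter> f"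
  using extreme_point_of_face[OF faceD(2)] by (auto simp: verts_def)

lemma edges_face: "f \<in> faces T \<Longrightarrow> edges f = {e \<in> edges T. e \<subseteq> f}"
  using face_of_face[OF faceD(2)] by (auto simp: edges_def edge_of_def)

lemma edges_face_facet: "f \<in> faces T \<Longrightarrow> edges f = {e. e facet_of f}"
  using faceD(4) by (auto simp: edges_def edge_of_def facet_of_def)

lemma edgeE:
  assumes "e \<in> edges T"
  obtains p q where "p \<noteq> q" "e = closed_segment p q" "verts e = {p, q}" "p \<in> verts T" "q \<in> verts T"
    "(p, q) \<in> dir_edges T"
proof -
  have e: "e face_of T" "aff_dim e = 1" using assms by (auto simp: edges_def edge_of_def)
  obtain p q where pq: "p \<noteq> q" "e = closed_segment p q" "{x. x extreme_point_of e} = {p, q}"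
    using one_dim_polytope[OF polytope_face[OF polytope e(1)] e(2)] by metis
  then have "p \<in> verts T" "q \<in> verts T"
    using extreme_point_of_face[OF e(1)] by (auto simp: verts_def)
  then show ?thesis using that[of p q] pq assms by (auto simp: verts_def dir_edges_def)
qed

lemma facet_Int_dim1:
  assumes "f \<in> faces T" "g \<in> faces T" "f \<noteq> g"
  shows "(f \<inter> g) face_of T" "aff_dim (f \<inter> g) \<le> 1" "polytope (f \<inter> g)"
  using face_Int_distinct_facets[OF convex, of f g] assms faceD(1) aff_dim polytope_face[OF polytope]
  by force+

lemma facet_Int_edge:
  assumes "f \<in> faces T" "g \<in> faces T" "f \<noteq> g" "p \<in> f \<inter> g" "q \<in> f \<inter> g" "p \<noteq> q"
  shows "f \<inter> g \<in> edges T"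
proof -
  have "aff_dim {p, q} \<le> aff_dim (f \<inter> g)" using assms by (intro aff_dim_subset) auto
  then have "1 \<le> aff_dim (f \<inter> g)" using assms(6) by (simp add: aff_dim_2)
  then show ?thesis using facet_Int_dim1[OF assms(1-3)] by (simp add: edges_def edge_of_def)
qed

lemma facet_Int_eq_edge:
  assumes "f \<in> faces T" "g \<in> faces T" "f \<noteq> g" "e \<in> edges T" "e \<subseteq> f" "e \<subseteq> g"
  shows "f \<inter> g = e"
proof (rule ccontr)
  assume ne: "f \<inter> g \<noteq> e"
  have e: "e face_of T" "aff_dim e = 1" using assms by (auto simp: edges_def edge_of_def)
  have "e face_of (f \<inter> g)"
    by (rule face_of_subset[OF e(1)]) (use assms faceD(5) in blast)+
  then have "aff_dim e < aff_dim (f \<inter> g)"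
    using face_of_aff_dim_lt facet_Int_dim1(1)[OF assms(1-3)] face_of_imp_convex ne by blast
  then show False using e(2) facet_Int_dim1(2)[OF assms(1-3)] by linarith
qed

text \<open>The plane orthogonal to the edge at its midpoint cuts out a polygon that has the
  midpoint as a vertex. A facet through the midpoint contains the whole edge, so the facets along
  \<open>e\<close> correspond to the edges of the polygon at this vertex.\<close>

lemma two_faces_at_edge:
  assumes e: "e \<in> edges T"
  shows "card {f \<in> faces T. e \<subseteq> f} = 2"
proof -
  obtain p q where pq: "p \<noteq> q" "e = closed_segment p q" "p \<in> verts T" "q \<in> verts T"
    using edgeE[OF e] by metis
  have eT: "e face_of T" using e by (auto simp: edges_def edge_of_def)
  have pqT: "p \<in> T" "q \<in> T" using pq verts_subset by auto
  define a where "a = q - p"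
  define x where "x = midpoint p q"
  define c where "c = a \<bullet> x"
  have x: "x = (1/2) *\<^sub>R (p + q)" by (simp add: x_def midpoint_def)
  have pos: "a \<bullet> a > 0" using pq(1) by (simp add: a_def)
  have a: "a \<bullet> q = a \<bullet> p + a \<bullet> a" by (simp add: a_def inner_diff_right)
  have c: "c = a \<bullet> p + (a \<bullet> a) / 2" by (simp add: c_def x inner_add_right a)
  have ap: "a \<bullet> p < c" "c < a \<bullet> q" using c a pos by auto
  let ?H = "{y. a \<bullet> y = c}"
  have xe: "x \<in> e" using pq(2) x_def by simp
  have eH: "e \<inter> ?H = {x}"
  proof -
    have "y = x" if y: "y \<in> e" "a \<bullet> y = c" for y
    proof -
      obtain t where t: "y = (1 - t) *\<^sub>R p + t *\<^sub>R q" using y(1) pq(2) by (auto simp: in_segment)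
      have "a \<bullet> p + t * (a \<bullet> a) = a \<bullet> p + (a \<bullet> a) / 2"
        using y(2) unfolding t c by (simp add: inner_add_right a algebra_simps)
      then have t2: "t = 1/2" using pos by simp
      show ?thesis unfolding t x t2 by (simp add: scaleR_right_distrib)
    qed
    then show ?thesis using xe by (auto simp: c_def)
  qed
  have "x extreme_point_of (T \<inter> ?H)"
    using face_of_slice[OF eT convex_hyperplane, of a c] eH face_of_singleton by metis
  moreover have "{f \<in> faces T. e \<subseteq> f} = {f. f facet_of T \<and> x \<in> f \<and> f \<inter> ?H \<noteq> {x}}"
  proof (intro set_eqI iffI)
    fix f assume "f \<in> {f \<in> faces T. e \<subseteq> f}"
    then have f: "f \<in> faces T" "e \<subseteq> f" by auto
    have pf: "p \<in> f" "q \<in> f" using f(2) pq(2) by auto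
    have "aff_dim (f \<inter> ?H) = 1"
      using aff_dim_Int_hyperplane[OF faceD(7)[OF f(1)] rel_interior_meets_hyperplane[OF faceD(7)[OF f(1)] pf ap] pf(1)]
        ap(1) faceD(4)[OF f(1)] by auto
    then have "f \<inter> ?H \<noteq> {x}" by auto
    then show "f \<in> {f. f facet_of T \<and> x \<in> f \<and> f \<inter> ?H \<noteq> {x}}"
      using f xe faceD(1) by auto
  next
    fix f assume "f \<in> {f. f facet_of T \<and> x \<in> f \<and> f \<inter> ?H \<noteq> {x}}"
    then have f: "f \<in> faces T" "x \<in> f" by (auto simp: faces_def)
    have "x \<in> open_segment p q" using pq(1) x_def by simp
    then have "p \<in> f \<and> q \<in> f" using face_ofD[OF faceD(2)[OF f(1)]] pqT f(2) by blast
    then show "f \<in> {f \<in> faces T. e \<subseteq> f}"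
      using f(1) pq(2) closed_segment_subset[OF _ _ faceD(7)[OF f(1)]] by auto
  qed
  moreover have "f \<inter> f' \<inter> ?H \<subseteq> {x}"
    if "f \<in> {f \<in> faces T. e \<subseteq> f}" "f' \<in> {f \<in> faces T. e \<subseteq> f}" "f \<noteq> f'" for f f'
    using facet_Int_eq_edge[of f f' e] that e eH by auto
  ultimately show ?thesis
    by (intro hyperplane_section_two_facets[OF polytope aff_dim pqT ap])
qed

text \<open>Stated for a general \<open>S\<close>, since it is used both for the polytope and for
  its facets; the vertices of \<open>S\<close> failing it are the extremal ones.\<close>

definition middle :: "real^3 \<Rightarrow> (real^3) set \<Rightarrow> real^3 \<Rightarrow> bool" where
  "middle h S v \<longleftrightarrow> v \<in> verts S \<and> (\<exists>p\<in>verts S. \<exists>q\<in>verts S. h \<bullet> p < h \<bullet> v \<and> h \<bullet> v < h \<bullet> q)"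

text \<open>The level plane through \<open>v\<close> cuts \<open>T\<close> in a polygon with vertex
  \<open>v\<close>, and a facet has \<open>v\<close> in its middle exactly when the plane cuts it in
  more than \<open>v\<close>. Genericity of \<open>h\<close> enters because no edge lies in a level
  plane.\<close>

lemma two_faces_middle:
  assumes inj: "inj_on (\<lambda>x. h \<bullet> x) (verts T)" and v: "middle h T v"
  shows "card {f \<in> faces T. middle h f v} = 2"
proof -
  obtain p q where pq: "p \<in> verts T" "q \<in> verts T" "h \<bullet> p < h \<bullet> v" "h \<bullet> v < h \<bullet> q"
    and vT: "v \<in> verts T" using v by (auto simp: middle_def)
  have pqT: "p \<in> T" "q \<in> T" using pq verts_subset by auto
  let ?H = "{y. h \<bullet> y = h \<bullet> v}"
  have vx: "v extreme_point_of T" using vT by (simp add: verts_def)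
  have "{v} face_of (T \<inter> ?H)"
    by (rule face_of_subset[of _ T]) (use vx in \<open>auto simp: face_of_singleton extreme_point_of_def\<close>)
  then have 1: "v extreme_point_of (T \<inter> ?H)" by (simp add: face_of_singleton)
  have eq: "{f \<in> faces T. middle h f v} = {f. f facet_of T \<and> v \<in> f \<and> f \<inter> ?H \<noteq> {v}}"
  proof (intro set_eqI iffI)
    fix f assume "f \<in> {f \<in> faces T. middle h f v}"
    then obtain p q where f: "f \<in> faces T" "v \<in> verts f" "p \<in> verts f" "q \<in> verts f"
      "h \<bullet> p < h \<bullet> v" "h \<bullet> v < h \<bullet> q" by (auto simp: middle_def)
    then have pf: "p \<in> f" "q \<in> f" "v \<in> f" using verts_face by auto
    have "aff_dim (f \<inter> ?H) = 1"
      using aff_dim_Int_hyperplane[OF faceD(7)[OF f(1)] rel_interior_meets_hyperplane[OF faceD(7)[OF f(1)] pf(1,2) f(5,6)] pf(1)]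
        f(5) faceD(4)[OF f(1)] by auto
    then have "f \<inter> ?H \<noteq> {v}" by auto
    then show "f \<in> {f. f facet_of T \<and> v \<in> f \<and> f \<inter> ?H \<noteq> {v}}" using f pf faceD(1) by auto
  next
    fix f assume "f \<in> {f. f facet_of T \<and> v \<in> f \<and> f \<inter> ?H \<noteq> {v}}"
    then have f: "f \<in> faces T" "v \<in> f" "f \<inter> ?H \<noteq> {v}" by (auto simp: faces_def)
    have vf: "v \<in> verts f" using verts_face[OF f(1)] vT f(2) by blast
    \<comment> \<open>If the level plane supports the facet, all vertices of the contact face share
      the value of \<open>v\<close>, and injectivity reduces the face to \<open>{v}\<close>.\<close>
    have single: "f \<inter> ?H = {v}" if F: "(f \<inter> ?H) face_of f"
    proof -
      have P: "polytope (f \<inter> ?H)" using polytope_face[OF faceD(3)[OF f(1)] F] .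
      have "{x. x extreme_point_of (f \<inter> ?H)} \<subseteq> {v}"
      proof
        fix x assume "x \<in> {x. x extreme_point_of (f \<inter> ?H)}"
        then have "x extreme_point_of f" "x \<in> ?H" using extreme_point_of_face[OF F] by auto
        then have "x \<in> verts T" "h \<bullet> x = h \<bullet> v" using verts_face[OF f(1)] by (auto simp: verts_def)
        then show "x \<in> {v}" using inj vT by (auto dest: inj_onD)
      qed
      then have "f \<inter> ?H \<subseteq> {v}" using hull_extreme(1)[OF P] hull_mono convex_hull_singleton by metis
      then show ?thesis using f(2) by auto
    qed
    have "\<exists>p\<in>verts f. h \<bullet> p < h \<bullet> v"
    proof (rule ccontr)
      assume "\<not> ?thesis"
      then have "(- h) \<bullet> y \<le> - (h \<bullet> v)" if "y \<in> f" for y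
        using extreme_le[OF faceD(3)[OF f(1)], of "- h" "- (h \<bullet> v)" y] that by (force simp: verts_def)
      then have "(f \<inter> {y. h \<bullet> y = h \<bullet> v}) face_of f"
        by (intro face_of_Int_supporting_hyperplane_ge faceD(7) f(1)) auto
      then show False using single f(3) by blast
    qed
    moreover have "\<exists>p\<in>verts f. h \<bullet> v < h \<bullet> p"
    proof (rule ccontr)
      assume "\<not> ?thesis"
      then have "h \<bullet> y \<le> h \<bullet> v" if "y \<in> f" for y
        using extreme_le[OF faceD(3)[OF f(1)], of h "h \<bullet> v" y] that by (force simp: verts_def)
      then have "(f \<inter> {y. h \<bullet> y = h \<bullet> v}) face_of f"
        by (intro face_of_Int_supporting_hyperplane_le faceD(7) f(1)) auto
      then show False using single f(3) by blast
    qed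
    ultimately show "f \<in> {f \<in> faces T. middle h f v}" using vf f(1) by (auto simp: middle_def)
  qed
  have 3: "f \<inter> f' \<inter> ?H \<subseteq> {v}"
    if "f \<in> {f \<in> faces T. middle h f v}" "f' \<in> {f \<in> faces T. middle h f v}" "f \<noteq> f'" for f f'
  proof
    fix y assume y: "y \<in> f \<inter> f' \<inter> ?H"
    have f: "f \<in> faces T" "f' \<in> faces T" "v \<in> f \<inter> f'"
      using that verts_face by (auto simp: middle_def)
    show "y \<in> {v}"
    proof (rule ccontr)
      assume "y \<notin> {v}"
      \<comment> \<open>A second common point would make the two facets share an edge at
        \<open>v\<close>; its other end has a different level, so the edge meets the level plane in
        \<open>v\<close> only.\<close>
      then have "f \<inter> f' \<in> edges T" using facet_Int_edge[OF f(1,2) that(3) f(3), of y] y by auto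
      then obtain r s where rs: "r \<noteq> s" "f \<inter> f' = closed_segment r s" "verts (f \<inter> f') = {r, s}"
        "r \<in> verts T" "s \<in> verts T" using edgeE by metis
      have "v \<in> verts (f \<inter> f')"
        using extreme_point_of_face[OF facet_Int_dim1(1)[OF f(1,2) that(3)]] vx f(3) by (auto simp: verts_def)
      then obtain w where w: "f \<inter> f' = closed_segment v w" "v \<noteq> w" "w \<in> verts T"
        using rs closed_segment_commute by auto
      have "h \<bullet> w \<noteq> h \<bullet> v" using inj w vT by (auto dest: inj_onD)
      moreover obtain t where t: "y = (1 - t) *\<^sub>R v + t *\<^sub>R w" using y w(1) by (auto simp: in_segment)
      moreover have "h \<bullet> v + t * (h \<bullet> w - h \<bullet> v) = h \<bullet> v"
        using y unfolding t by (simp add: inner_add_right algebra_simps)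
      ultimately have "t = 0" by simp
      then show False using t \<open>y \<notin> {v}\<close> by simp
    qed
  qed
  show ?thesis
    by (rule hyperplane_section_two_facets[OF polytope aff_dim pqT pq(3,4) 1 eq]) (use 3 in blast)
qed

lemma card_verts_ge2:
  assumes "polytope (S :: (real^3) set)" "aff_dim S \<ge> 1"
  shows "2 \<le> card (verts S)"
proof (rule ccontr)
  assume "\<not> ?thesis"
  then have "card (verts S) \<le> 1" by simp
  moreover have fin: "finite (verts S)" using hull_extreme(2)[OF assms(1)] by (simp add: verts_def)
  ultimately obtain a where "verts S \<subseteq> {a}" using card_le_Suc0_iff_eq[OF fin] by (cases "verts S = {}") auto
  then have "S \<subseteq> {a}" using hull_extreme(1)[OF assms(1)] hull_mono[of "verts S" "{a}" "convex"]
    by (simp add: verts_def)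
  then have "aff_dim S \<le> aff_dim {a}" by (rule aff_dim_subset)
  then show False using assms(2) by simp
qed

text \<open>Euler's formula by counting, for a generic functional, the pairs of a facet and a vertex at
  which the functional is not extremal on the facet. Every facet has two extremal vertices; at
  every vertex but the two extremal ones of \<open>T\<close>, the horizontal plane cuts out a polygon with that
  vertex, hence exactly two such facets.\<close>

theorem Euler: "card (verts T) + card (faces T) = card (edges T) + 2"
proof -
  obtain h where inj: "inj_on (\<lambda>x. h \<bullet> x) (verts T)"
    using generic_functional[OF finite_verts] by blast
  have split: "card {v \<in> verts S. middle h S v} + 2 = card (verts S)"
    if "polytope S" "aff_dim S \<ge> 1" "verts S \<subseteq> verts T" for S
  proof -
    have fin: "finite (verts S)" using that(3) finite_verts finite_subset by blast
    have "card {v \<in> verts S. \<not> middle h S v} = 2"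
      using card_nonmiddle[OF fin inj_on_subset[OF inj that(3)] card_verts_ge2[OF that(1,2)]]
      by (simp add: middle_def cong: conj_cong)
    moreover have "card (verts S) = card {v \<in> verts S. middle h S v} + card {v \<in> verts S. \<not> middle h S v}"
      using fin by (subst card_Un_disjoint[symmetric]) (auto intro: arg_cong[where f=card])
    ultimately show ?thesis by simp
  qed
  have mid_sub: "v \<in> verts T \<and> middle h T v" if "f \<in> faces T" "middle h f v" for f v
    using that verts_face[OF that(1)] by (auto simp: middle_def)
  have "(\<Sum>v\<in>verts T. card {f \<in> faces T. middle h f v}) = (\<Sum>f\<in>faces T. card {v \<in> verts T. middle h f v})"
    by (rule sum_multicount_gen) (use finite_verts finite_faces in auto)
  moreover have "(\<Sum>v\<in>verts T. card {f \<in> faces T. middle h f v})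
      = (\<Sum>v\<in>verts T. if middle h T v then 2 else 0)"
  proof (rule sum.cong)
    fix v assume "v \<in> verts T"
    show "card {f \<in> faces T. middle h f v} = (if middle h T v then 2 else 0)"
      using two_faces_middle[OF inj, of v] mid_sub[of _ v] by (auto simp: card_eq_0_iff)
  qed simp
  moreover have "\<dots> = 2 * card {v \<in> verts T. middle h T v}"
    using finite_verts by (simp add: sum.If_cases Int_def)
  moreover have "card {v \<in> verts T. middle h T v} + 2 = card (verts T)"
    using split[OF polytope] aff_dim by simp
  moreover have "(\<Sum>f\<in>faces T. card {v \<in> verts T. middle h f v}) + 2 * card (faces T)
      = (\<Sum>f\<in>faces T. card (edges f))"
  proof -
    have "(\<Sum>f\<in>faces T. card {v \<in> verts T. middle h f v} + 2) = (\<Sum>f\<in>faces T. card (edges f))"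
    proof (rule sum.cong)
      fix f assume f: "f \<in> faces T"
      have "{v \<in> verts T. middle h f v} = {v \<in> verts f. middle h f v}"
        using verts_face[OF f] by (auto simp: middle_def)
      moreover have "card {v \<in> verts f. middle h f v} + 2 = card (verts f)"
        by (rule split) (use faceD(3,4)[OF f] verts_face[OF f] in auto)
      moreover have "card (verts f) = card (edges f)"
        using polygon_card_verts_eq_edges[OF faceD(3,4)[OF f]] edges_face_facet[OF f] by (simp add: verts_def)
      ultimately show "card {v \<in> verts T. middle h f v} + 2 = card (edges f)" by simp
    qed simp
    then show ?thesis by (simp only: sum.distrib sum_constant) simp
  qed
  moreover have "(\<Sum>f\<in>faces T. card (edges f)) = 2 * card (edges T)"
  proof -
    have "(\<Sum>f\<in>faces T. card {e \<in> edges T. e \<subseteq> f}) = (\<Sum>e\<in>edges T. 2)"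
      by (rule sum_multicount_gen) (use finite_edges finite_faces two_faces_at_edge in auto)
    then show ?thesis using edges_face by simp
  qed
  \<comment> \<open>The two counts give \<open>2 * (card (verts T) - 2) = 2 * card (edges T) - 2 *
    card (faces T)\<close>.\<close>
  ultimately show ?thesis by linarith
qed

end

section \<open>Connectedness of the dual graph, normals and orientation\<close>

context solid_polytope begin

text \<open>The boundary stays connected when the vertices are removed, and the facets cover it by closed
  sets any two of which meet there only along edges.\<close>

lemma constant_across_edges_imp_constant:
  assumes c: "\<And>f g. f \<in> faces T \<Longrightarrow> g \<in> faces T \<Longrightarrow> f \<noteq> g \<Longrightarrow> f \<inter> g \<in> edges T \<Longrightarrow> c f = (c g :: real)"
    and f: "f \<in> faces T" and g: "g \<in> faces T"
  shows "c f = c g"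
proof (rule ccontr)
  assume ne: "c f \<noteq> c g"
  define X where "X = rel_frontier T - verts T"
  have un: "rel_frontier T = \<Union> (faces T)"
    using rel_frontier_of_polyhedron[OF polytope_imp_polyhedron[OF polytope]] by (simp add: faces_def)
  have "connected X"
  proof -
    have "card (verts T) \<noteq> 0" using card_verts_ge2[OF polytope] aff_dim by simp
    then obtain v where v: "v \<in> verts T" by fastforce
    have "T \<noteq> {v}" using aff_dim by (metis aff_dim_sing zero_neq_numeral)
    then have vf: "v \<in> rel_frontier T"
      using v extreme_point_not_in_REL_INTERIOR[of v T] closed
      by (auto simp: verts_def rel_frontier_def extreme_point_of_def)
    \<comment> \<open>The frontier of a convex body punctured at one point is homeomorphic to a
      plane. With the puncture at a vertex, only the finitely many other vertices are left to be
      removed, and the plane without a finite set is connected.\<close>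
    let ?P = "{y :: real^3. axis 1 1 \<bullet> y = 0}"
    have aP: "affine ?P" "aff_dim ?P = 2" "convex ?P"
      using affine_hyperplane convex_hyperplane aff_dim_hyperplane[of "axis 1 1 :: real^3" 0] by auto
    have "rel_frontier T - {v} homeomorphic ?P"
      by (rule homeomorphic_punctured_sphere_affine_gen) (use convex bounded vf aP aff_dim in auto)
    then obtain h k where hk: "homeomorphism (rel_frontier T - {v}) ?P h k"
      by (auto simp: homeomorphic_def)
    let ?F = "h ` ((rel_frontier T - {v}) \<inter> verts T)"
    have "\<not> collinear ?P" using aP(2) by (simp add: collinear_aff_dim)
    then have "connected (?P - ?F)"
      by (intro connected_convex_diff_countable aP countable_finite finite_imageI finite_Int disjI2 finite_verts)
    moreover have "continuous_on (?P - ?F) k"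
      by (rule continuous_on_subset[of ?P]) (use hk in \<open>auto simp: homeomorphism_def\<close>)
    ultimately have "connected (k ` (?P - ?F))" by (rule connected_continuous_image[rotated])
    moreover have "k ` (?P - ?F) = X"
    proof
      show "k ` (?P - ?F) \<subseteq> X"
      proof
        fix x assume "x \<in> k ` (?P - ?F)"
        then obtain y where y: "y \<in> ?P" "y \<notin> ?F" "x = k y" by blast
        then have "x \<in> rel_frontier T - {v}" "h x = y" using hk by (auto simp: homeomorphism_def)
        then show "x \<in> X" using y(2) by (auto simp: X_def)
      qed
      show "X \<subseteq> k ` (?P - ?F)"
      proof
        fix x assume x: "x \<in> X"
        then have x': "x \<in> rel_frontier T - {v}" using v by (auto simp: X_def)
        then have "h x \<in> ?P" "k (h x) = x" using hk unfolding homeomorphism_def by blast+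
        moreover have "h x \<notin> ?F"
        proof
          assume "h x \<in> ?F"
          then obtain y where "y \<in> rel_frontier T - {v}" "y \<in> verts T" "h x = h y" by blast
          then have "x = y" using hk x' unfolding homeomorphism_def by metis
          then show False using x \<open>y \<in> verts T\<close> by (simp add: X_def)
        qed
        ultimately show "x \<in> k ` (?P - ?F)" by (metis DiffI imageI)
      qed
    qed
    ultimately show ?thesis by simp
  qed
  let ?A = "\<Union>{f' \<in> faces T. c f' = c f}" and ?B = "\<Union>{f' \<in> faces T. c f' \<noteq> c f}"
  have cl: "closed ?A" "closed ?B"
    using finite_faces faceD(3) polytope_imp_closed by (auto intro!: closed_Union)
  have cov: "X \<subseteq> ?A \<union> ?B" using un by (auto simp: X_def)
  have nonvertex: "f' \<inter> X \<noteq> {}" if "f' \<in> faces T" for f'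
  proof -
    have "rel_interior f' \<noteq> {}" using rel_interior_eq_empty[OF faceD(7)] faceD(6) that by blast
    then obtain x where x: "x \<in> rel_interior f'" by blast
    have "f' \<noteq> {x}" using faceD(4)[OF that] by (metis aff_dim_sing zero_neq_numeral)
    then have "x \<notin> verts f'"
      using extreme_point_not_in_REL_INTERIOR[of x f'] x by (auto simp: verts_def)
    moreover have "x \<in> f'" using x rel_interior_subset by blast
    ultimately show ?thesis using verts_face[OF that] un that by (auto simp: X_def)
  qed
  have "?A \<inter> X \<noteq> {}" "?B \<inter> X \<noteq> {}" using nonvertex[OF f] nonvertex[OF g] f g ne by fastforce+
  moreover have "?A \<inter> ?B \<inter> X = {}"
  proof (rule ccontr)
    assume "?A \<inter> ?B \<inter> X \<noteq> {}"
    then obtain y f1 f2 where y: "y \<in> X" and F: "f1 \<in> faces T" "f2 \<in> faces T" "c f1 = c f" "c f2 \<noteq> c f"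
      and yf: "y \<in> f1 \<inter> f2" by blast
    have n: "f1 \<noteq> f2" using F by auto
    \<comment> \<open>A single common point would be a face and hence a vertex, and \<open>X\<close>
      contains no vertex.\<close>
    have "f1 \<inter> f2 \<noteq> {y}"
      using facet_Int_dim1(1)[OF F(1,2) n] y face_of_singleton[of y T] by (auto simp: X_def verts_def)
    then obtain z where "z \<in> f1 \<inter> f2" "z \<noteq> y" using yf by blast
    then have "f1 \<inter> f2 \<in> edges T" using facet_Int_edge[OF F(1,2) n yf] by blast
    then show False using c[OF F(1,2) n] F by simp
  qed
  ultimately show False
    using \<open>connected X\<close> cl cov unfolding connected_closed by blast
qed

end

text \<open>\<open>n\<close>, \<open>t\<close> and \<open>cross3 n t\<close> are mutually
  orthogonal, and the last two have equal length. Multiplying the expansion of \<open>z\<close> by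
  \<open>t \<bullet> t\<close> avoids normalising \<open>t\<close>.\<close>

lemma cross_right_handed_frame:
  fixes n t z :: "real^3"
  assumes n: "norm n = 1" and nt: "n \<bullet> t = 0"
  shows "(t \<bullet> t) *\<^sub>R z = ((t \<bullet> t) * (n \<bullet> z)) *\<^sub>R n + (t \<bullet> z) *\<^sub>R t + (cross3 n t \<bullet> z) *\<^sub>R cross3 n t"
proof -
  define y where "y = z - (n \<bullet> z) *\<^sub>R n"
  have nn: "n \<bullet> n = 1" using n by (simp add: norm_eq_1)
  have ny: "n \<bullet> y = 0" by (simp add: y_def inner_diff_right nn)
  \<comment> \<open>\<open>y\<close> is the part of \<open>z\<close> orthogonal to \<open>n\<close>,
    so its cross product with \<open>t\<close> is a multiple of \<open>n\<close>; crossing once more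
    with \<open>t\<close> recovers \<open>y\<close>.\<close>
  define k where "k = cross3 y t"
  have "cross3 n k = 0" using ny nt by (simp add: k_def Lagrange)
  then have "k = (n \<bullet> k) *\<^sub>R n" using Lagrange[of n n k] nn by simp
  moreover have "n \<bullet> k = - (cross3 n t \<bullet> y)"
    unfolding k_def by (simp add: cross3_simps)
  moreover have "cross3 t k = (t \<bullet> t) *\<^sub>R y - (t \<bullet> y) *\<^sub>R t" by (simp add: k_def Lagrange)
  ultimately have "(t \<bullet> t) *\<^sub>R y - (t \<bullet> y) *\<^sub>R t = - (cross3 n t \<bullet> y) *\<^sub>R cross3 t n"
    by (metis cross_mult_right)
  then have "(t \<bullet> t) *\<^sub>R y = (t \<bullet> y) *\<^sub>R t + (cross3 n t \<bullet> y) *\<^sub>R cross3 n t"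
    using cross_skew[of t n] by (simp add: algebra_simps)
  moreover have "t \<bullet> n = 0" using nt by (simp add: inner_commute)
  then have "t \<bullet> y = t \<bullet> z" "cross3 n t \<bullet> y = cross3 n t \<bullet> z"
    by (simp_all add: y_def inner_diff_right dot_cross_self)
  ultimately have "(t \<bullet> t) *\<^sub>R y = (t \<bullet> z) *\<^sub>R t + (cross3 n t \<bullet> z) *\<^sub>R cross3 n t" by simp
  moreover have "(t \<bullet> t) *\<^sub>R z = (t \<bullet> t) *\<^sub>R y + ((t \<bullet> t) * (n \<bullet> z)) *\<^sub>R n"
    by (simp add: y_def algebra_simps)
  ultimately show ?thesis by simp
qed

lemma cross_orthogonal_parallel:
  fixes a u w :: "real^3"
  assumes "a \<bullet> u = 0" "a \<bullet> w = 0" "cross3 u w \<noteq> 0"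
  obtains k where "a = k *\<^sub>R cross3 u w"
proof -
  have "cross3 (cross3 u w) a = 0"
    using Lagrange[of a u w] assms(1,2) cross_skew[of "cross3 u w" a] by simp
  then have "collinear {0, cross3 u w, a}" by (simp add: cross_eq_0)
  then show ?thesis using assms(3) that by (auto simp: collinear_lemma)
qed

section \<open>Outward normals and supporting planes\<close>

context solid_polytope begin

lemma face_frame:
  assumes "f \<in> faces T"
  obtains p q r where "p \<in> f" "q \<in> f" "r \<in> f" "cross3 (q - p) (r - p) \<noteq> 0"
proof -
  have nc: "\<not> collinear f" using faceD(4)[OF assms] by (simp add: collinear_aff_dim)
  then have "f \<noteq> {}" by auto
  then obtain p where p: "p \<in> f" by blast
  have "\<not> f \<subseteq> {p}" using nc collinear_subset[OF collinear_sing] by blast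
  then obtain q where q: "q \<in> f" "q \<noteq> p" by blast
  have "insert p (insert q f) = f" using p q by blast
  then obtain r where r: "r \<in> f" "\<not> collinear {p, q, r}" using nc collinear_triples[of p q f] q by metis
  have "\<not> collinear {0, q - p, r - p}"
    using r(2) collinear_3[of q p r] by (simp add: insert_commute)
  then have "cross3 (q - p) (r - p) \<noteq> 0" by (simp add: cross_eq_0)
  then show ?thesis using that p q r by blast
qed

text \<open>The condition under the definite description of \<open>outward_normal\<close>, separated
  so that existence and uniqueness can be shown for it.\<close>

definition is_normal :: "(real^3) set \<Rightarrow> real^3 \<Rightarrow> bool" where
  "is_normal f n \<longleftrightarrow> norm n = 1 \<and> (\<forall>x\<in>f. \<forall>y\<in>T. n \<bullet> y \<le> n \<bullet> x)"

lemma is_normal_orthogonal: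
  assumes "f \<in> faces T" "is_normal f n" "x \<in> f" "y \<in> f"
  shows "n \<bullet> (y - x) = 0"
proof -
  have "n \<bullet> y \<le> n \<bullet> x" "n \<bullet> x \<le> n \<bullet> y"
    using assms faceD(5)[OF assms(1)] unfolding is_normal_def by blast+
  then show ?thesis by (simp add: inner_diff_right)
qed

lemma not_in_plane:
  assumes "n \<noteq> (0::real^3)"
  shows "\<exists>y\<in>T. n \<bullet> y \<noteq> c"
proof (rule ccontr)
  assume "\<not> ?thesis"
  then have "T \<subseteq> {y. n \<bullet> y = c}" by auto
  then have "interior T \<subseteq> interior {y. n \<bullet> y = c}" by (rule interior_mono)
  then show False using interior_hyperplane[OF assms] interior_nonempty by simp
qed

text \<open>Both are unit multiples of the same cross product and agree up to sign; opposite signs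
  would confine \<open>T\<close> to a plane, although it has interior points.\<close>

lemma is_normal_unique:
  assumes f: "f \<in> faces T" and n: "is_normal f n" and m: "is_normal f m"
  shows "n = m"
proof -
  obtain p q r where pqr: "p \<in> f" "q \<in> f" "r \<in> f" "cross3 (q - p) (r - p) \<noteq> 0"
    using face_frame[OF f] by blast
  obtain k where k: "n = k *\<^sub>R cross3 (q - p) (r - p)"
    using cross_orthogonal_parallel[OF _ _ pqr(4)] is_normal_orthogonal[OF f n] pqr by metis
  obtain l where l: "m = l *\<^sub>R cross3 (q - p) (r - p)"
    using cross_orthogonal_parallel[OF _ _ pqr(4)] is_normal_orthogonal[OF f m] pqr by metis
  have "\<bar>k\<bar> * norm (cross3 (q - p) (r - p)) = \<bar>l\<bar> * norm (cross3 (q - p) (r - p))"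
    using n m unfolding is_normal_def k l by simp
  then have "\<bar>k\<bar> = \<bar>l\<bar>" using pqr(4) by simp
  then have "n = m \<or> n = - m" unfolding k l by (auto simp: abs_eq_iff)
  moreover have "n \<noteq> - m"
  proof
    assume nm: "n = - m"
    have "n \<bullet> y = n \<bullet> p" if "y \<in> T" for y
    proof -
      have "n \<bullet> y \<le> n \<bullet> p" "m \<bullet> y \<le> m \<bullet> p" using n m that pqr(1) unfolding is_normal_def by blast+
      then show ?thesis using nm by simp
    qed
    moreover have "n \<noteq> 0" using n by (auto simp: is_normal_def)
    ultimately show False using not_in_plane by blast
  qed
  ultimately show ?thesis by blast
qed

lemma is_normal_exists:
  assumes f: "f \<in> faces T"
  obtains n where "is_normal f n"
proof -
  obtain a b where ab: "a \<noteq> 0" "T \<subseteq> {x. a \<bullet> x \<le> b}" "f = T \<inter> {x. a \<bullet> x = b}"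
    using facet_of_polyhedron[OF polytope_imp_polyhedron[OF polytope] faceD(1)[OF f]] by blast
  have "a \<bullet> y \<le> a \<bullet> x" if "x \<in> f" "y \<in> T" for x y using ab that by auto
  then have "is_normal f (a /\<^sub>R norm a)"
    using ab(1) by (auto simp: is_normal_def intro!: mult_left_mono)
  then show ?thesis using that by blast
qed

lemma is_normal_outward: "f \<in> faces T \<Longrightarrow> is_normal f (outward_normal T f)"
proof -
  assume f: "f \<in> faces T"
  have "\<exists>!n. is_normal f n" using is_normal_exists[OF f] is_normal_unique[OF f] by metis
  then show ?thesis unfolding outward_normal_def is_normal_def by (rule theI')
qed

lemma norm_outward_normal: "f \<in> faces T \<Longrightarrow> norm (outward_normal T f) = 1"
  and outward_normal_le: "f \<in> faces T \<Longrightarrow> x \<in> f \<Longrightarrow> y \<in> T \<Longrightarrow> outward_normal T f \<bullet> (y - x) \<le> 0"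
  and outward_normal_orthogonal: "f \<in> faces T \<Longrightarrow> x \<in> f \<Longrightarrow> y \<in> f \<Longrightarrow> outward_normal T f \<bullet> (y - x) = 0"
proof -
  show "norm (outward_normal T f) = 1" if "f \<in> faces T"
    using is_normal_outward[OF that] by (simp add: is_normal_def)
  show "outward_normal T f \<bullet> (y - x) \<le> 0" if "f \<in> faces T" "x \<in> f" "y \<in> T"
    using is_normal_outward[OF that(1)] that(2,3) by (simp add: is_normal_def inner_diff_right)
  show "outward_normal T f \<bullet> (y - x) = 0" if "f \<in> faces T" "x \<in> f" "y \<in> f"
    using is_normal_orthogonal[OF that(1) is_normal_outward[OF that(1)] that(2,3)] .
qed

text \<open>Meant for gradients of functions that are constant along the face: orthogonality to two
  independent directions leaves only the normal direction.\<close>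

lemma orthogonal_face_imp_normal:
  assumes f: "f \<in> faces T" and x: "x \<in> f" and a: "\<And>y. y \<in> f \<Longrightarrow> a \<bullet> (y - x) = 0"
  shows "a = (a \<bullet> outward_normal T f) *\<^sub>R outward_normal T f"
proof -
  let ?n = "outward_normal T f"
  obtain p q r where pqr: "p \<in> f" "q \<in> f" "r \<in> f" "cross3 (q - p) (r - p) \<noteq> 0"
    using face_frame[OF f] by blast
  have "a \<bullet> (q - p) = 0" "a \<bullet> (r - p) = 0" using a[OF pqr(1)] a[OF pqr(2)] a[OF pqr(3)]
    by (simp_all add: inner_diff_right)
  then obtain k where k: "a = k *\<^sub>R cross3 (q - p) (r - p)"
    using cross_orthogonal_parallel[OF _ _ pqr(4)] by metis
  obtain l where l: "?n = l *\<^sub>R cross3 (q - p) (r - p)"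
    using cross_orthogonal_parallel[OF _ _ pqr(4)] outward_normal_orthogonal[OF f] pqr by metis
  have "l \<noteq> 0" using l norm_outward_normal[OF f] by auto
  then have *: "a = (k / l) *\<^sub>R ?n" unfolding k l by simp
  have "?n \<bullet> ?n = 1" using norm_outward_normal[OF f] by (simp add: norm_eq_1)
  then have "a \<bullet> ?n = k / l" by (subst *) simp
  then show ?thesis using * by simp
qed

text \<open>The supporting plane meets \<open>T\<close> in a face of dimension at most two that
  contains the facet \<open>f\<close>, and so in \<open>f\<close> itself.\<close>

lemma face_eq_supporting:
  assumes f: "f \<in> faces T" and x: "x \<in> f" and y: "y \<in> T" and 0: "outward_normal T f \<bullet> (y - x) = 0"
  shows "y \<in> f"
proof -
  let ?n = "outward_normal T f"
  let ?F = "T \<inter> {z. ?n \<bullet> z = ?n \<bullet> x}"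
  have "z \<in> T \<Longrightarrow> ?n \<bullet> z \<le> ?n \<bullet> x" for z using outward_normal_le[OF f x, of z] by (simp add: inner_diff_right)
  then have F: "?F face_of T" by (rule face_of_Int_supporting_hyperplane_le[OF convex])
  have "?n \<noteq> 0" using norm_outward_normal[OF f] by auto
  then have "?F \<noteq> T" using not_in_plane[of ?n "?n \<bullet> x"] by blast
  then have "aff_dim ?F < 3" using face_of_aff_dim_lt[OF convex F] aff_dim by simp
  moreover have "f \<subseteq> ?F"
  proof
    fix z assume "z \<in> f"
    then show "z \<in> ?F" using outward_normal_orthogonal[OF f x, of z] faceD(5)[OF f] by (auto simp: inner_diff_right)
  qed
  moreover have "f face_of ?F"
    by (rule face_of_subset[OF faceD(2)[OF f]]) (use calculation in auto)
  ultimately have "f = ?F"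
    using face_of_aff_dim_lt[of ?F f] face_of_imp_convex[OF F] faceD(4)[OF f] by force
  then show ?thesis using y 0 by (auto simp: inner_diff_right)
qed

text \<open>With a common point, parallel normals give the same supporting plane and thus the same
  face. The strict inequality in the comparison of orientations rests on this.\<close>

lemma outward_normal_distinct:
  assumes f: "f \<in> faces T" and g: "g \<in> faces T" and ne: "f \<noteq> g" and x: "x \<in> f \<inter> g"
  shows "outward_normal T g \<noteq> k *\<^sub>R outward_normal T f"
proof
  let ?n = "outward_normal T f"
  assume k: "outward_normal T g = k *\<^sub>R ?n"
  have "\<bar>k\<bar> = 1" using norm_outward_normal[OF f] norm_outward_normal[OF g] k by simp
  then have k0: "k \<noteq> 0" by auto
  have "f = g"
  proof (intro set_eqI iffI)
    fix y assume "y \<in> f"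
    then have "outward_normal T g \<bullet> (y - x) = 0" "y \<in> T"
      using outward_normal_orthogonal[OF f, of x y] x k faceD(5)[OF f] by auto
    then show "y \<in> g" using face_eq_supporting[OF g, of x y] x by blast
  next
    fix y assume "y \<in> g"
    then have "?n \<bullet> (y - x) = 0" "y \<in> T"
      using outward_normal_orthogonal[OF g, of x y] x k k0 faceD(5)[OF g] by auto
    then show "y \<in> f" using face_eq_supporting[OF f, of x y] x by blast
  qed
  then show False using ne by simp
qed

section \<open>Orientation of the edges of a face\<close>

lemma face_frame_expansion:
  assumes f: "f \<in> faces T" and "p \<in> f" "q \<in> f" "x \<in> f"
  shows "((q - p) \<bullet> (q - p)) *\<^sub>R (x - p) = ((q - p) \<bullet> (x - p)) *\<^sub>R (q - p)
    + (cross3 (outward_normal T f) (q - p) \<bullet> (x - p)) *\<^sub>R cross3 (outward_normal T f) (q - p)"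
  using cross_right_handed_frame[OF norm_outward_normal[OF f] outward_normal_orthogonal[OF f assms(2,3)], of "x - p"]
    outward_normal_orthogonal[OF f assms(2,4)] by simp

text \<open>Along the face, the functional that exposes the edge is a nonzero multiple of the one
  given by the conormal \<open>cross3 (outward_normal T f) (q - p)\<close>, so the latter has one
  sign on \<open>f\<close> and is not identically zero there. The inequality of truth values says
  that exactly one sign occurs.\<close>

lemma face_side_of_edge:
  assumes f: "f \<in> faces T" and e: "closed_segment p q \<in> edges f" and pq: "p \<noteq> q"
  shows "(\<forall>x\<in>f. cross3 (outward_normal T f) (q - p) \<bullet> (x - p) \<ge> 0) \<noteq>
         (\<forall>x\<in>f. cross3 (outward_normal T f) (q - p) \<bullet> (x - p) \<le> 0)"
    and "\<exists>x\<in>f. cross3 (outward_normal T f) (q - p) \<bullet> (x - p) \<noteq> 0"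
proof -
  let ?m = "cross3 (outward_normal T f) (q - p)"
  have ef: "closed_segment p q facet_of f" using e edges_face_facet[OF f] by blast
  obtain a b where ab: "f \<subseteq> {x. a \<bullet> x \<le> b}" "closed_segment p q = f \<inter> {x. a \<bullet> x = b}"
    using facet_of_polyhedron[OF polytope_imp_polyhedron[OF faceD(3)[OF f]] ef] by metis
  have pf: "p \<in> f" "q \<in> f" "a \<bullet> p = b" "a \<bullet> q = b" using ab(2) ends_in_segment[of p q] by auto
  have tt: "(q - p) \<bullet> (q - p) > 0" using pq by simp
  have key: "((q - p) \<bullet> (q - p)) * (a \<bullet> x - b) = (?m \<bullet> (x - p)) * (a \<bullet> ?m)" if x: "x \<in> f" for x
  proof -
    have "a \<bullet> (((q - p) \<bullet> (q - p)) *\<^sub>R (x - p)) = (?m \<bullet> (x - p)) * (a \<bullet> ?m)"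
      unfolding face_frame_expansion[OF f pf(1,2) x] using pf(3,4)
      by (simp add: inner_add_right inner_diff_right)
    then show ?thesis using pf(3) by (simp add: inner_diff_right)
  qed
  have "aff_dim f = 2" "aff_dim (closed_segment p q) = 1"
    using faceD(4)[OF f] e by (auto simp: edges_def edge_of_def)
  then have "f \<noteq> closed_segment p q" by auto
  then obtain x0 where x0: "x0 \<in> f" "a \<bullet> x0 < b" using ab by fastforce
  have "(?m \<bullet> (x0 - p)) * (a \<bullet> ?m) < 0"
    using key[OF x0(1)] tt x0(2) by (metis diff_less_0_iff_less mult_pos_neg)
  then have am: "a \<bullet> ?m \<noteq> 0" and m0: "?m \<bullet> (x0 - p) \<noteq> 0" by auto
  show "\<exists>x\<in>f. ?m \<bullet> (x - p) \<noteq> 0" using m0 x0 by blast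
  have le: "(?m \<bullet> (x - p)) * (a \<bullet> ?m) \<le> 0" if "x \<in> f" for x
  proof -
    have "a \<bullet> x - b \<le> 0" using ab(1) that by auto
    then show ?thesis using key[OF that] tt by (metis less_imp_le mult_nonneg_nonpos)
  qed
  have "(\<forall>x\<in>f. ?m \<bullet> (x - p) \<ge> 0) \<or> (\<forall>x\<in>f. ?m \<bullet> (x - p) \<le> 0)"
  proof (cases "a \<bullet> ?m < 0")
    case True
    then show ?thesis using le by (auto simp: mult_le_0_iff)
  next
    case False
    then have "a \<bullet> ?m > 0" using am by simp
    then show ?thesis using le by (auto simp: mult_le_0_iff)
  qed
  moreover have "\<not> ((\<forall>x\<in>f. ?m \<bullet> (x - p) \<ge> 0) \<and> (\<forall>x\<in>f. ?m \<bullet> (x - p) \<le> 0))"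
    using m0 x0(1) by force
  ultimately show "(\<forall>x\<in>f. ?m \<bullet> (x - p) \<ge> 0) \<noteq> (\<forall>x\<in>f. ?m \<bullet> (x - p) \<le> 0)" by blast
qed

lemma dir_edges_face:
  assumes "f \<in> faces T"
  shows "(p, q) \<in> dir_edges f \<longleftrightarrow> (p, q) \<in> dir_edges T \<and> closed_segment p q \<subseteq> f"
  using verts_face[OF assms] edges_face[OF assms] ends_in_segment[of p q] by (auto simp: dir_edges_def)

lemma dir_edges_commute: "(p, q) \<in> dir_edges S \<longleftrightarrow> (q, p) \<in> dir_edges S"
  by (auto simp: dir_edges_def closed_segment_commute)

text \<open>Reversing the edge reverses the conormal, and exactly one of the two conormals points
  into the face.\<close>

lemma face_boundary_flip:
  assumes f: "f \<in> faces T" and e: "(p, q) \<in> dir_edges f"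
  shows "(q, p) \<in> face_boundary T f \<longleftrightarrow> (p, q) \<notin> face_boundary T f"
proof -
  let ?m = "cross3 (outward_normal T f) (q - p)"
  have pq: "closed_segment p q \<in> edges f" "p \<noteq> q" using e by (auto simp: dir_edges_def)
  have "cross3 (outward_normal T f) (p - q) \<bullet> (x - q) = - (?m \<bullet> (x - p))" for x
  proof -
    have "cross3 (outward_normal T f) (p - q) = - ?m" by (metis cross_minus_right minus_diff_eq)
    moreover have "?m \<bullet> (x - q) = ?m \<bullet> (x - p) - ?m \<bullet> (q - p)" by (simp add: inner_diff_right)
    ultimately show ?thesis by (simp add: dot_cross_self)
  qed
  then show ?thesis
    using face_side_of_edge(1)[OF f pq] e dir_edges_commute[of p q f] by (simp add: face_boundary_def)
qed

text \<open>Let n and k be the normals of \<open>f\<close> and \<open>g\<close>, and t the edge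
  vector. As \<open>f\<close> lies below the plane of \<open>g\<close>, the inward conormal of
  \<open>f\<close> satisfies k \<bullet> (n \<times> t) < 0. The triple product is skew, so n
  \<bullet> (k \<times> t) > 0; as \<open>g\<close> lies below the plane of \<open>f\<close>, the
  vector k \<times> t points out of \<open>g\<close>.\<close>

lemma face_boundary_opposite:
  assumes f: "f \<in> faces T" and g: "g \<in> faces T" and ne: "f \<noteq> g"
    and pf: "(p, q) \<in> face_boundary T f" and pg: "(p, q) \<in> dir_edges g"
  shows "(q, p) \<in> face_boundary T g"
proof -
  let ?n = "outward_normal T f" and ?k = "outward_normal T g" and ?t = "q - p"
  let ?m = "cross3 ?n ?t" and ?l = "cross3 ?k ?t"
  have ef: "(p, q) \<in> dir_edges f" "\<And>x. x \<in> f \<Longrightarrow> ?m \<bullet> (x - p) \<ge> 0" using pf by (auto simp: face_boundary_def)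
  have e: "closed_segment p q \<in> edges f" "closed_segment p q \<in> edges g" "p \<noteq> q"
    using ef(1) pg by (auto simp: dir_edges_def)
  then have sub: "closed_segment p q \<subseteq> f" "closed_segment p q \<subseteq> g"
    using edges_face[OF f] edges_face[OF g] by auto
  then have mem: "p \<in> f" "q \<in> f" "p \<in> g" "q \<in> g" using ends_in_segment by blast+
  have tt: "?t \<bullet> ?t > 0" using e(3) by simp
  have nt: "?n \<bullet> ?t = 0" "?k \<bullet> ?t = 0"
    using outward_normal_orthogonal f g mem by blast+
  have skew: "?n \<bullet> ?l = - (?k \<bullet> ?m)" by (simp add: cross3_simps)
  obtain x0 where x0: "x0 \<in> f" "?m \<bullet> (x0 - p) > 0"
    using face_side_of_edge(2)[OF f e(1,3)] ef(2) by force
  have "(?t \<bullet> ?t) * (?k \<bullet> (x0 - p)) = (?m \<bullet> (x0 - p)) * (?k \<bullet> ?m)"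
  proof -
    have "?k \<bullet> ((?t \<bullet> ?t) *\<^sub>R (x0 - p)) = (?m \<bullet> (x0 - p)) * (?k \<bullet> ?m)"
      unfolding face_frame_expansion[OF f mem(1,2) x0(1)] using nt(2) by (simp add: inner_add_right)
    then show ?thesis by simp
  qed
  moreover have "(?t \<bullet> ?t) * (?k \<bullet> (x0 - p)) \<le> 0"
    using tt outward_normal_le[OF g mem(3), of x0] faceD(5)[OF f] x0(1)
    by (intro mult_nonneg_nonpos) auto
  ultimately have km: "?k \<bullet> ?m \<le> 0" using x0(2) by (simp add: mult_le_0_iff)
  have "?k \<bullet> ?m \<noteq> 0"
  proof
    \<comment> \<open>Orthogonal to the edge and to the conormal, \<open>?k\<close> would be a
      multiple of \<open>?n\<close>.\<close>
    assume "?k \<bullet> ?m = 0"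
    then have "(?t \<bullet> ?t) *\<^sub>R ?k = ((?t \<bullet> ?t) * (?n \<bullet> ?k)) *\<^sub>R ?n"
      using cross_right_handed_frame[OF norm_outward_normal[OF f] nt(1), of ?k] nt(2)
      by (simp add: inner_commute)
    then have "?k = (?n \<bullet> ?k) *\<^sub>R ?n" using tt
      by (metis less_irrefl scaleR_left_imp_eq scaleR_scaleR)
    then show False using outward_normal_distinct[OF f g ne, of p] mem by blast
  qed
  then have pos: "?n \<bullet> ?l > 0" using km skew by simp
  have "?l \<bullet> (y - p) \<le> 0" if y: "y \<in> g" for y
  proof -
    have "?n \<bullet> ((?t \<bullet> ?t) *\<^sub>R (y - p)) = (?l \<bullet> (y - p)) * (?n \<bullet> ?l)"
      unfolding face_frame_expansion[OF g mem(3,4) y] using nt(1) by (simp add: inner_add_right)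
    moreover have "?n \<bullet> ((?t \<bullet> ?t) *\<^sub>R (y - p)) \<le> 0"
      using tt outward_normal_le[OF f mem(1), of y] faceD(5)[OF g] y
      unfolding inner_scaleR_right by (intro mult_nonneg_nonpos) auto
    ultimately show ?thesis using pos by (simp add: mult_le_0_iff)
  qed
  then have "\<not> (\<forall>x\<in>g. ?l \<bullet> (x - p) \<ge> 0)"
    using face_side_of_edge(1)[OF g e(2,3)] by blast
  then have "(p, q) \<notin> face_boundary T g" by (auto simp: face_boundary_def)
  then show ?thesis using face_boundary_flip[OF g pg] by blast
qed

lemma face_boundary_subset: "f \<in> faces T \<Longrightarrow> face_boundary T f \<subseteq> dir_edges T"
  using dir_edges_face by (auto simp: face_boundary_def)

lemma finite_dir_edges: "finite (dir_edges T)"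
  by (rule finite_subset[of _ "verts T \<times> verts T"]) (use finite_verts in \<open>auto simp: dir_edges_def\<close>)

lemma two_faces_of_dir_edge:
  assumes "(p, q) \<in> dir_edges T"
  obtains f g where "f \<in> faces T" "g \<in> faces T" "f \<noteq> g" "{f \<in> faces T. closed_segment p q \<subseteq> f} = {f, g}"
    "(p, q) \<in> face_boundary T f" "(q, p) \<in> face_boundary T g"
proof -
  have "closed_segment p q \<in> edges T" using assms by (simp add: dir_edges_def)
  then have "card {f \<in> faces T. closed_segment p q \<subseteq> f} = 2" by (rule two_faces_at_edge)
  then obtain f g where fg: "{f \<in> faces T. closed_segment p q \<subseteq> f} = {f, g}" "f \<noteq> g"
    unfolding card_2_iff by blast
  then have "f \<in> {f \<in> faces T. closed_segment p q \<subseteq> f}" "g \<in> {f \<in> faces T. closed_segment p q \<subseteq> f}"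
    by simp_all
  then have F: "f \<in> faces T" "g \<in> faces T" "closed_segment p q \<subseteq> f" "closed_segment p q \<subseteq> g" by simp_all
  then have d: "(p, q) \<in> dir_edges f" "(p, q) \<in> dir_edges g"
    using assms dir_edges_face by blast+
  show ?thesis
  proof (cases "(p, q) \<in> face_boundary T f")
    case True
    then show ?thesis using that[of f g] fg F face_boundary_opposite[OF F(1,2) fg(2) True d(2)] by blast
  next
    case False
    then have "(q, p) \<in> face_boundary T f" using face_boundary_flip[OF F(1) d(1)] by blast
    then have "(p, q) \<in> face_boundary T g"
      using face_boundary_opposite[OF F(1,2) fg(2), of q p] d(2) dir_edges_commute by blast
    then show ?thesis using that[of g f] fg F \<open>(q, p) \<in> face_boundary T f\<close> by blast
  qed
qed

end

section \<open>Smooth bump functions\<close>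

lemma power_over_fact_le_exp:
  fixes x :: real
  assumes "0 \<le> x"
  shows "x ^ n / fact n \<le> exp x"
proof -
  have "(\<lambda>n. x ^ n /\<^sub>R fact n) sums exp x" by (rule exp_converges)
  then have s: "summable (\<lambda>n. x ^ n /\<^sub>R fact n)" and e: "exp x = (\<Sum>n. x ^ n /\<^sub>R fact n)"
    by (auto simp: sums_iff)
  have "(\<Sum>k\<in>{n}. x ^ k /\<^sub>R fact k) \<le> (\<Sum>n. x ^ n /\<^sub>R fact n)"
    by (rule sum_le_suminf[OF s]) (use assms in auto)
  then show ?thesis by (simp add: e divide_inverse mult.commute)
qed

text \<open>The classical flat function is the case \<open>m = 0\<close>; the powers of
  \<open>1 / t\<close> make the family closed under differentiation up to linear
  combinations.\<close>

definition flat_exp :: "nat \<Rightarrow> real \<Rightarrow> real" where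
  "flat_exp m t = (if t > 0 then (1 / t) ^ m * exp (- (1 / t)) else 0)"

text \<open>The term of degree \<open>m + 2\<close> in the series of \<open>exp (1 / t)\<close>
  outweighs \<open>(1 / t) ^ m\<close> and leaves the square that makes the difference quotient at
  \<open>0\<close> tend to zero.\<close>

lemma flat_exp_bound: "\<bar>flat_exp m t\<bar> \<le> fact (m + 2) * t\<^sup>2"
proof (cases "t > 0")
  case True
  have "(1 / t) ^ (m + 2) / fact (m + 2) \<le> exp (1 / t)"
    using True by (intro power_over_fact_le_exp) simp
  then have le: "(1 / t) ^ (m + 2) \<le> fact (m + 2) * exp (1 / t)"
    by (simp only: divide_le_eq fact_gt_zero if_True mult.commute)
  have "\<bar>flat_exp m t\<bar> = (1 / t) ^ (m + 2) * (t\<^sup>2 * exp (- (1 / t)))"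
    using True by (simp add: flat_exp_def power2_eq_square)
  also have "\<dots> \<le> fact (m + 2) * exp (1 / t) * (t\<^sup>2 * exp (- (1 / t)))"
    by (rule mult_right_mono[OF le]) simp
  also have "\<dots> = fact (m + 2) * t\<^sup>2" by (simp add: exp_minus)
  finally show ?thesis .
next
  case False
  then show ?thesis by (simp add: flat_exp_def)
qed

lemma flat_exp_has_derivative:
  "(flat_exp m has_real_derivative - real m * flat_exp (m + 1) t + flat_exp (m + 2) t) (at t)"
proof -
  consider "t > 0" | "t < 0" | "t = 0" by linarith
  then show ?thesis
  proof cases
    case 1
    have "((\<lambda>t. (1 / t) ^ m * exp (- (1 / t))) has_real_derivative
        - real m * flat_exp (m + 1) t + flat_exp (m + 2) t) (at t)"
    proof (cases m)
      case 0
      then show ?thesis using 1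
        by (auto intro!: derivative_eq_intros simp: flat_exp_def field_simps power2_eq_square)
    next
      case (Suc n)
      show ?thesis unfolding Suc using 1
        by (auto intro!: derivative_eq_intros simp del: power_Suc simp: flat_exp_def field_simps)
          (simp add: field_simps power2_eq_square)
    qed
    then show ?thesis
      by (rule has_field_derivative_transform_within_open[of _ _ _ "{0<..}"]) (use 1 in \<open>auto simp: flat_exp_def\<close>)
  next
    case 2
    have "((\<lambda>t. 0) has_real_derivative - real m * flat_exp (m + 1) t + flat_exp (m + 2) t) (at t)"
      using 2 by (simp add: flat_exp_def)
    then show ?thesis
      by (rule has_field_derivative_transform_within_open[of _ _ _ "{..<0}"]) (use 2 in \<open>auto simp: flat_exp_def\<close>)
  next
    case 3
    have "((\<lambda>h. fact (m + 2) * \<bar>h\<bar>) \<longlongrightarrow> fact (m + 2) * \<bar>0::real\<bar>) (at 0)"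
      by (intro tendsto_intros)
    then have lim: "((\<lambda>h. fact (m + 2) * \<bar>h\<bar>) \<longlongrightarrow> (0::real)) (at 0)" by simp
    have "norm (flat_exp m h / h) \<le> fact (m + 2) * \<bar>h\<bar>" if "h \<noteq> 0" for h
      using flat_exp_bound[of m h] that by (simp add: abs_divide divide_le_eq power2_eq_square abs_mult mult.assoc)
    then have "((\<lambda>h. flat_exp m h / h) \<longlongrightarrow> 0) (at 0)"
      by (intro Lim_null_comparison[OF _ lim]) (auto simp: eventually_at_filter)
    then have "(flat_exp m has_real_derivative 0) (at 0)"
      by (simp add: DERIV_def flat_exp_def)
    then show ?thesis using 3 by (simp add: flat_exp_def)
  qed
qed

text \<open>An algebra that contains the bump and is stable under directional derivatives;
  membership therefore yields differentiability of every order without a formula for higher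
  derivatives.\<close>

inductive_set bump_algebra :: "'a::euclidean_space \<Rightarrow> real \<Rightarrow> ('a \<Rightarrow> real) set" for c r where
  const: "(\<lambda>x. k) \<in> bump_algebra c r"
| lin: "(\<lambda>x. x \<bullet> v) \<in> bump_algebra c r"
| flat: "(\<lambda>x. flat_exp m (r - (x - c) \<bullet> (x - c))) \<in> bump_algebra c r"
| add: "f \<in> bump_algebra c r \<Longrightarrow> g \<in> bump_algebra c r \<Longrightarrow> (\<lambda>x. f x + g x) \<in> bump_algebra c r"
| mult: "f \<in> bump_algebra c r \<Longrightarrow> g \<in> bump_algebra c r \<Longrightarrow> (\<lambda>x. f x * g x) \<in> bump_algebra c r"

lemma bump_algebra_derivative:
  assumes "f \<in> bump_algebra c r"
  shows "\<exists>f'. (\<forall>x. (f has_derivative f' x) (at x)) \<and> (\<forall>h. (\<lambda>x. f' x h) \<in> bump_algebra c r)"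
  using assms
proof induction
  case (const k)
  have "(\<lambda>x. 0) \<in> bump_algebra c r" by (rule bump_algebra.const)
  then show ?case by (intro exI[of _ "\<lambda>x h. 0"]) auto
next
  case (lin v)
  have "(\<lambda>x. h \<bullet> v) \<in> bump_algebra c r" for h by (rule bump_algebra.const)
  then show ?case
    by (intro exI[of _ "\<lambda>x h. h \<bullet> v"]) (auto intro!: derivative_eq_intros)
next
  case (flat m)
  let ?q = "\<lambda>x. r - (x - c) \<bullet> (x - c)"
  \<comment> \<open>The derivative is written with sums and products of generators only, so that the
    introduction rules of the algebra apply to it.\<close>
  let ?f' = "\<lambda>x h. (- real m * flat_exp (m + 1) (?q x) + flat_exp (m + 2) (?q x)) * ((-2) * (x \<bullet> h + (- (c \<bullet> h))))"
  have "((\<lambda>x. flat_exp m (?q x)) has_derivative ?f' x) (at x)" for x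
  proof -
    have "(?q has_derivative (\<lambda>h. (-2) * (x \<bullet> h + (- (c \<bullet> h))))) (at x)"
      by (auto intro!: derivative_eq_intros simp: inner_diff_left inner_diff_right inner_commute)
    from DERIV_compose_FDERIV[OF flat_exp_has_derivative this] show ?thesis
      by (simp add: mult.commute)
  qed
  moreover have "(\<lambda>x. ?f' x h) \<in> bump_algebra c r" for h
    by (intro bump_algebra.add bump_algebra.mult bump_algebra.const bump_algebra.lin bump_algebra.flat)
  ultimately show ?case by (intro exI[of _ ?f'] conjI allI)
next
  case (add f g)
  then obtain f' g' where "\<And>x. (f has_derivative f' x) (at x)" "\<And>h. (\<lambda>x. f' x h) \<in> bump_algebra c r"
    "\<And>x. (g has_derivative g' x) (at x)" "\<And>h. (\<lambda>x. g' x h) \<in> bump_algebra c r" by metis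
  then show ?case
    by (intro exI[of _ "\<lambda>x h. f' x h + g' x h"] conjI allI has_derivative_add bump_algebra.add)
next
  case (mult f g)
  then obtain f' g' where fg: "\<And>x. (f has_derivative f' x) (at x)" "\<And>h. (\<lambda>x. f' x h) \<in> bump_algebra c r"
    "\<And>x. (g has_derivative g' x) (at x)" "\<And>h. (\<lambda>x. g' x h) \<in> bump_algebra c r" by metis
  have "(\<lambda>x. f x * g' x h + f' x h * g x) \<in> bump_algebra c r" for h
    by (intro bump_algebra.add bump_algebra.mult fg mult.hyps)
  moreover have "((\<lambda>x. f x * g x) has_derivative (\<lambda>h. f x * g' x h + f' x h * g x)) (at x)" for x
    by (rule has_derivative_mult[OF fg(1,3)])
  ultimately show ?case by (intro exI[of _ "\<lambda>x h. f x * g' x h + f' x h * g x"]) auto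
qed

lemma Ck_bump_algebra: "f \<in> bump_algebra c r \<Longrightarrow> Ck k f"
proof (induction k arbitrary: f)
  case 0
  then obtain f' where "\<And>x. (f has_derivative f' x) (at x)" using bump_algebra_derivative by blast
  then show ?case by (auto intro!: has_derivative_continuous_on)
next
  case (Suc k)
  then show ?case using bump_algebra_derivative[OF Suc.prems] by (auto simp del: Ck.simps(1))
qed

lemma Ck_bounded_linear:
  assumes "bounded_linear L"
  shows "Ck k f \<Longrightarrow> Ck k (\<lambda>x. L (f x))"
proof (induction k arbitrary: f)
  case 0
  then show ?case using bounded_linear.continuous_on[OF assms] by auto
next
  case (Suc k)
  then obtain f' where f': "\<And>x. (f has_derivative f' x) (at x)" "\<And>h. Ck k (\<lambda>x. f' x h)" by auto
  have "((\<lambda>x. L (f x)) has_derivative (\<lambda>h. L (f' x h))) (at x)" for x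
    by (rule bounded_linear.has_derivative[OF assms f'(1)])
  then show ?case using Suc.IH[OF f'(2)] by (auto intro!: exI[of _ "\<lambda>x h. L (f' x h)"])
qed

definition bump :: "'a::euclidean_space \<Rightarrow> real \<Rightarrow> 'a \<Rightarrow> real" where
  "bump c r x = flat_exp 0 (r\<^sup>2 - (x - c) \<bullet> (x - c))"

lemma bump_nonneg: "0 \<le> bump c r x"
  and bump_pos: "r > 0 \<Longrightarrow> bump c r c > 0"
  and bump_zero: "r > 0 \<Longrightarrow> x \<notin> cball c r \<Longrightarrow> bump c r x = 0"
proof -
  show "0 \<le> bump c r x" "r > 0 \<Longrightarrow> bump c r c > 0" by (auto simp: bump_def flat_exp_def)
  assume r: "r > 0" and "x \<notin> cball c r"
  then have "r < norm (x - c)" by (simp add: dist_norm norm_minus_commute)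
  then have "r\<^sup>2 < (norm (x - c))\<^sup>2" using r by (intro power_strict_mono) auto
  then show "bump c r x = 0" by (simp add: bump_def flat_exp_def power2_norm_eq_inner)
qed

lemma test_function_bump:
  assumes "r > 0" "cball c r \<subseteq> \<Omega>"
  shows "test_function \<Omega> (\<lambda>x. bump c r x *\<^sub>R a)"
proof -
  have "Ck k (bump c r)" for k
    unfolding bump_def[abs_def] by (rule Ck_bump_algebra[OF bump_algebra.flat])
  then have "Ck k (\<lambda>x. bump c r x *\<^sub>R a)" for k
    by (rule Ck_bounded_linear[OF bounded_linear_scaleR_left])
  moreover have "\<exists>K. compact K \<and> K \<subseteq> \<Omega> \<and> (\<forall>x. x \<notin> K \<longrightarrow> bump c r x *\<^sub>R a = 0)"
    using assms bump_zero by (intro exI[of _ "cball c r"]) auto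
  ultimately show ?thesis by (simp add: test_function_def)
qed

lemma continuous_on_test_function: "test_function \<Omega> \<phi> \<Longrightarrow> continuous_on S \<phi>"
  by (meson Ck.simps(1) continuous_on_subset subset_UNIV test_function_def)

lemma integrable_compact_support:
  fixes f :: "'a::euclidean_space \<Rightarrow> real"
  assumes "continuous_on K f" "compact K" "K \<subseteq> \<Omega>" "\<And>x. x \<notin> K \<Longrightarrow> f x = 0"
  shows "integrable lborel f" "(f has_integral (integral\<^sup>L lborel f)) \<Omega>"
proof -
  have "(\<lambda>x. indicator K x *\<^sub>R f x) = f" using assms(4) by (auto simp: fun_eq_iff indicator_def)
  then show i: "integrable lborel f" using borel_integrable_compact[OF assms(2,1)] by simp
  have "(\<lambda>x. if x \<in> \<Omega> then f x else 0) = f" using assms(3,4) by (force simp: fun_eq_iff)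
  then show "(f has_integral (integral\<^sup>L lborel f)) \<Omega>"
    using has_integral_integral_lborel[OF i] has_integral_restrict_UNIV[of \<Omega> f] by simp
qed

text \<open>Fundamental lemma of the calculus of variations: if \<open>d x0\<close> were nonzero,
  testing with a bump around \<open>x0\<close> in the direction of \<open>d x0\<close> would give a
  nonnegative integrand that is positive at \<open>x0\<close>.\<close>

lemma weak_zero_imp_zero:
  fixes d :: "'a::euclidean_space \<Rightarrow> 'b::euclidean_space"
  assumes T: "open \<Omega>" "continuous_on \<Omega> d"
    and weak: "\<And>\<phi>. test_function \<Omega> \<phi> \<Longrightarrow> integral \<Omega> (\<lambda>x. d x \<bullet> \<phi> x) = 0"
    and x: "x0 \<in> \<Omega>"
  shows "d x0 = 0"
proof (rule ccontr)
  assume ne: "d x0 \<noteq> 0"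
  have c: "continuous_on \<Omega> (\<lambda>x. d x \<bullet> d x0)" using T by (intro continuous_intros)
  have "open (\<Omega> \<inter> (\<lambda>x. d x \<bullet> d x0) -` {0<..})"
    by (rule continuous_open_preimage[OF c T(1) open_greaterThan])
  then have "open {x \<in> \<Omega>. 0 < d x \<bullet> d x0}" by (simp add: vimage_def Int_def)
  moreover have "x0 \<in> {x \<in> \<Omega>. 0 < d x \<bullet> d x0}" using x ne by simp
  ultimately obtain r where r: "r > 0" "cball x0 r \<subseteq> {x \<in> \<Omega>. 0 < d x \<bullet> d x0}"
    by (metis open_contains_cball)
  let ?\<phi> = "\<lambda>x. bump x0 r x *\<^sub>R d x0"
  let ?g = "\<lambda>x. d x \<bullet> ?\<phi> x"
  have sub: "cball x0 r \<subseteq> \<Omega>" using r by auto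
  have test: "test_function \<Omega> ?\<phi>" by (rule test_function_bump[OF r(1) sub])
  have cg: "continuous_on (cball x0 r) ?g"
    using continuous_on_test_function[OF test] continuous_on_subset[OF T(2) sub] by (intro continuous_on_inner) auto
  have z: "?g x = 0" if "x \<notin> cball x0 r" for x using bump_zero[OF r(1) that] by simp
  have hi: "(?g has_integral 0) \<Omega>"
    using integrable_compact_support(2)[OF cg compact_cball sub z] weak[OF test] integral_unique by metis
  \<comment> \<open>The integral is restricted to a box around \<open>x0\<close>, where a continuous
    nonnegative integrand with integral zero vanishes.\<close>
  obtain a b where ab: "cbox a b \<subseteq> ball x0 r" "x0 \<in> box a b"
    using open_contains_cbox[OF open_ball centre_in_ball[THEN iffD2, OF r(1)]] by metis
  have sub': "cbox a b \<subseteq> cball x0 r" using ab(1) ball_subset_cball by (rule order_trans)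
  have nn: "0 \<le> ?g x" for x
  proof (cases "x \<in> cball x0 r")
    case True
    then have "0 < d x \<bullet> d x0" using r(2) by blast
    then show ?thesis using bump_nonneg[of x0 r x] by simp
  next
    case False
    show ?thesis by (simp only: z[OF False] order_refl)
  qed
  have cg': "continuous_on (cbox a b) ?g" by (rule continuous_on_subset[OF cg sub'])
  have i: "?g integrable_on cbox a b" by (rule integrable_continuous[OF cg'])
  have "integral (cbox a b) ?g \<le> integral \<Omega> ?g"
    using sub' sub hi nn i by (intro integral_subset_le) (auto simp: integrable_on_def)
  moreover have "0 \<le> integral (cbox a b) ?g" using nn by (intro integral_nonneg[OF i])
  ultimately have "integral (cbox a b) ?g = 0" using weak[OF test] by simp
  then have "(?g has_integral 0) (cbox a b)" using i by (metis integrable_integral)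
  then have "?g x0 = 0"
    by (rule has_integral_0_cbox_imp_0[OF cg' nn]) (use ab(2) box_subset_cbox in blast)+
  then show False using bump_pos[OF r(1), of x0] ne by simp
qed

section \<open>Gradients on convex bodies\<close>

text \<open>On the segment from \<open>x\<close> to \<open>y\<close> the function depends on one
  variable and its one-sided derivative at \<open>0\<close> is unique. Stated without an interior,
  this serves for the tangential part on a planar face as well.\<close>

lemma gradient_unique_along:
  fixes f :: "'a::euclidean_space \<Rightarrow> real"
  assumes S: "convex S" "x \<in> S" "y \<in> S"
    and g: "(f has_derivative (\<lambda>h. g \<bullet> h)) (at x within S)"
    and g': "(f has_derivative (\<lambda>h. g' \<bullet> h)) (at x within S)"
  shows "g \<bullet> (y - x) = g' \<bullet> (y - x)"
proof -
  let ?p = "\<lambda>t. x + t *\<^sub>R (y - x)"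
  have sub: "?p ` {0..1} \<subseteq> S"
  proof
    fix z assume "z \<in> ?p ` {0..1}"
    then obtain t where t: "0 \<le> t" "t \<le> 1" "z = ?p t" by auto
    have "z = (1 - t) *\<^sub>R x + t *\<^sub>R y" unfolding t by (simp add: algebra_simps)
    then show "z \<in> S" using convexD_alt[OF S t(1,2)] by simp
  qed
  have vd: "((f \<circ> ?p) has_vector_derivative (k \<bullet> (y - x))) (at 0 within {0..1})"
    if k: "(f has_derivative (\<lambda>h. k \<bullet> h)) (at x within S)" for k
  proof -
    have "(?p has_derivative (\<lambda>t. t *\<^sub>R (y - x))) (at 0 within {0..1})"
      by (auto intro!: derivative_eq_intros)
    moreover have "(f has_derivative (\<lambda>h. k \<bullet> h)) (at (?p 0) within ?p ` {0..1})"
      using has_derivative_subset[OF k sub] by simp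
    ultimately have "((f \<circ> ?p) has_derivative ((\<lambda>h. k \<bullet> h) \<circ> (\<lambda>t. t *\<^sub>R (y - x)))) (at 0 within {0..1})"
      by (rule diff_chain_within)
    then show ?thesis by (simp add: has_vector_derivative_def o_def)
  qed
  have "at (0::real) within {0..1} \<noteq> bot"
    by (simp add: at_within_Icc_at_right)
  then show ?thesis using vector_derivative_unique_within[OF _ vd[OF g] vd[OF g']] by blast
qed

lemma gradient_unique_within:
  fixes f :: "'a::euclidean_space \<Rightarrow> real"
  assumes S: "convex S" "interior S \<noteq> {}" "x \<in> S"
    and g: "(f has_derivative (\<lambda>h. g \<bullet> h)) (at x within S)"
    and g': "(f has_derivative (\<lambda>h. g' \<bullet> h)) (at x within S)"
  shows "g = g'"
proof -
  note along = gradient_unique_along[OF S(1,3) _ g g']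
  obtain z e where z: "e > 0" "ball z e \<subseteq> S"
    using S(2) by (metis ex_in_conv mem_interior)
  \<comment> \<open>\<open>w\<close> stays in the ball around \<open>z\<close> and differs from
    \<open>z\<close> by a positive multiple of \<open>g - g'\<close>, so comparing the directions
    towards \<open>w\<close> and \<open>z\<close> tests \<open>g - g'\<close> against
    itself.\<close>
  define w where "w = z + (e / 2 / (1 + norm (g - g'))) *\<^sub>R (g - g')"
  have n: "1 + norm (g - g') > 0" by (smt (verit) norm_ge_zero)
  have "norm (w - z) = e / 2 * (norm (g - g') / (1 + norm (g - g')))"
    using n z(1) by (simp add: w_def)
  also have "\<dots> \<le> e / 2 * 1" using n z(1) by (intro mult_left_mono) auto
  finally have "w \<in> S" "z \<in> S" using z by (auto simp: dist_norm norm_minus_commute subset_iff)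
  then have "(g - g') \<bullet> (w - z) = 0"
    using along[of w] along[of z] by (simp add: inner_diff_left inner_diff_right)
  then have "(g - g') \<bullet> (g - g') = 0" using n z(1) by (simp add: w_def)
  then show ?thesis by simp
qed

locale convex_body =
  fixes T :: "'a::euclidean_space set"
  assumes convex_T: "convex T" and compact_T: "compact T" and interior_T: "interior T \<noteq> {}"
begin

lemma grad_eqI:
  assumes "x \<in> T" "(f has_derivative (\<lambda>h. g \<bullet> h)) (at x within T)"
  shows "grad T f x = g"
proof -
  have "(THE g. (f has_derivative (\<lambda>h. g \<bullet> h)) (at x within T)) = g"
    using assms(2) gradient_unique_within[OF convex_T interior_T assms(1)] by (intro the_equality) blast+
  then show ?thesis using assms(1) by (simp add: grad_def zext_def)
qed

lemma grad_outside: "x \<notin> T \<Longrightarrow> grad T f x = 0"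
  by (simp add: grad_def zext_def)

lemma C1_on_grad:
  assumes "C1_on T f"
  shows "continuous_on T (grad T f)"
    and "x \<in> T \<Longrightarrow> (f has_derivative (\<lambda>h. grad T f x \<bullet> h)) (at x within T)"
proof -
  obtain g where g: "continuous_on T g" "\<And>x. x \<in> T \<Longrightarrow> (f has_derivative (\<lambda>h. g x \<bullet> h)) (at x within T)"
    using assms by (auto simp: C1_on_def)
  have eq: "grad T f x = g x" if "x \<in> T" for x using grad_eqI[OF that g(2)[OF that]] .
  show "continuous_on T (grad T f)" using g(1) eq by (simp cong: continuous_on_cong)
  show "x \<in> T \<Longrightarrow> (f has_derivative (\<lambda>h. grad T f x \<bullet> h)) (at x within T)" using g(2) eq by simp
qed

lemma C1_onI:
  assumes "continuous_on T g" "\<And>x. x \<in> T \<Longrightarrow> (f has_derivative (\<lambda>h. g x \<bullet> h)) (at x within T)"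
  shows "C1_on T f" "x \<in> T \<Longrightarrow> grad T f x = g x"
  using assms grad_eqI by (auto simp: C1_on_def)

lemma C1_on_continuous: "C1_on T f \<Longrightarrow> continuous_on T f"
  by (rule has_derivative_continuous_on) (rule C1_on_grad(2))

lemma C1_on_cong:
  assumes "\<And>x. x \<in> T \<Longrightarrow> f x = g x"
  shows "C1_on T f \<longleftrightarrow> C1_on T g" "grad T f = grad T g"
proof -
  have *: "(f has_derivative D) (at x within T) \<longleftrightarrow> (g has_derivative D) (at x within T)" if "x \<in> T" for x D
    using assms that has_derivative_transform[of x T f g D] has_derivative_transform[of x T g f D] by metis
  then show "C1_on T f \<longleftrightarrow> C1_on T g" by (auto simp: C1_on_def)
  show "grad T f = grad T g" using * by (auto simp: grad_def zext_def fun_eq_iff)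
qed

lemma grad_zext: "grad T (zext T f) = grad T f" "C1_on T (zext T f) \<longleftrightarrow> C1_on T f"
  using C1_on_cong[of "zext T f" f] by (auto simp: zext_def)

lemma C1_on_const: "C1_on T (\<lambda>x. c)" "grad T (\<lambda>x. c) = (\<lambda>x. 0)"
proof -
  have *: "((\<lambda>x. c) has_derivative (\<lambda>h. 0 \<bullet> h)) (at x within T)" for x by simp
  show "C1_on T (\<lambda>x. c)" by (rule C1_onI(1)[of "\<lambda>x. 0"]) auto
  show "grad T (\<lambda>x. c) = (\<lambda>x. 0)" using grad_eqI[OF _ *] grad_outside by (auto simp: fun_eq_iff)
qed

lemma C1_on_inner: "C1_on T (\<lambda>x. x \<bullet> v)" "x \<in> T \<Longrightarrow> grad T (\<lambda>x. x \<bullet> v) x = v"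
proof -
  have *: "((\<lambda>x. x \<bullet> v) has_derivative (\<lambda>h. v \<bullet> h)) (at x within T)" for x
    by (auto intro!: derivative_eq_intros simp: inner_commute)
  show "C1_on T (\<lambda>x. x \<bullet> v)" by (rule C1_onI(1)[of "\<lambda>x. v"]) (use * in auto)
  show "x \<in> T \<Longrightarrow> grad T (\<lambda>x. x \<bullet> v) x = v" by (rule grad_eqI[OF _ *])
qed

lemma C1_on_add:
  assumes "C1_on T f" "C1_on T g"
  shows "C1_on T (\<lambda>x. f x + g x)" "grad T (\<lambda>x. f x + g x) = (\<lambda>x. grad T f x + grad T g x)"
proof -
  have *: "((\<lambda>x. f x + g x) has_derivative (\<lambda>h. (grad T f x + grad T g x) \<bullet> h)) (at x within T)" if "x \<in> T" for x
    using has_derivative_add[OF C1_on_grad(2)[OF assms(1) that] C1_on_grad(2)[OF assms(2) that]]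
    by (simp add: inner_add_left)
  show "C1_on T (\<lambda>x. f x + g x)"
    by (rule C1_onI(1)[OF _ *]) (auto intro: continuous_on_add C1_on_grad(1) assms)
  show "grad T (\<lambda>x. f x + g x) = (\<lambda>x. grad T f x + grad T g x)"
    using grad_eqI[OF _ *] grad_outside by (force simp: fun_eq_iff)
qed

lemma C1_on_mult:
  assumes "C1_on T f" "C1_on T g"
  shows "C1_on T (\<lambda>x. f x * g x)"
    "x \<in> T \<Longrightarrow> grad T (\<lambda>x. f x * g x) x = f x *\<^sub>R grad T g x + g x *\<^sub>R grad T f x"
proof -
  have *: "((\<lambda>x. f x * g x) has_derivative (\<lambda>h. (f x *\<^sub>R grad T g x + g x *\<^sub>R grad T f x) \<bullet> h)) (at x within T)" if "x \<in> T" for x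
    using has_derivative_mult[OF C1_on_grad(2)[OF assms(1) that] C1_on_grad(2)[OF assms(2) that]]
    by (simp add: inner_add_left mult.commute)
  show "C1_on T (\<lambda>x. f x * g x)"
    by (rule C1_onI(1)[OF _ *])
      (auto intro!: continuous_on_add continuous_on_scaleR C1_on_grad(1) C1_on_continuous assms)
  show "x \<in> T \<Longrightarrow> grad T (\<lambda>x. f x * g x) x = f x *\<^sub>R grad T g x + g x *\<^sub>R grad T f x"
    using grad_eqI[OF _ *] by blast
qed

lemma C1_on_scale:
  assumes "C1_on T f"
  shows "C1_on T (\<lambda>x. c * f x)" "grad T (\<lambda>x. c * f x) = (\<lambda>x. c *\<^sub>R grad T f x)"
proof -
  show "C1_on T (\<lambda>x. c * f x)" by (rule C1_on_mult(1)[OF C1_on_const(1) assms])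
  have "grad T (\<lambda>x. c * f x) x = c *\<^sub>R grad T f x" for x
    using C1_on_mult(2)[OF C1_on_const(1) assms, of x c] C1_on_const(2)[of c] grad_outside[of x]
    by (cases "x \<in> T") auto
  then show "grad T (\<lambda>x. c * f x) = (\<lambda>x. c *\<^sub>R grad T f x)" by auto
qed

lemma C1_on_sum:
  assumes "finite I" "\<And>i. i \<in> I \<Longrightarrow> C1_on T (f i)"
  shows "C1_on T (\<lambda>x. \<Sum>i\<in>I. f i x)" "grad T (\<lambda>x. \<Sum>i\<in>I. f i x) = (\<lambda>x. \<Sum>i\<in>I. grad T (f i) x)"
  using assms by (induction I) (auto simp: C1_on_const C1_on_add)

text \<open>The gradient is bounded by compactness, and the mean value inequality applies by
  convexity. The constant serves to dominate difference quotients uniformly in the step.\<close>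

lemma C1_on_lipschitz:
  assumes "C1_on T f"
  obtains L where "L \<ge> 0" "\<And>x y. x \<in> T \<Longrightarrow> y \<in> T \<Longrightarrow> \<bar>f x - f y\<bar> \<le> L * norm (x - y)"
proof -
  have "compact (grad T f ` T)" by (rule compact_continuous_image[OF C1_on_grad(1)[OF assms] compact_T])
  then obtain L where L: "L > 0" "\<And>x. x \<in> T \<Longrightarrow> norm (grad T f x) \<le> L"
    using bounded_pos[of "grad T f ` T"] compact_imp_bounded by auto
  have "onorm (\<lambda>h. grad T f x \<bullet> h) \<le> L" if "x \<in> T" for x
  proof (rule onorm_bound)
    fix h
    have "\<bar>grad T f x \<bullet> h\<bar> \<le> norm (grad T f x) * norm h" by (rule Cauchy_Schwarz_ineq2)
    also have "\<dots> \<le> L * norm h" using L(2)[OF that] by (rule mult_right_mono) simp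
    finally show "norm (grad T f x \<bullet> h) \<le> L * norm h" by simp
  qed (use L in simp)
  then have "norm (f x - f y) \<le> L * norm (x - y)" if "x \<in> T" "y \<in> T" for x y
    using differentiable_bound[OF convex_T C1_on_grad(2)[OF assms] _ that] by blast
  then show ?thesis using that[of L] L(1) by auto
qed

lemma grad_zero_outside_support:
  assumes "compact K" "\<And>x. x \<notin> K \<Longrightarrow> s x = 0" "x \<notin> K"
  shows "grad T s x = 0"
proof (cases "x \<in> T")
  case True
  have "open (- K)" by (rule open_Compl[OF compact_imp_closed[OF assms(1)]])
  have "((\<lambda>x. 0) has_derivative (\<lambda>h. 0 \<bullet> h)) (at x within T)" by simp
  then have "(s has_derivative (\<lambda>h. 0 \<bullet> h)) (at x within T)"
    by (rule has_derivative_transform_within_open[OF _ \<open>open (- K)\<close>]) (use assms True in auto)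
  then show ?thesis by (rule grad_eqI[OF True])
qed (rule grad_outside)

section \<open>Integration by parts for functions that are only continuously differentiable\<close>

text \<open>Extensions by zero may jump at the boundary of \<open>T\<close>, so continuity is lost;
  the product is still measurable and dominated by a constant times the shifted function
  \<open>\<bar>s\<bar>\<close> on a compact set.\<close>

lemma correlation_integrable:
  fixes b s :: "'a \<Rightarrow> real"
  assumes b: "continuous_on T b" and s: "continuous_on T s"
  shows "integrable lborel (\<lambda>x. zext T b (x + p) * zext T s (x + q))"
proof -
  let ?b = "zext T b" and ?s = "zext T s"
  have ind: "zext T f = (\<lambda>x. indicator T x *\<^sub>R f x)" for f :: "'a \<Rightarrow> real"
    by (auto simp: zext_def indicator_def)
  have Tb: "T \<in> sets borel" using compact_T by (simp add: borel_compact)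
  have [measurable]: "?b \<in> borel_measurable borel" "?s \<in> borel_measurable borel"
    unfolding ind by (rule borel_measurable_continuous_on_indicator[OF Tb b],
        rule borel_measurable_continuous_on_indicator[OF Tb s])
  obtain B where B: "\<And>x. x \<in> T \<Longrightarrow> \<bar>b x\<bar> \<le> B"
    using compact_imp_bounded[OF compact_continuous_image[OF b compact_T]] by (auto simp: bounded_iff)
  have B': "\<bar>?b x\<bar> \<le> \<bar>B\<bar>" for x using B[of x] by (auto simp: zext_def)
  have "compact ((\<lambda>x. x - q) ` T)" by (intro compact_continuous_image compact_T continuous_intros)
  moreover have "continuous_on ((\<lambda>x. x - q) ` T) (\<lambda>x. \<bar>s (x + q)\<bar> * \<bar>B\<bar>)"
    by (intro continuous_intros continuous_on_compose2[OF s]) auto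
  ultimately have "integrable lborel (\<lambda>x. indicator ((\<lambda>x. x - q) ` T) x *\<^sub>R (\<bar>s (x + q)\<bar> * \<bar>B\<bar>))"
    by (rule borel_integrable_compact)
  then show ?thesis
  proof (rule Bochner_Integration.integrable_bound)
    show "AE x in lborel. norm (?b (x + p) * ?s (x + q)) \<le> norm (indicator ((\<lambda>x. x - q) ` T) x *\<^sub>R (\<bar>s (x + q)\<bar> * \<bar>B\<bar>))"
    proof (rule AE_I2)
      fix x
      show "norm (?b (x + p) * ?s (x + q)) \<le> norm (indicator ((\<lambda>x. x - q) ` T) x *\<^sub>R (\<bar>s (x + q)\<bar> * \<bar>B\<bar>))"
      proof (cases "x + q \<in> T")
        case True
        then have "x \<in> (\<lambda>x. x - q) ` T" by (intro image_eqI[of _ _ "x + q"]) auto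
        then show ?thesis using True B'[of "x + p"]
          by (simp add: zext_def abs_mult mult.commute[of "\<bar>s (x + q)\<bar>"] mult_right_mono del: image_eqI)
      qed (simp add: zext_def)
    qed
  qed measurable
qed

lemma lborel_integral_shift:
  fixes F :: "'a \<Rightarrow> real"
  assumes "F \<in> borel_measurable lborel"
  shows "(\<integral>x. F (x + q) \<partial>lborel) = (\<integral>x. F x \<partial>lborel)"
proof -
  have "integral\<^sup>L (lborel :: 'a measure) F = integral\<^sup>L (distr lborel borel ((+) q)) F"
    by (simp add: lborel_distr_plus)
  also have "\<dots> = (\<integral>x. F (q + x) \<partial>lborel)"
    using assms by (intro integral_distr) auto
  finally show ?thesis by (simp add: add.commute)
qed

lemma difference_quotient_tendsto:
  assumes "C1_on T f" "x \<in> interior T"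
  shows "((\<lambda>t. (zext T f (x + t *\<^sub>R w) - zext T f x) / t) \<longlongrightarrow> grad T f x \<bullet> w) (at 0)"
proof -
  have xT: "x \<in> T" using assms(2) interior_subset by blast
  have "(f has_derivative (\<lambda>h. grad T f x \<bullet> h)) (at x)"
    using C1_on_grad(2)[OF assms(1) xT] at_within_interior[OF assms(2)] by simp
  then have "(zext T f has_derivative (\<lambda>h. grad T f x \<bullet> h)) (at x)"
    by (rule has_derivative_transform_within_open[OF _ open_interior assms(2)])
      (use interior_subset in \<open>auto simp: zext_def\<close>)
  then have 1: "(zext T f has_derivative (\<lambda>h. grad T f x \<bullet> h)) (at (x + 0 *\<^sub>R w))" by simp
  have 2: "((\<lambda>t. x + t *\<^sub>R w) has_derivative (\<lambda>t. t *\<^sub>R w)) (at 0)"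
    by (auto intro!: derivative_eq_intros)
  have "((\<lambda>t. zext T f (x + t *\<^sub>R w)) has_derivative (\<lambda>t. grad T f x \<bullet> (t *\<^sub>R w))) (at 0)"
    by (rule has_derivative_compose[OF 2 1])
  then have "((\<lambda>t. zext T f (x + t *\<^sub>R w)) has_real_derivative (grad T f x \<bullet> w)) (at 0)"
    by (simp add: has_field_derivative_def mult_commute_abs)
  then show ?thesis by (simp add: DERIV_def)
qed

text \<open>With difference quotients in place of derivatives the integral vanishes by translation
  invariance, because the two difference operators commute. The quotients of \<open>s\<close> are taken
  backwards, which makes them adjoint to the forward quotients of \<open>b\<close>.\<close>

lemma has_integral_jacobian_zero:
  assumes b: "C1_on T b" and s: "C1_on T s"
    and K: "compact K" "K \<subseteq> interior T" "\<And>x. x \<notin> K \<Longrightarrow> s x = 0"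
  shows "((\<lambda>x. (grad T b x \<bullet> u) * (grad T s x \<bullet> v) - (grad T b x \<bullet> v) * (grad T s x \<bullet> u)) has_integral 0) (interior T)"
proof -
  obtain \<delta> where d: "\<delta> > 0" "(\<Union>x\<in>K. ball x \<delta>) \<subseteq> interior T"
    using compact_subset_open_imp_ball_epsilon_subset[OF K(1) open_interior K(2)] by blast
  have near: "y \<in> interior T" "y \<in> T" if "k \<in> K" "norm (y - k) < \<delta>" for y k
  proof -
    have "y \<in> ball k \<delta>" using that(2) by (simp add: dist_norm norm_minus_commute)
    then show "y \<in> interior T" using d(2) that(1) by blast
    then show "y \<in> T" using interior_subset by blast
  qed
  have KT: "K \<subseteq> T" using K(2) interior_subset by blast
  define B S where "B = zext T b" and "S = zext T s"
  have S0: "S x = 0" if "x \<notin> K" for x using K(3)[OF that] by (simp add: S_def zext_def)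
  \<comment> \<open>The correlation of \<open>B\<close> and \<open>S\<close>; by translation
    invariance all four integrals in the expansion of \<open>P\<close> are values of it.\<close>
  define A where "A w = (\<integral>x. B (x + w) * S x \<partial>lborel)" for w
  have int: "integrable lborel (\<lambda>x. B (x + p) * S (x + q))" for p q
    unfolding B_def S_def by (rule correlation_integrable[OF C1_on_continuous[OF b] C1_on_continuous[OF s]])
  have corr: "(\<integral>x. B (x + p) * S (x + q) \<partial>lborel) = A (p - q)" for p q
  proof -
    have "(\<lambda>x. B (x + (p - q)) * S x) \<in> borel_measurable lborel"
      using borel_measurable_integrable[OF int[of "p - q" 0]] by simp
    from lborel_integral_shift[OF this, of q] show ?thesis by (simp add: A_def algebra_simps)
  qed
  define P where "P p q x = (B (x + p) - B x) * (S (x - q) - S x)" for p q x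
  have Pexp: "P p q x = B (x + p) * S (x + (- q)) - B (x + p) * S (x + 0) - B (x + 0) * S (x + (- q)) + B (x + 0) * S (x + 0)" for p q x
    by (simp add: P_def algebra_simps)
  have Pint: "integrable lborel (P p q)" for p q
    unfolding Pexp[abs_def] by (intro Bochner_Integration.integrable_add Bochner_Integration.integrable_diff int)
  \<comment> \<open>The right-hand side is symmetric in \<open>p\<close> and \<open>q\<close>, so
    the antisymmetrised product has integral \<open>0\<close> before any limit is taken.\<close>
  have Pval: "(\<integral>x. P p q x \<partial>lborel) = A (p + q) - A p - A q + A 0" for p q
    unfolding Pexp
    by (simp only: Bochner_Integration.integral_add Bochner_Integration.integral_diff
        Bochner_Integration.integrable_add Bochner_Integration.integrable_diff int corr) simp
  \<comment> \<open>A common strict bound on both directions, which keeps the displacements by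
    \<open>h n\<close> times \<open>u\<close> or \<open>v\<close> below
    \<open>\<delta> / 2\<close>.\<close>
  define c where "c = 1 + norm u + norm v"
  have c: "c > 0" "norm u < c" "norm v < c" by (auto simp: c_def add_pos_nonneg)
  define h where "h n = \<delta> / (2 * c) * inverse (real (Suc n))" for n
  have h0: "h n > 0" for n using d(1) c(1) by (simp add: h_def)
  have hlim: "h \<longlonglongrightarrow> 0"
    unfolding h_def[abs_def] using tendsto_mult_right_zero[OF LIMSEQ_inverse_real_of_nat] by blast
  have hsmall: "h n * norm w < \<delta> / 2" if "norm w < c" for n w
  proof -
    have "h n * norm w < h n * c" using that h0 by simp
    also have "\<dots> = \<delta> / 2 * inverse (real (Suc n))" using c(1) by (simp add: h_def)
    also have "\<dots> \<le> \<delta> / 2 * 1" using d(1) by (intro mult_left_mono) (auto simp: inverse_le_1_iff)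
    finally show ?thesis by simp
  qed
  define G where "G n x = (P (h n *\<^sub>R u) (h n *\<^sub>R v) x - P (h n *\<^sub>R v) (h n *\<^sub>R u) x) / (h n)\<^sup>2" for n x
  define f where "f x = - ((grad T b x \<bullet> u) * (grad T s x \<bullet> v) - (grad T b x \<bullet> v) * (grad T s x \<bullet> u))" for x
  have Gint: "integrable lborel (G n)" for n
    unfolding G_def[abs_def] by (intro integrable_divide Bochner_Integration.integrable_diff Pint)
  have G0: "(\<integral>x. G n x \<partial>lborel) = 0" for n
    unfolding G_def by (simp add: Bochner_Integration.integral_diff[OF Pint Pint] Pval add.commute)
  \<comment> \<open>The backward shift is shorter than \<open>\<delta>\<close>, and the
    \<open>\<delta>\<close>-neighbourhood of \<open>K\<close> lies in the interior; hence neither a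
    point outside nor its shift can be in \<open>K\<close>.\<close>
  have off: "P (h n *\<^sub>R p) (h n *\<^sub>R q) x = 0" if "x \<notin> interior T" "norm q < c" for n p q x
  proof -
    have "x \<notin> K" using that(1) K(2) by blast
    moreover have "x - h n *\<^sub>R q \<notin> K"
    proof
      assume k: "x - h n *\<^sub>R q \<in> K"
      have "norm (x - (x - h n *\<^sub>R q)) < \<delta>" using hsmall[OF that(2), of n] h0[of n] d(1) by simp
      then show False using near(1)[OF k] that(1) by blast
    qed
    ultimately show ?thesis by (simp add: P_def S0)
  qed
  have f0: "f x = 0" if "x \<notin> interior T" for x
  proof -
    have "x \<notin> K" using that K(2) by blast
    then show ?thesis using grad_zero_outside_support[OF K(1,3)] by (simp add: f_def)
  qed
  have lim: "(\<lambda>n. G n x) \<longlonglongrightarrow> f x" for x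
  proof (cases "x \<in> interior T")
    case True
    have at0: "filterlim h (at 0) sequentially"
      using hlim h0 by (auto simp: filterlim_at less_imp_neq[THEN not_sym] intro!: always_eventually)
    have q: "(\<lambda>n. (zext T g (x + h n *\<^sub>R w) - zext T g x) / h n) \<longlonglongrightarrow> grad T g x \<bullet> w" if "C1_on T g" for g w
      by (rule filterlim_compose[OF difference_quotient_tendsto[OF that True] at0])
    have "(\<lambda>n. (B (x + h n *\<^sub>R p) - B x) / h n * ((S (x + h n *\<^sub>R (- q)) - S x) / h n))
        \<longlonglongrightarrow> (grad T b x \<bullet> p) * (grad T s x \<bullet> (- q))" for p q
      unfolding B_def S_def by (intro tendsto_mult q b s)
    then have "(\<lambda>n. P (h n *\<^sub>R p) (h n *\<^sub>R q) x / (h n)\<^sup>2) \<longlonglongrightarrow> - ((grad T b x \<bullet> p) * (grad T s x \<bullet> q))" for p q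
      by (simp add: P_def power2_eq_square)
    from tendsto_diff[OF this[of u v] this[of v u]] show ?thesis
      by (simp add: G_def f_def diff_divide_distrib)
  next
    case False
    then show ?thesis using off[OF False] f0[OF False] c by (simp add: G_def)
  qed
  obtain Lb where Lb: "Lb \<ge> 0" "\<And>x y. x \<in> T \<Longrightarrow> y \<in> T \<Longrightarrow> \<bar>b x - b y\<bar> \<le> Lb * norm (x - y)"
    using C1_on_lipschitz[OF b] by blast
  obtain Ls where Ls: "Ls \<ge> 0" "\<And>x y. x \<in> T \<Longrightarrow> y \<in> T \<Longrightarrow> \<bar>s x - s y\<bar> \<le> Ls * norm (x - y)"
    using C1_on_lipschitz[OF s] by blast
  have Pb: "\<bar>P (h n *\<^sub>R p) (h n *\<^sub>R q) x / (h n)\<^sup>2\<bar> \<le> Lb * norm p * (Ls * norm q)"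
    if pq: "norm p < c" "norm q < c" for n p q x
  \<comment> \<open>The product vanishes unless \<open>x\<close> or its backward shift lies in
    \<open>K\<close>; in that case all points involved are within \<open>\<delta>\<close> of
    \<open>K\<close>, hence in \<open>T\<close>, where the Lipschitz bounds hold.\<close>
  proof (cases "x \<in> K \<or> x - h n *\<^sub>R q \<in> K")
    case True
    then obtain k where k: "k \<in> K" "norm (x - k) < \<delta> / 2"
      using hsmall[OF pq(2), of n] h0[of n] d(1) by force
    have tri: "norm (x + w - k) < \<delta>" if "norm w < \<delta> / 2" for w
      using norm_triangle_ineq[of "x - k" w] k(2) that by (simp add: algebra_simps)
    have m: "x \<in> T" "x + h n *\<^sub>R p \<in> T" "x - h n *\<^sub>R q \<in> T"
      using near(2)[OF k(1) tri[of 0]] near(2)[OF k(1) tri[of "h n *\<^sub>R p"]] near(2)[OF k(1) tri[of "- (h n *\<^sub>R q)"]]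
        hsmall[OF pq(1), of n] hsmall[OF pq(2), of n] h0[of n] d(1) by auto
    have "\<bar>B (x + h n *\<^sub>R p) - B x\<bar> \<le> Lb * (h n * norm p)"
      using Lb(2)[OF m(2,1)] m h0[of n] by (simp add: B_def zext_def)
    moreover have "\<bar>S (x - h n *\<^sub>R q) - S x\<bar> \<le> Ls * (h n * norm q)"
      using Ls(2)[OF m(3,1)] m h0[of n] by (simp add: S_def zext_def)
    ultimately have "\<bar>P (h n *\<^sub>R p) (h n *\<^sub>R q) x\<bar> \<le> Lb * (h n * norm p) * (Ls * (h n * norm q))"
      unfolding P_def abs_mult by (intro mult_mono) (use Lb(1) h0[of n] in auto)
    also have "\<dots> = Lb * norm p * (Ls * norm q) * (h n)\<^sup>2" by (simp add: power2_eq_square)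
    finally show ?thesis using h0[of n] by (simp add: divide_le_eq)
  next
    case False
    then show ?thesis using Lb(1) Ls(1) by (simp add: P_def S0)
  qed
  define M where "M = Lb * norm u * (Ls * norm v) + Lb * norm v * (Ls * norm u)"
  have bound: "norm (G n x) \<le> indicator T x *\<^sub>R M" for n x
  proof (cases "x \<in> T")
    case True
    have "\<bar>G n x\<bar> \<le> \<bar>P (h n *\<^sub>R u) (h n *\<^sub>R v) x / (h n)\<^sup>2\<bar> + \<bar>P (h n *\<^sub>R v) (h n *\<^sub>R u) x / (h n)\<^sup>2\<bar>"
      unfolding G_def diff_divide_distrib by (rule abs_triangle_ineq4)
    then have "\<bar>G n x\<bar> \<le> M"
      using Pb[OF c(2,3), of n x] Pb[OF c(3,2), of n x] unfolding M_def by linarith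
    then show ?thesis using True by simp
  next
    case False
    then have "x \<notin> interior T" using interior_subset by blast
    then show ?thesis using off c False by (simp add: G_def)
  qed
  have wint: "integrable lborel (\<lambda>x. indicator T x *\<^sub>R M)"
    by (rule borel_integrable_compact[OF compact_T continuous_on_const])
  have fm: "f \<in> borel_measurable lborel"
    by (rule borel_measurable_LIMSEQ_metric[OF borel_measurable_integrable[OF Gint] lim])
  have fint: "integrable lborel f"
    by (rule integrable_dominated_convergence[where s = G, OF fm borel_measurable_integrable[OF Gint] wint])
      (use lim bound in auto)
  have "(\<lambda>n. \<integral>x. G n x \<partial>lborel) \<longlonglongrightarrow> (\<integral>x. f x \<partial>lborel)"
    by (rule integral_dominated_convergence[where s = G, OF fm borel_measurable_integrable[OF Gint] wint])
      (use lim bound in auto)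
  then have "(\<lambda>n. 0) \<longlonglongrightarrow> (\<integral>x. f x \<partial>lborel)" by (simp only: G0)
  then have "(\<integral>x. f x \<partial>lborel) = 0" by (rule LIMSEQ_unique[OF _ tendsto_const])
  then have "(f has_integral 0) UNIV" using has_integral_integral_lborel[OF fint] by simp
  moreover have "(\<lambda>x. if x \<in> interior T then f x else 0) = f" using f0 by auto
  ultimately have "(f has_integral 0) (interior T)" using has_integral_restrict_UNIV[of "interior T" f] by simp
  then show ?thesis using has_integral_neg[of f 0 "interior T"] by (simp add: f_def)
qed

end

section \<open>Weak curl and weak divergence\<close>

lemma Ck_imp_continuous: "Ck k f \<Longrightarrow> continuous_on S f"
  by (cases k) (auto intro: continuous_on_subset has_derivative_continuous_on has_derivative_at_withinI)

lemma Ck_gradient: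
  fixes f :: "'a::euclidean_space \<Rightarrow> real"
  assumes "Ck (Suc k) f"
  shows "(f has_derivative (\<lambda>h. grad UNIV f x \<bullet> h)) (at x)"
    and "Ck k (\<lambda>x. grad UNIV f x \<bullet> h)"
    and "continuous_on S (grad UNIV f)"
proof -
  obtain f' where f': "\<And>x. (f has_derivative f' x) (at x)" "\<And>h. Ck k (\<lambda>x. f' x h)"
    using assms by auto
  define g where "g x = (\<Sum>i\<in>Basis. f' x i *\<^sub>R i)" for x
  have lin: "linear (f' x)" for x using f'(1) has_derivative_linear by blast
  have g: "g x \<bullet> h = f' x h" for x h
  proof -
    have "f' x h = f' x (\<Sum>i\<in>Basis. (h \<bullet> i) *\<^sub>R i)" by (simp add: euclidean_representation)
    also have "\<dots> = (\<Sum>i\<in>Basis. (h \<bullet> i) * f' x i)"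
      by (simp add: linear_sum[OF lin] linear_cmul[OF lin])
    finally show ?thesis
      unfolding g_def inner_sum_left inner_scaleR_left by (simp add: inner_commute mult.commute)
  qed
  then have d: "(f has_derivative (\<lambda>h. g x \<bullet> h)) (at x)" for x using f'(1)[of x] by (simp add: fun_eq_iff[symmetric])
  have "grad UNIV f x = g x" for x
  proof -
    have "(THE k. (f has_derivative (\<lambda>h. k \<bullet> h)) (at x)) = g x"
      using d[of x] gradient_unique_within[of UNIV x f] by (intro the_equality) auto
    then show ?thesis by (simp add: grad_def zext_def)
  qed
  then have eq: "grad UNIV f = g" by auto
  show "(f has_derivative (\<lambda>h. grad UNIV f x \<bullet> h)) (at x)" using d eq by simp
  show "Ck k (\<lambda>x. grad UNIV f x \<bullet> h)" using f'(2)[of h] g eq by simp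
  show "continuous_on S (grad UNIV f)"
    unfolding eq g_def[abs_def] by (intro continuous_intros Ck_imp_continuous[OF f'(2)])
qed

lemma test_functionD:
  assumes "test_function \<Omega> \<phi>"
  obtains K where "compact K" "K \<subseteq> \<Omega>" "\<And>x. x \<notin> K \<Longrightarrow> \<phi> x = 0"
  using assms by (auto simp: test_function_def)

lemma grad_UNIV_outside_support:
  fixes f :: "'a::euclidean_space \<Rightarrow> real"
  assumes "compact K" "\<And>x. x \<notin> K \<Longrightarrow> f x = 0" "x \<notin> K"
  shows "grad UNIV f x = 0"
proof -
  have "open (- K)" by (rule open_Compl[OF compact_imp_closed[OF assms(1)]])
  have "((\<lambda>x. 0) has_derivative (\<lambda>h. 0 \<bullet> h)) (at x)" by simp
  then have "(f has_derivative (\<lambda>h. 0 \<bullet> h)) (at x)"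
    by (rule has_derivative_transform_within_open[OF _ \<open>open (- K)\<close>]) (use assms in auto)
  note d0 = this
  have "(THE k. (f has_derivative (\<lambda>h. k \<bullet> h)) (at x)) = 0"
    by (rule the_equality[where P = "\<lambda>k. (f has_derivative (\<lambda>h. k \<bullet> h)) (at x)", OF d0],
        rule gradient_unique_within[OF convex_UNIV _ UNIV_I _ d0]) auto
  then show ?thesis by (simp add: grad_def zext_def)
qed

text \<open>Expresses the curl by gradients of the components, the form in which Jacobians of two
  scalar functions can be recognised.\<close>

lemma classical_curl_grad:
  fixes \<phi> :: "real^3 \<Rightarrow> real^3"
  assumes "Ck (Suc k) \<phi>"
  shows "classical_curl \<phi> x = (let D = (\<lambda>j k. grad UNIV (\<lambda>x. \<phi> x $ k) x $ j) in
     vector [D 2 3 - D 3 2, D 3 1 - D 1 3, D 1 2 - D 2 1])"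
proof -
  obtain \<phi>' where d: "(\<phi> has_derivative \<phi>') (at x)" using assms by auto
  have "frechet_derivative \<phi> (at x) (axis j 1) $ k = grad UNIV (\<lambda>x. \<phi> x $ k) x $ j" for j k
  proof -
    have L: "bounded_linear (\<lambda>v :: real^3. v $ k)" by (rule bounded_linear_vec_nth)
    have 1: "((\<lambda>x. \<phi> x $ k) has_derivative (\<lambda>h. \<phi>' h $ k)) (at x)"
      by (rule bounded_linear.has_derivative[OF L d])
    have 2: "((\<lambda>x. \<phi> x $ k) has_derivative (\<lambda>h. grad UNIV (\<lambda>x. \<phi> x $ k) x \<bullet> h)) (at x)"
      by (rule Ck_gradient(1)[OF Ck_bounded_linear[OF L assms]])
    have "\<phi>' (axis j 1) $ k = grad UNIV (\<lambda>x. \<phi> x $ k) x \<bullet> axis j 1"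
      using has_derivative_unique[OF 1 2] by metis
    then show ?thesis using frechet_derivative_at[OF d] by (simp add: inner_axis)
  qed
  then show ?thesis by (simp add: classical_curl_def Let_def)
qed

context convex_body begin

lemma Ck_C1_on:
  assumes "Ck (Suc k) f"
  shows "C1_on T f" "x \<in> T \<Longrightarrow> grad T f x = grad UNIV f x"
  using C1_onI[OF Ck_gradient(3)[OF assms] has_derivative_at_withinI[OF Ck_gradient(1)[OF assms]]] by auto

text \<open>A convex body is the closure of its interior, so continuity carries the vanishing to the
  boundary; representatives continuous up to the boundary are therefore unique.\<close>

lemma continuous_zero_interior_imp_zero:
  fixes d :: "'a \<Rightarrow> 'b::euclidean_space"
  assumes c: "continuous_on T d"
    and weak: "\<And>\<phi>. test_function (interior T) \<phi> \<Longrightarrow> integral (interior T) (\<lambda>x. d x \<bullet> \<phi> x) = 0"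
    and x: "x \<in> T"
  shows "d x = 0"
proof -
  have cl: "closure (interior T) = T"
    using convex_closure_interior[OF convex_T interior_T] compact_imp_closed[OF compact_T] by simp
  have c': "continuous_on (interior T) d" by (rule continuous_on_subset[OF c interior_subset])
  have "d y = 0" if "y \<in> interior T" for y by (rule weak_zero_imp_zero[OF open_interior c' weak that])
  then show ?thesis
    using continuous_constant_on_closure[of "interior T" d 0 x] c x cl by simp
qed

lemma integrable_interior:
  fixes f :: "'a \<Rightarrow> real"
  assumes "continuous_on T f" "compact K" "K \<subseteq> interior T" "\<And>x. x \<notin> K \<Longrightarrow> f x = 0"
  shows "f integrable_on interior T"
proof -
  have "K \<subseteq> T" using assms(3) interior_subset by blast
  then have "continuous_on K f" using assms(1) continuous_on_subset by blast
  from integrable_compact_support(2)[OF this assms(2-4)] show ?thesis by (auto simp: integrable_on_def)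
qed

lemma locally_integrable_continuous:
  fixes u :: "'a \<Rightarrow> 'b::euclidean_space"
  assumes "continuous_on T u"
  shows "locally_integrable (interior T) u"
  unfolding locally_integrable_def
proof (intro allI impI)
  fix K assume K: "compact K \<and> K \<subseteq> interior T"
  then have "continuous_on K u" using assms interior_subset continuous_on_subset by (metis subset_trans)
  then have "integrable lborel (\<lambda>x. indicator K x *\<^sub>R u x)" using borel_integrable_compact K by blast
  then have "integrable lebesgue (\<lambda>x. indicator K x *\<^sub>R u x)"
    using integrable_completion borel_measurable_integrable by blast
  then show "u absolutely_integrable_on K" by (simp add: set_integrable_def)
qed

end

locale convex_body3 = convex_body T for T :: "(real^3) set"
begin

text \<open>A single integral of a difference replaces the equality of two integrals, so that sums
  and multiples follow from the rules for \<open>has_integral\<close>. The continuity clauses single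
  out the representative that \<open>curl\<close> selects.\<close>

definition weak_curl_pair :: "(real^3 \<Rightarrow> real^3) \<Rightarrow> (real^3 \<Rightarrow> real^3) \<Rightarrow> bool" where
  "weak_curl_pair u w \<longleftrightarrow> continuous_on T u \<and> continuous_on T w \<and> zext T w = w \<and>
     (\<forall>\<phi>. test_function (interior T) \<phi> \<longrightarrow>
       ((\<lambda>x. u x \<bullet> classical_curl \<phi> x - w x \<bullet> \<phi> x) has_integral 0) (interior T))"

definition weak_div_pair :: "(real^3 \<Rightarrow> real^3) \<Rightarrow> (real^3 \<Rightarrow> real) \<Rightarrow> bool" where
  "weak_div_pair u g \<longleftrightarrow> continuous_on T u \<and> continuous_on T g \<and> zext T g = g \<and>
     (\<forall>\<phi>. test_function (interior T) \<phi> \<longrightarrow>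
       ((\<lambda>x. u x \<bullet> grad UNIV \<phi> x + g x * \<phi> x) has_integral 0) (interior T))"

lemma inner_test_integrable:
  fixes w :: "real^3 \<Rightarrow> 'b::euclidean_space"
  assumes "continuous_on T w" "test_function (interior T) \<phi>"
  shows "(\<lambda>x. w x \<bullet> \<phi> x) integrable_on interior T"
proof -
  obtain K where K: "compact K" "K \<subseteq> interior T" "\<And>x. x \<notin> K \<Longrightarrow> \<phi> x = 0"
    using test_functionD[OF assms(2)] by blast
  show ?thesis
    by (rule integrable_interior[OF _ K(1,2)])
      (use K(3) in \<open>auto intro!: continuous_on_inner assms continuous_on_test_function[OF assms(2)]\<close>)
qed

lemma zext_eq_iff: "zext S f = f \<longleftrightarrow> (\<forall>x. x \<notin> S \<longrightarrow> f x = 0)"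
  by (auto simp: zext_def fun_eq_iff)

lemma zext_eqI:
  assumes "zext S f = f" "zext S g = g" "\<And>x. x \<in> S \<Longrightarrow> f x = g x"
  shows "f = g"
proof (rule ext)
  fix x
  show "f x = g x"
    using fun_cong[OF assms(1), of x] fun_cong[OF assms(2), of x] assms(3)[of x]
    by (auto simp: zext_def split: if_splits)
qed

lemma weak_pair_unique:
  fixes w w' :: "real^3 \<Rightarrow> 'b::euclidean_space"
  assumes w: "continuous_on T w" "zext T w = w" and w': "continuous_on T w'" "zext T w' = w'"
    and eq: "\<And>\<phi>. test_function (interior T) \<phi> \<Longrightarrow>
       integral (interior T) (\<lambda>x. w x \<bullet> \<phi> x) = integral (interior T) (\<lambda>x. w' x \<bullet> \<phi> x)"
  shows "w = w'"
proof (rule zext_eqI[OF w(2) w'(2)])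
  fix x assume x: "x \<in> T"
  have "w x - w' x = 0"
  proof (rule continuous_zero_interior_imp_zero[OF _ _ x])
    show "continuous_on T (\<lambda>x. w x - w' x)" by (intro continuous_on_diff w w')
    fix \<phi> :: "real^3 \<Rightarrow> 'b" assume t: "test_function (interior T) \<phi>"
    show "integral (interior T) (\<lambda>x. (w x - w' x) \<bullet> \<phi> x) = 0"
      using integral_diff[OF inner_test_integrable[OF w(1) t] inner_test_integrable[OF w'(1) t]] eq[OF t]
      by (simp add: inner_diff_left)
  qed
  then show "w x = w' x" by simp
qed

text \<open>Continuity of \<open>w\<close> makes its pairing with a test function integrable, so the
  single integral splits into the two of \<open>has_weak_curl\<close>.\<close>

lemma curl_eqI:
  assumes "weak_curl_pair u w"
  shows "curl T u = w"
proof -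
  have w: "continuous_on T w" "zext T w = w" and u: "continuous_on T u"
    and wk: "\<And>\<phi>. test_function (interior T) \<phi> \<Longrightarrow>
       ((\<lambda>x. u x \<bullet> classical_curl \<phi> x - w x \<bullet> \<phi> x) has_integral 0) (interior T)"
    using assms by (auto simp: weak_curl_pair_def)
  have eq: "integral (interior T) (\<lambda>x. u x \<bullet> classical_curl \<phi> x) = integral (interior T) (\<lambda>x. w x \<bullet> \<phi> x)"
    if t: "test_function (interior T) \<phi>" for \<phi>
    using has_integral_add[OF wk[OF t] integrable_integral[OF inner_test_integrable[OF w(1) t]]]
    by (simp add: integral_unique)
  have h: "has_weak_curl (interior T) u w"
    unfolding has_weak_curl_def using eq locally_integrable_continuous[OF u] locally_integrable_continuous[OF w(1)] by blast
  show ?thesis unfolding curl_def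
  proof (rule the_equality)
    fix w' assume w': "continuous_on T w' \<and> zext T w' = w' \<and> has_weak_curl (interior T) u w'"
    show "w' = w"
      by (rule weak_pair_unique) (use w' w eq in \<open>auto simp: has_weak_curl_def\<close>)
  qed (use w h in blast)
qed

lemma divergence_eqI:
  assumes "weak_div_pair u g"
  shows "divergence T u = g"
proof -
  have g: "continuous_on T g" "zext T g = g" and u: "continuous_on T u"
    and wk: "\<And>\<phi>. test_function (interior T) \<phi> \<Longrightarrow>
       ((\<lambda>x. u x \<bullet> grad UNIV \<phi> x + g x * \<phi> x) has_integral 0) (interior T)"
    using assms by (auto simp: weak_div_pair_def)
  have eq: "integral (interior T) (\<lambda>x. u x \<bullet> grad UNIV \<phi> x) = - integral (interior T) (\<lambda>x. g x * \<phi> x)"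
    if t: "test_function (interior T) \<phi>" for \<phi>
    using has_integral_diff[OF wk[OF t] integrable_integral[OF inner_test_integrable[OF g(1) t]]]
    by (simp add: integral_unique)
  have h: "has_weak_div (interior T) u g"
    unfolding has_weak_div_def using eq locally_integrable_continuous[OF u] locally_integrable_continuous[OF g(1)] by blast
  show ?thesis unfolding divergence_def
  proof (rule the_equality)
    fix g' assume g': "continuous_on T g' \<and> zext T g' = g' \<and> has_weak_div (interior T) u g'"
    show "g' = g"
      by (rule weak_pair_unique) (use g' g eq in \<open>auto simp: has_weak_div_def\<close>)
  qed (use g h in blast)
qed

lemma weak_curl_pair_zero: "weak_curl_pair 0 0"
  by (simp add: weak_curl_pair_def zext_def fun_eq_iff zero_fun_def)

lemma weak_curl_pair_add:
  assumes "weak_curl_pair u w" "weak_curl_pair u' w'"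
  shows "weak_curl_pair (u + u') (w + w')"
proof -
  have "((\<lambda>x. (u + u') x \<bullet> classical_curl \<phi> x - (w + w') x \<bullet> \<phi> x) has_integral 0) (interior T)"
    if "test_function (interior T) \<phi>" for \<phi>
    using has_integral_add[of "\<lambda>x. u x \<bullet> classical_curl \<phi> x - w x \<bullet> \<phi> x" 0 "interior T"
        "\<lambda>x. u' x \<bullet> classical_curl \<phi> x - w' x \<bullet> \<phi> x" 0] assms that
    by (simp add: weak_curl_pair_def inner_add_left algebra_simps)
  moreover have "zext T (w + w') = w + w'"
    using assms by (simp add: weak_curl_pair_def zext_eq_iff)
  moreover have "continuous_on T (u + u')" "continuous_on T (w + w')"
    using assms by (auto simp: weak_curl_pair_def plus_fun_def intro: continuous_on_add)
  ultimately show ?thesis by (simp add: weak_curl_pair_def)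
qed

lemma weak_curl_pair_scale:
  assumes "weak_curl_pair u w"
  shows "weak_curl_pair (c *\<^sub>R u) (c *\<^sub>R w)"
proof -
  have "((\<lambda>x. (c *\<^sub>R u) x \<bullet> classical_curl \<phi> x - (c *\<^sub>R w) x \<bullet> \<phi> x) has_integral 0) (interior T)"
    if "test_function (interior T) \<phi>" for \<phi>
    using has_integral_mult_right[of "\<lambda>x. u x \<bullet> classical_curl \<phi> x - w x \<bullet> \<phi> x" 0 "interior T" c] assms that
    by (simp add: weak_curl_pair_def scaleR_fun_def algebra_simps)
  moreover have "zext T (c *\<^sub>R w) = c *\<^sub>R w"
    using assms by (simp add: weak_curl_pair_def zext_eq_iff scaleR_fun_def)
  ultimately show ?thesis using assms
    by (auto simp: weak_curl_pair_def scaleR_fun_def intro!: continuous_intros)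
qed

lemma weak_curl_pair_sum:
  "finite I \<Longrightarrow> (\<And>i. i \<in> I \<Longrightarrow> weak_curl_pair (u i) (w i)) \<Longrightarrow> weak_curl_pair (\<Sum>i\<in>I. u i) (\<Sum>i\<in>I. w i)"
  by (induction I rule: finite_induct) (auto simp: weak_curl_pair_zero weak_curl_pair_add)

lemma weak_div_pair_zero: "weak_div_pair 0 0"
  by (simp add: weak_div_pair_def zext_def fun_eq_iff zero_fun_def)

lemma weak_div_pair_add:
  assumes "weak_div_pair u g" "weak_div_pair u' g'"
  shows "weak_div_pair (u + u') (g + g')"
proof -
  have "((\<lambda>x. (u + u') x \<bullet> grad UNIV \<phi> x + (g + g') x * \<phi> x) has_integral 0) (interior T)"
    if "test_function (interior T) \<phi>" for \<phi>
    using has_integral_add[of "\<lambda>x. u x \<bullet> grad UNIV \<phi> x + g x * \<phi> x" 0 "interior T"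
        "\<lambda>x. u' x \<bullet> grad UNIV \<phi> x + g' x * \<phi> x" 0] assms that
    by (simp add: weak_div_pair_def inner_add_left algebra_simps)
  moreover have "zext T (g + g') = g + g'"
    using assms by (simp add: weak_div_pair_def zext_eq_iff)
  moreover have "continuous_on T (u + u')" "continuous_on T (g + g')"
    using assms by (auto simp: weak_div_pair_def plus_fun_def intro: continuous_on_add)
  ultimately show ?thesis by (simp add: weak_div_pair_def)
qed

lemma weak_div_pair_scale:
  assumes "weak_div_pair u g"
  shows "weak_div_pair (c *\<^sub>R u) (c *\<^sub>R g)"
proof -
  have "((\<lambda>x. (c *\<^sub>R u) x \<bullet> grad UNIV \<phi> x + (c *\<^sub>R g) x * \<phi> x) has_integral 0) (interior T)"
    if "test_function (interior T) \<phi>" for \<phi>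
    using has_integral_mult_right[of "\<lambda>x. u x \<bullet> grad UNIV \<phi> x + g x * \<phi> x" 0 "interior T" c] assms that
    by (simp add: weak_div_pair_def scaleR_fun_def algebra_simps)
  moreover have "zext T (c *\<^sub>R g) = c *\<^sub>R g"
    using assms by (simp add: weak_div_pair_def zext_eq_iff scaleR_fun_def)
  ultimately show ?thesis using assms
    by (auto simp: weak_div_pair_def scaleR_fun_def intro!: continuous_intros)
qed

text \<open>With \<open>s\<close> read as a vector field, the integrand is grad b \<bullet> curl s;
  expanded, it groups into three Jacobians of \<open>b\<close> with one component each.\<close>

lemma triple_jacobian_zero:
  assumes b: "C1_on T b" and s: "\<And>k. C1_on T (s k)"
    and K: "compact K" "K \<subseteq> interior T" "\<And>k x. x \<notin> K \<Longrightarrow> s k x = 0"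
  shows "((\<lambda>x. grad T b x \<bullet> vector [grad T (s 3) x $ 2 - grad T (s 2) x $ 3,
      grad T (s 1) x $ 3 - grad T (s 3) x $ 1, grad T (s 2) x $ 1 - grad T (s 1) x $ 2]) has_integral 0) (interior T)"
proof -
  have J: "((\<lambda>x. grad T b x $ i * grad T (s k) x $ j - grad T b x $ j * grad T (s k) x $ i) has_integral 0) (interior T)"
    for i j :: 3 and k
    using has_integral_jacobian_zero[OF b s[of k] K(1,2) K(3)[of _ k], of "axis i 1" "axis j 1"] by (simp add: inner_axis)
  have "((\<lambda>x. (grad T b x $ 1 * grad T (s 3) x $ 2 - grad T b x $ 2 * grad T (s 3) x $ 1)
      + (grad T b x $ 3 * grad T (s 2) x $ 1 - grad T b x $ 1 * grad T (s 2) x $ 3)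
      + (grad T b x $ 2 * grad T (s 1) x $ 3 - grad T b x $ 3 * grad T (s 1) x $ 2)) has_integral 0 + 0 + 0) (interior T)"
    by (intro has_integral_add J)
  then show ?thesis
    by (simp add: inner_vec_def sum_3 algebra_simps)
qed

text \<open>The integral of grad b \<bullet> curl s vanishes for s = a \<phi>, and curl (a \<phi>) =
  a curl \<phi> + grad a \<times> \<phi>. No second derivative of \<open>b\<close> occurs.\<close>

lemma weak_curl_mult_grad:
  assumes a: "C1_on T a" and b: "C1_on T b"
  shows "weak_curl_pair (\<lambda>x. a x *\<^sub>R grad T b x) (\<lambda>x. cross3 (grad T a x) (grad T b x))"
  unfolding weak_curl_pair_def
proof (intro conjI allI impI)
  show "continuous_on T (\<lambda>x. a x *\<^sub>R grad T b x)"
    by (intro continuous_on_scaleR C1_on_continuous C1_on_grad(1) a b)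
  show "continuous_on T (\<lambda>x. cross3 (grad T a x) (grad T b x))"
    by (intro continuous_on_cross C1_on_grad(1) a b)
  show "zext T (\<lambda>x. cross3 (grad T a x) (grad T b x)) = (\<lambda>x. cross3 (grad T a x) (grad T b x))"
    by (auto simp: zext_def fun_eq_iff grad_outside)
  fix \<phi> :: "real^3 \<Rightarrow> real^3" assume t: "test_function (interior T) \<phi>"
  have Ck: "Ck (Suc 0) \<phi>" using t unfolding test_function_def by blast
  have Ckk: "Ck (Suc 0) (\<lambda>x. \<phi> x $ k)" for k by (rule Ck_bounded_linear[OF bounded_linear_vec_nth Ck])
  obtain K where K: "compact K" "K \<subseteq> interior T" "\<And>x. x \<notin> K \<Longrightarrow> \<phi> x = 0"
    using test_functionD[OF t] by blast
  define s where "s k x = a x * \<phi> x $ k" for k x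
  have s: "C1_on T (s k)" "x \<in> T \<Longrightarrow> grad T (s k) x = a x *\<^sub>R grad UNIV (\<lambda>x. \<phi> x $ k) x + \<phi> x $ k *\<^sub>R grad T a x" for k x
    unfolding s_def[abs_def] using C1_on_mult[OF a Ck_C1_on(1)[OF Ckk]] Ck_C1_on(2)[OF Ckk] by auto
  have "((\<lambda>x. grad T b x \<bullet> vector [grad T (s 3) x $ 2 - grad T (s 2) x $ 3,
      grad T (s 1) x $ 3 - grad T (s 3) x $ 1, grad T (s 2) x $ 1 - grad T (s 1) x $ 2]) has_integral 0) (interior T)"
    by (rule triple_jacobian_zero[OF b s(1) K(1,2)]) (simp add: s_def K(3))
  then show "((\<lambda>x. (a x *\<^sub>R grad T b x) \<bullet> classical_curl \<phi> x - cross3 (grad T a x) (grad T b x) \<bullet> \<phi> x) has_integral 0) (interior T)"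
  proof (rule has_integral_eq[rotated])
    fix x assume "x \<in> interior T"
    then have xT: "x \<in> T" using interior_subset by blast
    show "grad T b x \<bullet> vector [grad T (s 3) x $ 2 - grad T (s 2) x $ 3,
        grad T (s 1) x $ 3 - grad T (s 3) x $ 1, grad T (s 2) x $ 1 - grad T (s 1) x $ 2]
      = (a x *\<^sub>R grad T b x) \<bullet> classical_curl \<phi> x - cross3 (grad T a x) (grad T b x) \<bullet> \<phi> x"
      unfolding s(2)[OF xT] classical_curl_grad[OF Ck] Let_def
      by (simp add: inner_vec_def sum_3 cross3_def algebra_simps)
  qed
qed

text \<open>The Jacobian of \<open>s\<close> with a coordinate function of index \<open>j\<close>
  different from \<open>k\<close> reduces to this partial derivative.\<close>

lemma has_integral_partial_zero:
  assumes s: "C1_on T s" and K: "compact K" "K \<subseteq> interior T" "\<And>x. x \<notin> K \<Longrightarrow> s x = 0"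
  shows "((\<lambda>x. grad T s x $ k) has_integral 0) (interior T)"
proof -
  obtain j :: 3 where j: "j \<noteq> k" by (metis (full_types) one_neq_zero zero_neq_one exhaust_3 num1_eq1 zero_neq_numeral)
  have "((\<lambda>x. (grad T (\<lambda>x. x \<bullet> axis j 1) x \<bullet> axis j 1) * (grad T s x \<bullet> axis k 1)
      - (grad T (\<lambda>x. x \<bullet> axis j 1) x \<bullet> axis k 1) * (grad T s x \<bullet> axis j 1)) has_integral 0) (interior T)"
    by (rule has_integral_jacobian_zero[OF C1_on_inner(1) s K])
  then show ?thesis
  proof (rule has_integral_eq[rotated])
    fix x assume "x \<in> interior T"
    then have xT: "x \<in> T" using interior_subset by blast
    show "(grad T (\<lambda>x. x \<bullet> axis j 1) x \<bullet> axis j 1) * (grad T s x \<bullet> axis k 1)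
      - (grad T (\<lambda>x. x \<bullet> axis j 1) x \<bullet> axis k 1) * (grad T s x \<bullet> axis j 1) = grad T s x $ k"
    proof -
      have "axis j 1 \<bullet> axis j (1 :: real) = 1" "axis j 1 \<bullet> axis k (1 :: real) = 0"
        using j by (simp_all add: inner_axis_axis)
      then show ?thesis unfolding C1_on_inner(2)[OF xT] by (simp add: inner_axis[of "grad T s x"])
    qed
  qed
qed

text \<open>The mixed partial derivatives of a test function agree because they do so weakly.\<close>

lemma mixed_partials:
  fixes \<phi> :: "real^3 \<Rightarrow> real"
  assumes t: "test_function (interior T) \<phi>" and x: "x \<in> T"
  shows "grad UNIV (\<lambda>x. grad UNIV \<phi> x $ i) x $ j = grad UNIV (\<lambda>x. grad UNIV \<phi> x $ j) x $ i"
proof -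
  have Ck2: "Ck (Suc (Suc 0)) \<phi>" using t unfolding test_function_def by blast
  have Ck1: "Ck (Suc 0) (\<lambda>x. grad UNIV \<phi> x $ i)" for i
    using Ck_gradient(2)[OF Ck2, of "axis i 1"] by (simp add: inner_axis)
  let ?d = "\<lambda>x. grad UNIV (\<lambda>x. grad UNIV \<phi> x $ i) x $ j - grad UNIV (\<lambda>x. grad UNIV \<phi> x $ j) x $ i"
  have "?d x = 0"
  proof (rule continuous_zero_interior_imp_zero[OF _ _ x])
    show "continuous_on T ?d" by (intro continuous_intros Ck_gradient(3)[OF Ck1])
    fix \<eta> :: "real^3 \<Rightarrow> real" assume e: "test_function (interior T) \<eta>"
    have Cke: "Ck (Suc 0) \<eta>" using e unfolding test_function_def by blast
    obtain K where K: "compact K" "K \<subseteq> interior T" "\<And>x. x \<notin> K \<Longrightarrow> \<eta> x = 0"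
      using test_functionD[OF e] by blast
    note C1 = Ck_C1_on[OF Ck2] Ck_C1_on[OF Ck1] Ck_C1_on[OF Cke]
    have P: "((\<lambda>x. grad T (\<lambda>x. grad UNIV \<phi> x $ i * \<eta> x) x $ j) has_integral 0) (interior T)" for i j
      by (rule has_integral_partial_zero[OF C1_on_mult(1)[OF C1(3,5)] K(1,2)]) (simp add: K(3))
    have "((\<lambda>x. (grad T \<phi> x \<bullet> axis i 1) * (grad T \<eta> x \<bullet> axis j 1) - (grad T \<phi> x \<bullet> axis j 1) * (grad T \<eta> x \<bullet> axis i 1)) has_integral 0) (interior T)"
      by (rule has_integral_jacobian_zero[OF C1(1,5) K])
    \<comment> \<open>By the product rule, the terms with a derivative of \<open>\<eta>\<close> form
      exactly the Jacobian of \<open>\<phi>\<close> and \<open>\<eta>\<close>, which is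
      subtracted.\<close>
    from has_integral_diff[OF has_integral_diff[OF P[of i j] P[of j i]] this]
    have "((\<lambda>x. ?d x \<bullet> \<eta> x) has_integral 0 - 0 - 0) (interior T)"
    proof (rule has_integral_eq[rotated])
      fix x assume "x \<in> interior T"
      then have xT: "x \<in> T" using interior_subset by blast
      show "grad T (\<lambda>x. grad UNIV \<phi> x $ i * \<eta> x) x $ j - grad T (\<lambda>x. grad UNIV \<phi> x $ j * \<eta> x) x $ i
        - ((grad T \<phi> x \<bullet> axis i 1) * (grad T \<eta> x \<bullet> axis j 1) - (grad T \<phi> x \<bullet> axis j 1) * (grad T \<eta> x \<bullet> axis i 1))
        = ?d x \<bullet> \<eta> x"
        unfolding C1_on_mult(2)[OF C1(3,5) xT] C1(2)[OF xT] C1(4)[OF xT] C1(6)[OF xT]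
        by (simp add: inner_axis algebra_simps)
    qed
    then show "integral (interior T) (\<lambda>x. ?d x \<bullet> \<eta> x) = 0" by (simp add: integral_unique)
  qed
  then show ?thesis by simp
qed

text \<open>The integral of grad b \<bullet> curl s also vanishes for s = a grad \<phi>, whose curl
  is grad a \<times> grad \<phi> because the second derivatives of the test function cancel by
  symmetry.\<close>

lemma weak_div_cross_grad:
  assumes a: "C1_on T a" and b: "C1_on T b"
  shows "weak_div_pair (\<lambda>x. cross3 (grad T a x) (grad T b x)) 0"
  unfolding weak_div_pair_def
proof (intro conjI allI impI)
  show "continuous_on T (\<lambda>x. cross3 (grad T a x) (grad T b x))"
    by (intro continuous_on_cross C1_on_grad(1) a b)
  show "continuous_on T (0 :: real^3 \<Rightarrow> real)" by (simp add: zero_fun_def)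
  show "zext T (0 :: real^3 \<Rightarrow> real) = 0" by (auto simp: zext_def)
  fix \<phi> :: "real^3 \<Rightarrow> real" assume t: "test_function (interior T) \<phi>"
  have Ck2: "Ck (Suc (Suc 0)) \<phi>" using t unfolding test_function_def by blast
  have Ck1: "Ck (Suc 0) (\<lambda>x. grad UNIV \<phi> x $ k)" for k
    using Ck_gradient(2)[OF Ck2, of "axis k 1"] by (simp add: inner_axis)
  obtain K where K: "compact K" "K \<subseteq> interior T" "\<And>x. x \<notin> K \<Longrightarrow> \<phi> x = 0"
    using test_functionD[OF t] by blast
  define s where "s k x = a x * grad UNIV \<phi> x $ k" for k x
  have s: "C1_on T (s k)" "x \<in> T \<Longrightarrow> grad T (s k) x = a x *\<^sub>R grad UNIV (\<lambda>x. grad UNIV \<phi> x $ k) x + grad UNIV \<phi> x $ k *\<^sub>R grad T a x" for k x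
    unfolding s_def[abs_def] using C1_on_mult[OF a Ck_C1_on(1)[OF Ck1]] Ck_C1_on(2)[OF Ck1] by auto
  have "((\<lambda>x. grad T b x \<bullet> vector [grad T (s 3) x $ 2 - grad T (s 2) x $ 3,
      grad T (s 1) x $ 3 - grad T (s 3) x $ 1, grad T (s 2) x $ 1 - grad T (s 1) x $ 2]) has_integral 0) (interior T)"
    by (rule triple_jacobian_zero[OF b s(1) K(1,2)]) (simp add: s_def grad_UNIV_outside_support[OF K(1,3)])
  then have "((\<lambda>x. - (cross3 (grad T a x) (grad T b x) \<bullet> grad UNIV \<phi> x)) has_integral 0) (interior T)"
  proof (rule has_integral_eq[rotated])
    fix x assume "x \<in> interior T"
    then have xT: "x \<in> T" using interior_subset by blast
    have sym: "grad UNIV (\<lambda>x. grad UNIV \<phi> x $ 3) x $ 2 = grad UNIV (\<lambda>x. grad UNIV \<phi> x $ 2) x $ 3"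
      "grad UNIV (\<lambda>x. grad UNIV \<phi> x $ 1) x $ 3 = grad UNIV (\<lambda>x. grad UNIV \<phi> x $ 3) x $ 1"
      "grad UNIV (\<lambda>x. grad UNIV \<phi> x $ 2) x $ 1 = grad UNIV (\<lambda>x. grad UNIV \<phi> x $ 1) x $ 2"
      by (rule mixed_partials[OF t xT])+
    show "grad T b x \<bullet> vector [grad T (s 3) x $ 2 - grad T (s 2) x $ 3,
        grad T (s 1) x $ 3 - grad T (s 3) x $ 1, grad T (s 2) x $ 1 - grad T (s 1) x $ 2]
      = - (cross3 (grad T a x) (grad T b x) \<bullet> grad UNIV \<phi> x)"
      unfolding s(2)[OF xT]
      by (simp add: sym inner_vec_def sum_3 cross3_def algebra_simps)
  qed
  from has_integral_neg[OF this]
  show "((\<lambda>x. cross3 (grad T a x) (grad T b x) \<bullet> grad UNIV \<phi> x + 0 x * \<phi> x) has_integral 0) (interior T)"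
    by simp
qed

text \<open>The partial derivative of a coordinate difference times the test function has integral
  zero; summed over the three coordinates, the derivatives of the coordinates themselves contribute
  the \<open>3\<close>.\<close>

lemma weak_div_position: "weak_div_pair (zext T (\<lambda>x. x - y)) (zext T (\<lambda>_. 3))"
  unfolding weak_div_pair_def
proof (intro conjI allI impI)
  have "continuous_on T (\<lambda>x. x - y)" "continuous_on T (\<lambda>x :: real^3. 3 :: real)"
    by (intro continuous_intros)+
  then show "continuous_on T (zext T (\<lambda>x. x - y))" "continuous_on T (zext T (\<lambda>_. 3 :: real))"
    by (simp_all add: zext_def cong: continuous_on_cong)
  show "zext T (zext T (\<lambda>_. 3 :: real)) = zext T (\<lambda>_. 3)" by (auto simp: zext_def)
  fix \<phi> :: "real^3 \<Rightarrow> real" assume t: "test_function (interior T) \<phi>"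
  have Ck: "Ck (Suc 0) \<phi>" using t unfolding test_function_def by blast
  obtain K where K: "compact K" "K \<subseteq> interior T" "\<And>x. x \<notin> K \<Longrightarrow> \<phi> x = 0"
    using test_functionD[OF t] by blast
  let ?c = "\<lambda>k x. x \<bullet> axis k 1 + - (y $ k)"
  have c: "C1_on T (?c k)" "x \<in> T \<Longrightarrow> grad T (?c k) x = axis k 1" for k x
    using C1_on_add[OF C1_on_inner(1)[of "axis k 1"] C1_on_const(1)[of "- (y $ k)"]] C1_on_inner(2)[of x "axis k 1"]
      C1_on_const(2) by auto
  note m = C1_on_mult[OF c(1) Ck_C1_on(1)[OF Ck]]
  have P: "((\<lambda>x. grad T (\<lambda>x. ?c k x * \<phi> x) x $ k) has_integral 0) (interior T)" for k
    by (rule has_integral_partial_zero[OF m(1) K(1,2)]) (simp add: K(3))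
  have "((\<lambda>x. \<Sum>k\<in>UNIV. grad T (\<lambda>x. ?c k x * \<phi> x) x $ k) has_integral (\<Sum>k\<in>(UNIV::3 set). 0)) (interior T)"
    by (rule has_integral_sum) (rule finite, rule P)
  then have "((\<lambda>x. \<Sum>k\<in>UNIV. grad T (\<lambda>x. ?c k x * \<phi> x) x $ k) has_integral 0) (interior T)" by simp
  then show "((\<lambda>x. zext T (\<lambda>x. x - y) x \<bullet> grad UNIV \<phi> x + zext T (\<lambda>_. 3) x * \<phi> x) has_integral 0) (interior T)"
  proof (rule has_integral_eq[rotated])
    fix x assume "x \<in> interior T"
    then have xT: "x \<in> T" using interior_subset by blast
    show "(\<Sum>k\<in>UNIV. grad T (\<lambda>x. ?c k x * \<phi> x) x $ k) = zext T (\<lambda>x. x - y) x \<bullet> grad UNIV \<phi> x + zext T (\<lambda>_. 3) x * \<phi> x"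
      unfolding m(2)[OF xT] Ck_C1_on(2)[OF Ck xT] c(2)[OF xT]
      using xT by (simp add: zext_def sum_3 inner_vec_def inner_axis algebra_simps axis_def)
  qed
qed

end

section \<open>The area of a face is positive\<close>

text \<open>A distance-preserving map that fixes the origin preserves norms and, by polarisation,
  inner products; the defects of additivity and homogeneity then have norm zero.\<close>

lemma isometry_linear_part:
  fixes g :: "'a::euclidean_space \<Rightarrow> 'b::euclidean_space"
  assumes iso: "\<And>x y. dist (g x) (g y) = dist x y"
  shows "linear (\<lambda>x. g x - g 0)"
proof -
  define h where "h x = g x - g 0" for x
  have n: "norm (h x) = norm x" for x using iso[of x 0] by (simp add: h_def dist_norm)
  have d: "norm (h x - h y) = norm (x - y)" for x y using iso[of x y] by (simp add: h_def dist_norm)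
  have sq: "h x \<bullet> h x = x \<bullet> x" for x using n[of x] by (simp add: norm_eq)
  have i: "h x \<bullet> h y = x \<bullet> y" for x y
  proof -
    have "(h x - h y) \<bullet> (h x - h y) = (x - y) \<bullet> (x - y)" using d[of x y] by (simp add: norm_eq)
    then show ?thesis using sq by (simp add: inner_diff_left inner_diff_right inner_commute)
  qed
  have "h (x + y) = h x + h y" for x y
  proof -
    have "(h (x + y) - h x - h y) \<bullet> (h (x + y) - h x - h y) = 0"
      by (simp add: inner_diff_left inner_diff_right i inner_add_left inner_add_right inner_commute)
    then have "h (x + y) - h x - h y = 0" by (simp only: inner_eq_zero_iff)
    then show ?thesis by (simp add: algebra_simps)
  qed
  moreover have "h (c *\<^sub>R x) = c *\<^sub>R h x" for c x
  proof -
    have "(h (c *\<^sub>R x) - c *\<^sub>R h x) \<bullet> (h (c *\<^sub>R x) - c *\<^sub>R h x) = 0"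
      by (simp add: inner_diff_left inner_diff_right i)
    then show ?thesis by simp
  qed
  ultimately show ?thesis unfolding h_def[symmetric] by (intro linearI)
qed

context solid_polytope begin

text \<open>The area refers to an arbitrarily chosen isometry, so only its defining properties can
  be used: its range is an affine plane containing the facet, hence its affine hull, and a relative
  ball in the facet pulls back to a disc of positive measure.\<close>

lemma planar_area_pos:
  assumes f: "f \<in> faces T"
  shows "planar_area f > 0"
proof -
  let ?iso = "\<lambda>g :: real^2 \<Rightarrow> real^3. (\<forall>x y. dist (g x) (g y) = dist x y) \<and> f \<subseteq> range g"
  let ?n = "outward_normal T f"
  \<comment> \<open>Such an isometry comes from an orthonormal frame \<open>t\<close>,
    \<open>m\<close> of the plane of the face, based at the point \<open>p\<close> of the
    face.\<close>
  have "\<exists>g. ?iso g"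
  proof -
    obtain p q r where pqr: "p \<in> f" "q \<in> f" "r \<in> f" "cross3 (q - p) (r - p) \<noteq> 0"
      using face_frame[OF f] by blast
    have "q - p \<noteq> 0" using pqr(4) by auto
    define t where "t = (q - p) /\<^sub>R norm (q - p)"
    define m where "m = cross3 ?n t"
    have nt: "?n \<bullet> t = 0" using outward_normal_orthogonal[OF f pqr(1,2)] by (simp add: t_def)
    have "norm t = 1" using \<open>q - p \<noteq> 0\<close> by (simp add: t_def)
    then have tt: "t \<bullet> t = 1" by (simp add: norm_eq_1)
    have nn: "?n \<bullet> ?n = 1" using norm_outward_normal[OF f] by (simp add: norm_eq_1)
    have tm: "t \<bullet> m = 0" by (simp add: m_def dot_cross_self)
    have "(norm m)\<^sup>2 + (?n \<bullet> t)\<^sup>2 = (norm ?n * norm t)\<^sup>2" unfolding m_def by (rule norm_cross_dot)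
    then have mm: "m \<bullet> m = 1" using nt tt norm_outward_normal[OF f] by (simp add: power2_norm_eq_inner norm_eq_1)
    define g :: "real^2 \<Rightarrow> real^3" where "g z = p + z $ 1 *\<^sub>R t + z $ 2 *\<^sub>R m" for z
    have "dist (g x) (g y) = dist x y" for x y
    proof -
      have "g x - g y = (x - y) $ 1 *\<^sub>R t + (x - y) $ 2 *\<^sub>R m" by (simp add: g_def algebra_simps)
      then have "(g x - g y) \<bullet> (g x - g y) = (x - y) $ 1 * (x - y) $ 1 + (x - y) $ 2 * (x - y) $ 2"
        using tt mm tm by (simp only: inner_add_left inner_add_right inner_scaleR_left inner_scaleR_right
            inner_commute[of m t]) simp
      also have "\<dots> = (x - y) \<bullet> (x - y)" by (simp add: inner_vec_def sum_2)
      finally have "(g x - g y) \<bullet> (g x - g y) = (x - y) \<bullet> (x - y)" .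
      then show ?thesis by (simp add: dist_norm norm_eq)
    qed
    moreover have "f \<subseteq> range g"
    proof
      fix x assume x: "x \<in> f"
      have "x - p = (t \<bullet> (x - p)) *\<^sub>R t + (m \<bullet> (x - p)) *\<^sub>R m"
        using cross_right_handed_frame[OF norm_outward_normal[OF f] nt, of "x - p"]
          outward_normal_orthogonal[OF f pqr(1) x] tt by (simp add: m_def)
      then have "x = g (vector [t \<bullet> (x - p), m \<bullet> (x - p)])" by (simp add: g_def algebra_simps)
      then show "x \<in> range g" by blast
    qed
    ultimately show ?thesis by blast
  qed
  define g where "g = (SOME g. ?iso g)"
  have "?iso g" unfolding g_def using \<open>\<exists>g. ?iso g\<close> by (rule someI_ex)
  then have iso: "\<And>x y. dist (g x) (g y) = dist x y" and sub: "f \<subseteq> range g" by auto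
  have lin: "linear (\<lambda>x. g x - g 0)" by (rule isometry_linear_part[OF iso])
  have range: "range g = (+) (g 0) ` range (\<lambda>x. g x - g 0)" by (auto simp: image_image)
  have aff: "affine (range g)"
    unfolding range by (intro affine_translation[THEN iffD1] subspace_imp_affine linear_subspace_image[OF lin] subspace_UNIV)
  have "aff_dim (range g) \<le> aff_dim (UNIV :: (real^2) set)"
    unfolding range aff_dim_translation_eq by (rule aff_dim_linear_image_le[OF lin])
  then have d2: "aff_dim (range g) \<le> 2" by simp
  have hull: "affine hull f \<subseteq> range g" using hull_minimal[of f "range g" affine] sub aff by blast
  have "aff_dim (affine hull f) = aff_dim (range g)"
    using faceD(4)[OF f] d2 aff_dim_subset[OF hull] by simp
  then have heq: "affine hull f = range g"
    using affine_dim_equal[OF affine_affine_hull aff _ hull] faceD(6)[OF f] by simp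
  have cg: "continuous_on UNIV g"
    unfolding continuous_on_iff using iso by metis
  have clos: "closed (g -` f)"
    using continuous_closed_vimage[of f g] cg polytope_imp_closed[OF faceD(3)[OF f]] by (simp add: continuous_on_eq_continuous_at)
  have bdd: "bounded (g -` f)"
  proof -
    obtain B where B: "\<And>x. x \<in> f \<Longrightarrow> dist (g 0) x \<le> B"
      using polytope_imp_bounded[OF faceD(3)[OF f]] bounded_any_center[of f "g 0"] by blast
    have "dist 0 z \<le> B" if "z \<in> g -` f" for z using B[of "g z"] that iso[of 0 z] by simp
    then show ?thesis unfolding bounded_def by blast
  qed
  have lm: "g -` f \<in> lmeasurable"
    using clos bdd by (intro lmeasurable_compact) (simp add: compact_eq_bounded_closed)
  have "rel_interior f \<noteq> {}" using rel_interior_eq_empty[OF faceD(7)] faceD(6) f by blast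
  then obtain y where y: "y \<in> rel_interior f" by blast
  then obtain e where e: "e > 0" "ball y e \<inter> affine hull f \<subseteq> f" by (auto simp: mem_rel_interior_ball)
  have "y \<in> f" using y rel_interior_subset by blast
  then obtain z where z: "y = g z" using sub by blast
  have "ball z e \<subseteq> g -` f"
  proof
    fix w assume "w \<in> ball z e"
    then have "g w \<in> ball y e \<inter> affine hull f" using iso[of z w] z heq by simp
    then show "w \<in> g -` f" using e(2) by blast
  qed
  then have "measure lebesgue (ball z e) \<le> measure lebesgue (g -` f)"
    by (intro measure_mono_fmeasurable lm) auto
  moreover have "measure lebesgue (ball z e) > 0"
    using content_ball_pos[OF e(1), of z] by (simp add: measure_completion)
  ultimately have "measure lebesgue (g -` f) > 0" by (rule less_le_trans[rotated])
  then show ?thesis unfolding planar_area_def g_def[symmetric] .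
qed

end

section \<open>Triangles and parallelograms\<close>

text \<open>The minimisers of a functional over a polytope form an exposed face; its extreme points
  are extreme in the whole polytope and therefore among the generators \<open>S\<close>.\<close>

lemma exposed_face_of_hull:
  fixes S :: "'a::euclidean_space set"
  assumes "finite S" "\<And>y. y \<in> S \<Longrightarrow> m \<le> c \<bullet> y"
  shows "(convex hull {y \<in> S. c \<bullet> y = m}) face_of (convex hull S)"
proof -
  let ?f = "convex hull S"
  have P: "polytope ?f" using assms(1) by (rule polytope_convex_hull)
  have ge: "?f \<subseteq> {x. m \<le> c \<bullet> x}"
    by (rule hull_minimal) (use assms(2) convex_halfspace_ge in auto)
  have F: "(?f \<inter> {x. c \<bullet> x = m}) face_of ?f"
    by (rule face_of_Int_supporting_hyperplane_ge) (use ge in auto)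
  have PF: "polytope (?f \<inter> {x. c \<bullet> x = m})" using polytope_face[OF P F] .
  have ext: "{x. x extreme_point_of (?f \<inter> {x. c \<bullet> x = m})} \<subseteq> {y \<in> S. c \<bullet> y = m}"
    using extreme_point_of_face[OF F] extreme_point_of_convex_hull by blast
  have "?f \<inter> {x. c \<bullet> x = m} = convex hull {x. x extreme_point_of (?f \<inter> {x. c \<bullet> x = m})}"
    by (rule hull_extreme(1)[OF PF])
  also have "\<dots> \<subseteq> convex hull {y \<in> S. c \<bullet> y = m}" by (rule hull_mono[OF ext])
  finally have "?f \<inter> {x. c \<bullet> x = m} \<subseteq> convex hull {y \<in> S. c \<bullet> y = m}" .
  moreover have "convex hull {y \<in> S. c \<bullet> y = m} \<subseteq> ?f \<inter> {x. c \<bullet> x = m}"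
    by (rule hull_minimal) (auto simp: hull_inc convex_Int convex_hyperplane)
  ultimately have "convex hull {y \<in> S. c \<bullet> y = m} = ?f \<inter> {x. c \<bullet> x = m}" by blast
  then show ?thesis using F by simp
qed

text \<open>A parallelogram with a chosen base corner and two edge vectors; moving the corner around
  and exchanging the vectors reduces statements about all corners and sides to a single one.\<close>

definition spans_parallelogram :: "(real^3) set \<Rightarrow> real^3 \<Rightarrow> real^3 \<Rightarrow> real^3 \<Rightarrow> bool" where
  "spans_parallelogram f a u w \<longleftrightarrow> cross3 u w \<noteq> 0 \<and> f = convex hull {a, a + u, a + u + w, a + w}"

lemma spans_parallelogram_rotate:
  assumes "spans_parallelogram f a u w"
  shows "spans_parallelogram f (a + u) w (- u)"
proof -
  have "{a + u, a + u + w, a + u + w + - u, a + u + - u} = {a, a + u, a + u + w, a + w}" by auto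
  moreover have "cross3 w (- u) = cross3 u w" using cross_skew[of u w] by simp
  ultimately show ?thesis using assms by (simp add: spans_parallelogram_def)
qed

lemma spans_parallelogram_reflect:
  assumes "spans_parallelogram f a u w"
  shows "spans_parallelogram f a w u"
proof -
  have "{a, a + w, a + w + u, a + u} = {a, a + u, a + u + w, a + w}" by (auto simp: algebra_simps)
  moreover have "cross3 w u \<noteq> 0" using assms cross_skew[of u w] by (simp add: spans_parallelogram_def)
  ultimately show ?thesis using assms by (simp add: spans_parallelogram_def)
qed

lemma spans_parallelogram_faces:
  assumes "spans_parallelogram f a u w"
  shows "{a} face_of f" "closed_segment a (a + u) face_of f" "\<not> closed_segment a (a + u + w) face_of f"
    "u \<noteq> 0" "u + w \<noteq> 0"
proof -
  define S where "S = {a, a + u, a + u + w, a + w}"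
  have f: "f = convex hull S" and m0: "cross3 u w \<noteq> 0" using assms by (auto simp: spans_parallelogram_def S_def)
  define m where "m = cross3 u w"
  have mm: "m \<bullet> m > 0" using m0 by (simp add: m_def)
  \<comment> \<open>Up to the factor \<open>m \<bullet> m\<close>, \<open>\<alpha>\<close> and
    \<open>\<beta>\<close> are dual to \<open>u\<close> and \<open>w\<close>: \<open>\<beta>\<close>
    exposes the side along \<open>u\<close>, and \<open>\<alpha> + \<beta>\<close> exposes the
    corner \<open>a\<close>.\<close>
  define \<alpha> where "\<alpha> = cross3 w m"
  define \<beta> where "\<beta> = cross3 m u"
  have ab: "\<alpha> \<bullet> u = m \<bullet> m" "\<alpha> \<bullet> w = 0" "\<beta> \<bullet> u = 0" "\<beta> \<bullet> w = m \<bullet> m"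
    unfolding \<alpha>_def \<beta>_def by (simp_all add: dot_cross_self) (simp_all add: m_def cross3_simps)
  have fin: "finite S" by (simp add: S_def)
  have "{y \<in> S. (\<alpha> + \<beta>) \<bullet> y = (\<alpha> + \<beta>) \<bullet> a} = {a}"
    using mm by (auto simp: S_def inner_add_left inner_add_right ab)
  moreover have "(\<alpha> + \<beta>) \<bullet> a \<le> (\<alpha> + \<beta>) \<bullet> y" if "y \<in> S" for y
    using mm that by (auto simp: S_def inner_add_left inner_add_right ab)
  ultimately show "{a} face_of f"
    using exposed_face_of_hull[OF fin, of "(\<alpha> + \<beta>) \<bullet> a" "\<alpha> + \<beta>"] by (simp add: f)
  have "{y \<in> S. \<beta> \<bullet> y = \<beta> \<bullet> a} = {a, a + u}"
    using mm by (auto simp: S_def inner_add_right ab)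
  moreover have "\<beta> \<bullet> a \<le> \<beta> \<bullet> y" if "y \<in> S" for y
    using mm that by (auto simp: S_def inner_add_right ab)
  ultimately show "closed_segment a (a + u) face_of f"
    using exposed_face_of_hull[OF fin, of "\<beta> \<bullet> a" "\<beta>"] by (simp add: f segment_convex_hull)
  show "u \<noteq> 0" using m0 by auto
  have "cross3 u (u + w) \<noteq> 0" using m0 by (simp add: cross_add_right)
  then show "u + w \<noteq> 0" by auto
  show "\<not> closed_segment a (a + u + w) face_of f"
  proof
    \<comment> \<open>The diagonals bisect each other, so a face containing one of them would
      contain the ends of the other, among them \<open>a + u\<close>, which is not on the first
      diagonal.\<close>
    assume F: "closed_segment a (a + u + w) face_of f"
    have "midpoint a (a + u + w) = midpoint (a + u) (a + w)" by (simp add: midpoint_def algebra_simps)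
    moreover have "a + u \<noteq> a + w" using m0 by auto
    ultimately have "midpoint a (a + u + w) \<in> open_segment (a + u) (a + w)" by simp
    moreover have "midpoint a (a + u + w) \<in> closed_segment a (a + u + w)" by simp
    moreover have "a + u \<in> f" "a + w \<in> f" unfolding f S_def by (auto intro: hull_inc)
    ultimately have "a + u \<in> closed_segment a (a + u + w)" using face_ofD[OF F] by blast
    then obtain t where "a + u = (1 - t) *\<^sub>R a + t *\<^sub>R (a + u + w)" by (auto simp: in_segment)
    then have "u = t *\<^sub>R (u + w)" by (simp add: algebra_simps)
    then have "\<alpha> \<bullet> u = t * (\<alpha> \<bullet> (u + w))" "\<beta> \<bullet> u = t * (\<beta> \<bullet> (u + w))" by (metis inner_scaleR_right)+
    then show False using mm by (auto simp: inner_add_right ab)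
  qed
qed

lemma spans_parallelogram_verts:
  assumes "spans_parallelogram f a u w"
  shows "verts f = {a, a + u, a + u + w, a + w}"
proof
  show "verts f \<subseteq> {a, a + u, a + u + w, a + w}"
    using assms extreme_point_of_convex_hull by (auto simp: verts_def spans_parallelogram_def)
  note r1 = spans_parallelogram_rotate[OF assms]
  note r2 = spans_parallelogram_rotate[OF r1]
  note r3 = spans_parallelogram_rotate[OF r2]
  show "{a, a + u, a + u + w, a + w} \<subseteq> verts f"
    using spans_parallelogram_faces(1)[OF assms] spans_parallelogram_faces(1)[OF r1]
      spans_parallelogram_faces(1)[OF r2] spans_parallelogram_faces(1)[OF r3]
    by (auto simp: verts_def face_of_singleton)
qed

lemma segment_edge_of:
  "a \<noteq> b \<Longrightarrow> closed_segment a b \<in> edges f \<longleftrightarrow> closed_segment a b face_of f"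
proof -
  assume "a \<noteq> b"
  then have "aff_dim (closed_segment a b) = 1"
    by (simp add: segment_convex_hull aff_dim_convex_hull aff_dim_2)
  then show ?thesis by (simp add: edges_def edge_of_def)
qed

lemma spans_parallelogram_dir_edges:
  assumes "spans_parallelogram f a u w"
  shows "(a, a + u) \<in> dir_edges f" "(a, a + u + w) \<notin> dir_edges f"
  using spans_parallelogram_verts[OF assms] spans_parallelogram_faces[OF assms]
    segment_edge_of[of a "a + u" f] segment_edge_of[of a "a + u + w" f]
  by (auto simp: dir_edges_def add.assoc)

text \<open>Rotation brings the base corner to \<open>i\<close>; then \<open>j\<close> is a
  neighbour, since the segment to the opposite corner is no edge, and a reflection makes it the
  first neighbour if necessary.\<close>

lemma parallelogram_at_dir_edge:
  assumes "parallelogram f" "(i, j) \<in> dir_edges f"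
  obtains w where "spans_parallelogram f i (j - i) w"
proof -
  obtain a u w where P: "spans_parallelogram f a u w"
    using assms(1) by (auto simp: parallelogram_def spans_parallelogram_def cross_eq_0)
  have "\<exists>u w. spans_parallelogram f i u w"
  proof -
    note r1 = spans_parallelogram_rotate[OF P]
    note r2 = spans_parallelogram_rotate[OF r1]
    note r3 = spans_parallelogram_rotate[OF r2]
    have "i \<in> {a, a + u, a + u + w, a + w}"
      using assms(2) spans_parallelogram_verts[OF P] by (auto simp: dir_edges_def)
    then show ?thesis using P r1 r2 r3 by auto
  qed
  then obtain u w where Q: "spans_parallelogram f i u w" by blast
  have "j \<in> {i, i + u, i + u + w, i + w}" "j \<noteq> i"
    using assms(2) spans_parallelogram_verts[OF Q] by (auto simp: dir_edges_def)
  moreover have "j \<noteq> i + u + w" using spans_parallelogram_dir_edges(2)[OF Q] assms(2) by blast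
  ultimately consider "j = i + u" | "j = i + w" by blast
  then show ?thesis
  proof cases
    case 1
    then show ?thesis using that[of w] Q by simp
  next
    case 2
    then show ?thesis using that[of u] spans_parallelogram_reflect[OF Q] by simp
  qed
qed

lemma triangle_dir_edges:
  assumes "2 simplex f" "(i, j) \<in> dir_edges f"
  obtains k where "verts f = {i, j, k}" "i \<noteq> j" "j \<noteq> k" "k \<noteq> i" "f = convex hull {i, j, k}"
    "\<And>p q. p \<in> {i, j, k} \<Longrightarrow> q \<in> {i, j, k} \<Longrightarrow> p \<noteq> q \<Longrightarrow> (p, q) \<in> dir_edges f"
proof -
  obtain S where S: "\<not> affine_dependent S" "int (card S) = 3" "f = convex hull S"
    using assms(1) by (auto simp: simplex_def)
  have vf: "verts f = S"
    using extreme_point_of_convex_hull_affine_independent[OF S(1)] S(3) by (auto simp: verts_def)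
  have ij: "i \<in> S" "j \<in> S" "i \<noteq> j" using assms(2) vf by (auto simp: dir_edges_def)
  have fin: "finite S" using S(1) by (rule aff_independent_finite)
  have "card (S - {i, j}) = 1" using ij S(2) fin by (simp add: card_Diff_subset)
  then obtain k where k: "S - {i, j} = {k}" by (auto simp: card_1_singleton_iff)
  then have Sk: "S = {i, j, k}" "k \<noteq> i" "k \<noteq> j" using ij by auto
  have "(p, q) \<in> dir_edges f" if "p \<in> S" "q \<in> S" "p \<noteq> q" for p q
  proof -
    have "closed_segment p q face_of f"
      unfolding S(3) face_of_convex_hull_affine_independent[OF S(1)]
      by (intro exI[of _ "{p, q}"]) (use that in \<open>auto simp: segment_convex_hull\<close>)
    then show ?thesis using that vf segment_edge_of[of p q f] by (auto simp: dir_edges_def)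
  qed
  then show ?thesis using that[of k] vf Sk ij S(3) by auto
qed

section \<open>The flux of the modified Whitney forms through the faces\<close>

text \<open>The linear combination that turns Whitney forms into modified ones, applied to an arbitrary
  family: the Whitney forms, their curls, or the fluxes of the curls through a face.\<close>

definition whitney_comb :: "(real^3) set \<Rightarrow> (real^3 \<Rightarrow> real^3 \<Rightarrow> real^3 \<Rightarrow> real) \<Rightarrow>
    (real^3 \<Rightarrow> real^3 \<Rightarrow> 'b::real_vector) \<Rightarrow> real^3 \<Rightarrow> real^3 \<Rightarrow> 'b" where
  "whitney_comb T C F i j = F i j
     + (1/2) *\<^sub>R ((\<Sum>k | k \<in> adjacent_verts T i j \<and> (i, k) \<in> face_diagonals T. F i k)
       - (\<Sum>k | k \<in> adjacent_verts T i j \<and> (j, k) \<in> face_diagonals T. F j k))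
     + (1/2) *\<^sub>R ((\<Sum>k | (i, k) \<in> inner_diagonals T. C i k j *\<^sub>R F i k)
       - (\<Sum>k | (j, k) \<in> inner_diagonals T. C j k i *\<^sub>R F j k))"

lemma mod_whitney_eq_comb: "mod_whitney T lam C i j x = whitney_comb T C (\<lambda>p q. whitney T lam p q x) i j"
  by (simp add: mod_whitney_def whitney_comb_def)

lemma linear_whitney_comb:
  assumes "linear L"
  shows "L (whitney_comb T C F i j) = whitney_comb T C (\<lambda>p q. L (F p q)) i j"
  unfolding whitney_comb_def
  by (simp add: linear_add[OF assms] linear_diff[OF assms] linear_cmul[OF assms] linear_sum[OF assms])

lemma adjacent_verts_commute: "adjacent_verts T i j = adjacent_verts T j i"
  by (simp add: adjacent_verts_def closed_segment_commute)

text \<open>Both correction differences change sign under the exchange for every \<open>F\<close>;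
  the hypothesis takes care of the leading term.\<close>

lemma whitney_comb_skew:
  assumes "F j i = - F i j"
  shows "whitney_comb T C F j i = - whitney_comb T C F i j"
  unfolding whitney_comb_def adjacent_verts_commute[of T j i] assms
  by (simp add: algebra_simps)

lemma sum_fun_apply: "(\<Sum>i\<in>I. f i) x = (\<Sum>i\<in>I. f i x)"
  by (induction I rule: infinite_finite_induct) auto

lemma linear_fun_apply: "linear (\<lambda>f :: 'a \<Rightarrow> 'b::real_vector. f x)"
  by (rule linearI) (auto simp: scaleR_fun_def)

locale gbc_polytope = solid_polytope T for T :: "(real^3) set" +
  fixes lam :: "real^3 \<Rightarrow> real^3 \<Rightarrow> real" and C :: "real^3 \<Rightarrow> real^3 \<Rightarrow> real^3 \<Rightarrow> real"
  assumes regular: "regular_coordinates T lam" and face_cond: "face_conditions T lam"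

sublocale gbc_polytope \<subseteq> convex_body3 T
  by unfold_locales (rule convex compact interior_nonempty)+

context gbc_polytope begin

section \<open>Jacobians of the coordinates on a face\<close>

lemma lam_C1: "p \<in> verts T \<Longrightarrow> C1_on T (lam p)"
  and lam_lagrange: "p \<in> verts T \<Longrightarrow> q \<in> verts T \<Longrightarrow> lam p q = (if p = q then 1 else 0)"
  and lam_face_zero: "f \<in> faces T \<Longrightarrow> p \<in> verts T \<Longrightarrow> p \<notin> f \<Longrightarrow> x \<in> f \<Longrightarrow> lam p x = 0"
  using regular by (auto simp: regular_coordinates_def C1_lagrange_gbc_def)

lemma lam_sum: "x \<in> T \<Longrightarrow> (\<Sum>p\<in>verts T. lam p x) = 1"
proof -
  assume x: "x \<in> T"
  have "\<forall>a b. \<forall>x\<in>T. a \<bullet> x + b = (\<Sum>p\<in>verts T. (a \<bullet> p + b) * lam p x)"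
    using regular by (simp add: regular_coordinates_def C1_lagrange_gbc_def gbc_def)
  then have "0 \<bullet> x + 1 = (\<Sum>p\<in>verts T. (0 \<bullet> p + 1) * lam p x)" using x by blast
  then show ?thesis by simp
qed

lemma grad_lam_sum: "(\<Sum>p\<in>verts T. grad T (lam p) x) = 0"
proof -
  have "(\<lambda>x. \<Sum>p\<in>verts T. grad T (lam p) x) = grad T (\<lambda>x. \<Sum>p\<in>verts T. lam p x)"
    by (rule C1_on_sum(2)[OF finite_verts, symmetric]) (rule lam_C1)
  also have "\<dots> = grad T (\<lambda>x. 1)" by (rule C1_on_cong(2)) (rule lam_sum)
  also have "\<dots> = (\<lambda>x. 0)" by (rule C1_on_const(2))
  finally show ?thesis by (rule fun_cong)
qed

text \<open>The coordinate vanishes on the face, so its derivative within the face is also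
  \<open>0\<close>; uniqueness along the face makes the gradient orthogonal to all directions of the
  face.\<close>

lemma grad_lam_normal:
  assumes f: "f \<in> faces T" and p: "p \<in> verts T" "p \<notin> f" and x: "x \<in> f"
  shows "\<exists>k. grad T (lam p) x = k *\<^sub>R outward_normal T f"
proof -
  have sub: "f \<subseteq> T" by (rule faceD(5)[OF f])
  have "(lam p has_derivative (\<lambda>h. grad T (lam p) x \<bullet> h)) (at x within T)"
    by (rule C1_on_grad(2)[OF lam_C1[OF p(1)]]) (use sub x in blast)
  then have 1: "(lam p has_derivative (\<lambda>h. grad T (lam p) x \<bullet> h)) (at x within f)"
    by (rule has_derivative_subset[OF _ sub])
  have "((\<lambda>x. 0) has_derivative (\<lambda>h. 0 \<bullet> h)) (at x within f)" by simp
  then have 2: "(lam p has_derivative (\<lambda>h. 0 \<bullet> h)) (at x within f)"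
    by (rule has_derivative_transform[OF x, rotated]) (simp add: lam_face_zero[OF f p])
  have "grad T (lam p) x \<bullet> (y - x) = 0" if "y \<in> f" for y
    using gradient_unique_along[OF faceD(7)[OF f] x that 1 2] by simp
  from orthogonal_face_imp_normal[OF f x this] show ?thesis by blast
qed

lemma jacobian_skew: "face_jacobian T lam f q p x = - face_jacobian T lam f p q x"
  unfolding face_jacobian_def using cross_skew[of "grad T (lam q) x" "grad T (lam p) x"] by simp

lemma jacobian_zero:
  assumes f: "f \<in> faces T" and p: "p \<in> verts T" "p \<notin> f" and x: "x \<in> f"
  shows "face_jacobian T lam f p q x = 0" "face_jacobian T lam f q p x = 0"
proof -
  obtain k where "grad T (lam p) x = k *\<^sub>R outward_normal T f" using grad_lam_normal[OF assms] by blast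
  then show "face_jacobian T lam f p q x = 0"
    by (simp add: face_jacobian_def cross_mult_left dot_cross_self)
  then show "face_jacobian T lam f q p x = 0" using jacobian_skew[of f q p x] by simp
qed

lemma jacobian_refl: "face_jacobian T lam f p p x = 0"
  by (simp add: face_jacobian_def)

text \<open>The gradients of a partition of unity sum to zero, and the coordinates of vertices off
  the face do not contribute.\<close>

lemma jacobian_sum:
  assumes f: "f \<in> faces T" and x: "x \<in> f"
  shows "(\<Sum>q\<in>verts f. face_jacobian T lam f p q x) = 0"
proof -
  have "(\<Sum>q\<in>verts f. face_jacobian T lam f p q x) = (\<Sum>q\<in>verts T. face_jacobian T lam f p q x)"
    by (rule sum.mono_neutral_left[OF finite_verts]) (use verts_face[OF f] jacobian_zero[OF f _ _ x] in auto)
  also have "\<dots> = cross3 (grad T (lam p) x) (\<Sum>q\<in>verts T. grad T (lam q) x) \<bullet> outward_normal T f"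
  proof -
    have "linear (\<lambda>v. cross3 (grad T (lam p) x) v \<bullet> outward_normal T f)"
      by (rule linearI) (simp_all add: cross_add_right cross_mult_right inner_add_left)
    then show ?thesis unfolding face_jacobian_def by (rule linear_sum[symmetric])
  qed
  finally show ?thesis by (simp add: grad_lam_sum)
qed

lemma face_subset_frontier: "f \<in> faces T \<Longrightarrow> f \<subseteq> frontier T"
  using face_of_subset_rel_frontier[OF faceD(2,8)] rel_interior closed
  by (auto simp: rel_frontier_def frontier_def)

lemma finite_adjacent: "finite {k. k \<in> adjacent_verts T i j \<and> P k}"
proof -
  have "adjacent_verts T i j \<subseteq> verts T" using verts_face by (auto simp: adjacent_verts_def)
  then show ?thesis using finite_verts by (auto intro: finite_subset)
qed

text \<open>The face is convex and lies in the frontier, so it misses at least one end of the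
  diagonal.\<close>

lemma inner_diagonal_jacobian_zero:
  assumes f: "f \<in> faces T" and x: "x \<in> f" and ik: "(i, k) \<in> inner_diagonals T"
  shows "face_jacobian T lam f i k x = 0"
proof -
  have v: "i \<in> verts T" "k \<in> verts T" "\<not> closed_segment i k \<subseteq> frontier T"
    using ik by (auto simp: inner_diagonals_def)
  then have "\<not> (i \<in> f \<and> k \<in> f)"
    using closed_segment_subset[OF _ _ faceD(7)[OF f]] face_subset_frontier[OF f] by blast
  then show ?thesis using jacobian_zero[OF f _ _ x] v by blast
qed

lemma comb_jacobian:
  assumes f: "f \<in> faces T" and x: "x \<in> f"
  shows "whitney_comb T C (\<lambda>p q. face_jacobian T lam f p q x) i j = face_jacobian T lam f i j x
    + (1/2) * ((\<Sum>k | k \<in> adjacent_verts T i j \<and> (i, k) \<in> face_diagonals T \<and> k \<in> f. face_jacobian T lam f i k x)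
      - (\<Sum>k | k \<in> adjacent_verts T i j \<and> (j, k) \<in> face_diagonals T \<and> k \<in> f. face_jacobian T lam f j k x))"
proof -
  have I: "(\<Sum>k | (i, k) \<in> inner_diagonals T. c k *\<^sub>R face_jacobian T lam f i k x) = 0" for i c
    by (rule sum.neutral) (use inner_diagonal_jacobian_zero[OF f x] in auto)
  have F: "(\<Sum>k | k \<in> adjacent_verts T i j \<and> (i', k) \<in> face_diagonals T. face_jacobian T lam f i' k x)
    = (\<Sum>k | k \<in> adjacent_verts T i j \<and> (i', k) \<in> face_diagonals T \<and> k \<in> f. face_jacobian T lam f i' k x)" for i'
    by (rule sum.mono_neutral_right[OF finite_adjacent])
      (use jacobian_zero[OF f _ _ x] in \<open>auto simp: face_diagonals_def\<close>)
  show ?thesis unfolding whitney_comb_def I F by simp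
qed

lemma in_adjacent_verts: "f \<in> faces T \<Longrightarrow> closed_segment i j \<subseteq> f \<Longrightarrow> k \<in> verts f \<Longrightarrow> k \<in> adjacent_verts T i j"
  by (auto simp: adjacent_verts_def)

text \<open>The orientation condition is affine in \<open>x\<close>, so it suffices to check the
  vertices.\<close>

lemma face_boundaryI:
  assumes f: "f \<in> faces T" and e: "(p, q) \<in> dir_edges f"
    and v: "\<And>x. x \<in> verts f \<Longrightarrow> cross3 (outward_normal T f) (q - p) \<bullet> (x - p) \<ge> 0"
  shows "(p, q) \<in> face_boundary T f"
proof -
  let ?m = "cross3 (outward_normal T f) (q - p)"
  have "?m \<bullet> (x - p) \<ge> 0" if "x \<in> f" for x
  proof -
    have "(- ?m) \<bullet> x \<le> (- ?m) \<bullet> p"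
      by (rule extreme_le[OF faceD(3)[OF f] _ that]) (use v in \<open>auto simp: verts_def inner_diff_right\<close>)
    then show ?thesis by (simp add: inner_diff_right)
  qed
  then show ?thesis using e by (simp add: face_boundary_def)
qed

lemma face_boundaryD:
  assumes "f \<in> faces T" "(i, j) \<in> face_boundary T f"
  shows "(i, j) \<in> dir_edges f" "closed_segment i j \<subseteq> f" "i \<in> f" "j \<in> f" "i \<in> verts f" "j \<in> verts f"
    "x \<in> f \<Longrightarrow> cross3 (outward_normal T f) (j - i) \<bullet> (x - i) \<ge> 0"
proof -
  show 1: "(i, j) \<in> dir_edges f" using assms(2) by (simp add: face_boundary_def)
  then show "closed_segment i j \<subseteq> f" using dir_edges_face[OF assms(1)] by blast
  then show "i \<in> f" "j \<in> f" using ends_in_segment by blast+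
  show "i \<in> verts f" "j \<in> verts f" using 1 by (auto simp: dir_edges_def)
  show "x \<in> f \<Longrightarrow> cross3 (outward_normal T f) (j - i) \<bullet> (x - i) \<ge> 0"
    using assms(2) by (simp add: face_boundary_def)
qed

lemma ccw_vertices_triangle:
  assumes "distinct [p1, p2, p3]" "verts f = {p1, p2, p3}"
    "(p1, p2) \<in> face_boundary T f" "(p2, p3) \<in> face_boundary T f" "(p3, p1) \<in> face_boundary T f"
  shows "ccw_vertices T f [p1, p2, p3]"
proof -
  have "([p1, p2, p3] ! n, [p1, p2, p3] ! (Suc n mod 3)) \<in> face_boundary T f" if "n < 3" for n
  proof -
    from that consider "n = 0" | "n = 1" | "n = 2" by linarith
    then show ?thesis by cases (use assms(3-5) in simp_all)
  qed
  then show ?thesis using assms(1,2) by (simp add: ccw_vertices_def)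
qed

lemma ccw_vertices_quadrilateral:
  assumes "distinct [p1, p2, p3, p4]" "verts f = {p1, p2, p3, p4}"
    "(p1, p2) \<in> face_boundary T f" "(p2, p3) \<in> face_boundary T f"
    "(p3, p4) \<in> face_boundary T f" "(p4, p1) \<in> face_boundary T f"
  shows "ccw_vertices T f [p1, p2, p3, p4]"
proof -
  have "([p1, p2, p3, p4] ! n, [p1, p2, p3, p4] ! (Suc n mod 4)) \<in> face_boundary T f" if "n < 4" for n
  proof -
    from that consider "n = 0" | "n = 1" | "n = 2" | "n = 3" by linarith
    then show ?thesis by cases (use assms(3-6) in simp_all)
  qed
  then show ?thesis using assms(1,2) by (simp add: ccw_vertices_def)
qed

text \<open>A triangle has no diagonals, so both correction sums are empty and the prescribed
  Jacobian remains.\<close>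

lemma comb_jacobian_triangle:
  assumes f: "f \<in> faces T" and x: "x \<in> f" and ij: "(i, j) \<in> face_boundary T f"
    and s: "2 simplex f"
    and D: "\<And>p1 p2 p3. ccw_vertices T f [p1, p2, p3] \<Longrightarrow> face_jacobian T lam f p1 p2 x = 1 / (2 * planar_area f)"
  shows "whitney_comb T C (\<lambda>p q. face_jacobian T lam f p q x) i j = 1 / (2 * planar_area f)"
proof -
  note e = face_boundaryD[OF f ij]
  obtain k where k: "verts f = {i, j, k}" "i \<noteq> j" "j \<noteq> k" "k \<noteq> i"
    and dir: "\<And>p q. p \<in> {i, j, k} \<Longrightarrow> q \<in> {i, j, k} \<Longrightarrow> p \<noteq> q \<Longrightarrow> (p, q) \<in> dir_edges f"
    using triangle_dir_edges[OF s e(1)] by metis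
  let ?n = "outward_normal T f"
  have kf: "k \<in> f" using k(1) verts_face[OF f] by blast
  have pos: "cross3 ?n (j - i) \<bullet> (k - i) \<ge> 0" by (rule e(7)[OF kf])
  \<comment> \<open>The triple product is invariant under cyclic relabelling of the corners, so one
    correctly directed side determines the direction of the other two.\<close>
  have eq1: "cross3 ?n (k - j) \<bullet> (i - j) = cross3 ?n (j - i) \<bullet> (k - i)"
    and eq2: "cross3 ?n (i - k) \<bullet> (j - k) = cross3 ?n (j - i) \<bullet> (k - i)"
    by (simp_all add: cross3_simps)
  have "(j, k) \<in> face_boundary T f"
    by (rule face_boundaryI[OF f]) (use dir k pos eq1 in \<open>auto simp: dot_cross_self\<close>)
  moreover have "(k, i) \<in> face_boundary T f"
    by (rule face_boundaryI[OF f]) (use dir k pos eq2 in \<open>auto simp: dot_cross_self\<close>)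
  ultimately have "ccw_vertices T f [i, j, k]"
    using k ij by (intro ccw_vertices_triangle) auto
  then have Dij: "face_jacobian T lam f i j x = 1 / (2 * planar_area f)" by (rule D)
  have no: "(p, q) \<notin> face_diagonals T" if "p \<in> verts f" "q \<in> f" for p q
  proof
    assume d: "(p, q) \<in> face_diagonals T"
    then have "q \<in> verts f" "p \<noteq> q" using verts_face[OF f] that(2) by (auto simp: face_diagonals_def)
    then have "(p, q) \<in> dir_edges f" using dir that(1) k(1) by blast
    then show False using d dir_edges_face[OF f] by (auto simp: face_diagonals_def)
  qed
  then have empty: "{k. k \<in> adjacent_verts T i j \<and> (i, k) \<in> face_diagonals T \<and> k \<in> f} = {}"
    "{k. k \<in> adjacent_verts T i j \<and> (j, k) \<in> face_diagonals T \<and> k \<in> f} = {}"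
    using e(5,6) by blast+
  show ?thesis unfolding comb_jacobian[OF f x] empty by (simp add: Dij)
qed

text \<open>Exactly one diagonal of the face starts at \<open>i\<close> and one at \<open>j\<close>.
  With weight 1/2 they turn the Jacobian of the side from \<open>i\<close> to \<open>j\<close> into
  the mean of those of the two neighbouring sides, whose sum is prescribed.\<close>

lemma comb_jacobian_parallelogram:
  assumes f: "f \<in> faces T" and x: "x \<in> f" and ij: "(i, j) \<in> face_boundary T f"
    and s: "parallelogram f"
    and D: "\<And>p1 p2 p3 p4. ccw_vertices T f [p1, p2, p3, p4] \<Longrightarrow>
      face_jacobian T lam f p2 p3 x + face_jacobian T lam f p4 p1 x = 1 / planar_area f"
  shows "whitney_comb T C (\<lambda>p q. face_jacobian T lam f p q x) i j = 1 / (2 * planar_area f)"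
proof -
  note e = face_boundaryD[OF f ij]
  obtain w where P0: "spans_parallelogram f i (j - i) w" using parallelogram_at_dir_edge[OF s e(1)] by blast
  define u where "u = j - i"
  have P: "spans_parallelogram f i u w" using P0 by (simp add: u_def)
  have j: "j = i + u" by (simp add: u_def)
  define k where "k = i + u + w"
  define l where "l = i + w"
  note P1 = spans_parallelogram_rotate[OF P]
  note P2 = spans_parallelogram_rotate[OF P1]
  note P3 = spans_parallelogram_rotate[OF P2]
  have v: "verts f = {i, j, k, l}" using spans_parallelogram_verts[OF P] by (simp add: j k_def l_def)
  have de: "(j, k) \<in> dir_edges f" "(k, l) \<in> dir_edges f" "(l, i) \<in> dir_edges f"
    using spans_parallelogram_dir_edges(1)[OF P1] spans_parallelogram_dir_edges(1)[OF P2]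
      spans_parallelogram_dir_edges(1)[OF P3] by (simp_all add: j k_def l_def)
  have nde: "(i, k) \<notin> dir_edges f" "(j, l) \<notin> dir_edges f"
    using spans_parallelogram_dir_edges(2)[OF P] spans_parallelogram_dir_edges(2)[OF P1] by (simp_all add: j k_def l_def)
  have ne: "i \<noteq> j" "j \<noteq> k" "k \<noteq> l" "l \<noteq> i" "i \<noteq> k" "j \<noteq> l"
    using e(1) de spans_parallelogram_faces(5)[OF P] spans_parallelogram_faces(5)[OF P1]
    by (auto simp: dir_edges_def j k_def l_def add.assoc)
  let ?n = "outward_normal T f"
  have mem: "k \<in> f" "l \<in> f" "k \<in> verts f" "l \<in> verts f" using v verts_face[OF f] by auto
  have pos: "cross3 ?n u \<bullet> w \<ge> 0" using e(7)[OF mem(2)] by (simp add: j l_def)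
  have skew: "cross3 ?n w \<bullet> u = - (cross3 ?n u \<bullet> w)" by (simp add: cross3_simps)
  have bd1: "(j, k) \<in> face_boundary T f"
  proof (rule face_boundaryI[OF f de(1)])
    fix x assume "x \<in> verts f"
    then consider "x = i" | "x = j" | "x = k" | "x = l" using v by blast
    then show "0 \<le> cross3 ?n (k - j) \<bullet> (x - j)"
      by cases (use pos skew in \<open>simp_all add: j k_def l_def inner_diff_right dot_cross_self\<close>)
  qed
  have bd2: "(k, l) \<in> face_boundary T f"
  proof (rule face_boundaryI[OF f de(2)])
    fix x assume "x \<in> verts f"
    then consider "x = i" | "x = j" | "x = k" | "x = l" using v by blast
    then show "0 \<le> cross3 ?n (l - k) \<bullet> (x - k)"
      by cases (use pos skew in \<open>simp_all add: j k_def l_def inner_diff_right dot_cross_self\<close>)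
  qed
  have bd3: "(l, i) \<in> face_boundary T f"
  proof (rule face_boundaryI[OF f de(3)])
    fix x assume "x \<in> verts f"
    then consider "x = i" | "x = j" | "x = k" | "x = l" using v by blast
    then show "0 \<le> cross3 ?n (i - l) \<bullet> (x - l)"
      by cases (use pos skew in \<open>simp_all add: j k_def l_def inner_diff_right dot_cross_self\<close>)
  qed
  have ccw: "ccw_vertices T f [i, j, k, l]"
    using v ij ne bd1 bd2 bd3 by (intro ccw_vertices_quadrilateral) auto
  have diag: "(p, q) \<in> face_diagonals T" if "(p, q) \<notin> dir_edges f" "p \<in> verts f" "q \<in> verts f" "p \<noteq> q" for p q
  proof -
    have pq: "p \<in> verts T" "q \<in> verts T" "p \<in> f" "q \<in> f" using that verts_face[OF f] by auto
    have sub: "closed_segment p q \<subseteq> f" by (rule closed_segment_subset[OF pq(3,4) faceD(7)[OF f]])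
    then show ?thesis
      using pq(1,2) that(1,4) face_subset_frontier[OF f] dir_edges_face[OF f, of p q] by (auto simp: face_diagonals_def)
  qed
  have nodiag: "(p, q) \<notin> face_diagonals T" if "(p, q) \<in> dir_edges f" for p q
    using that dir_edges_face[OF f] by (auto simp: face_diagonals_def)
  have f_verts: "q \<in> verts f" if "(p, q) \<in> face_diagonals T" "q \<in> f" for p q
    using that verts_face[OF f] by (auto simp: face_diagonals_def)
  have irr: "(p, p) \<notin> face_diagonals T" for p by (auto simp: face_diagonals_def)
  have "(i, l) \<in> dir_edges f" "(j, i) \<in> dir_edges f" using de(3) e(1) dir_edges_commute by blast+
  then have n2: "(i, l) \<notin> face_diagonals T" "(j, i) \<notin> face_diagonals T"
    "(i, j) \<notin> face_diagonals T" "(j, k) \<notin> face_diagonals T" using nodiag e(1) de(1) by blast+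
  have ik: "{q. q \<in> adjacent_verts T i j \<and> (i, q) \<in> face_diagonals T \<and> q \<in> f} = {k}"
  proof
    show "{q. q \<in> adjacent_verts T i j \<and> (i, q) \<in> face_diagonals T \<and> q \<in> f} \<subseteq> {k}"
    proof
      fix q assume "q \<in> {q. q \<in> adjacent_verts T i j \<and> (i, q) \<in> face_diagonals T \<and> q \<in> f}"
      then have q: "(i, q) \<in> face_diagonals T" "q \<in> f" by auto
      then have "q \<in> {i, j, k, l}" using f_verts[OF q] v by simp
      then show "q \<in> {k}" using q(1) n2 irr[of i] by auto
    qed
    show "{k} \<subseteq> {q. q \<in> adjacent_verts T i j \<and> (i, q) \<in> face_diagonals T \<and> q \<in> f}"
      using diag[OF nde(1) e(5) mem(3) ne(5)] in_adjacent_verts[OF f e(2) mem(3)] mem(1) by blast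
  qed
  have jl: "{q. q \<in> adjacent_verts T i j \<and> (j, q) \<in> face_diagonals T \<and> q \<in> f} = {l}"
  proof
    show "{q. q \<in> adjacent_verts T i j \<and> (j, q) \<in> face_diagonals T \<and> q \<in> f} \<subseteq> {l}"
    proof
      fix q assume "q \<in> {q. q \<in> adjacent_verts T i j \<and> (j, q) \<in> face_diagonals T \<and> q \<in> f}"
      then have q: "(j, q) \<in> face_diagonals T" "q \<in> f" by auto
      then have "q \<in> {i, j, k, l}" using f_verts[OF q] v by simp
      then show "q \<in> {l}" using q(1) n2 irr[of j] by auto
    qed
    show "{l} \<subseteq> {q. q \<in> adjacent_verts T i j \<and> (j, q) \<in> face_diagonals T \<and> q \<in> f}"
      using diag[OF nde(2) e(6) mem(4) ne(6)] in_adjacent_verts[OF f e(2) mem(4)] mem(2) by blast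
  qed
  let ?D = "\<lambda>p q. face_jacobian T lam f p q x"
  \<comment> \<open>The row sums at \<open>i\<close> and at \<open>j\<close> eliminate the two
    diagonals.\<close>
  have "?D i i + ?D i j + ?D i k + ?D i l = 0" "?D j i + ?D j j + ?D j k + ?D j l = 0"
    using jacobian_sum[OF f x, of i] jacobian_sum[OF f x, of j] ne unfolding v by (simp_all add: add.assoc)
  moreover have "?D j i = - ?D i j" "?D i l = - ?D l i" by (rule jacobian_skew)+
  ultimately have "?D i j + (1/2) * (?D i k - ?D j l) = (1/2) * (?D j k + ?D l i)"
    using jacobian_refl[of f i x] jacobian_refl[of f j x] by (simp add: field_simps)
  then show ?thesis unfolding comb_jacobian[OF f x] ik jl using D[OF ccw] by simp
qed

lemma comb_jacobian_boundary:
  assumes f: "f \<in> faces T" and x: "x \<in> f" and ij: "(i, j) \<in> face_boundary T f"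
  shows "whitney_comb T C (\<lambda>p q. face_jacobian T lam f p q x) i j = 1 / (2 * planar_area f)"
proof -
  consider
    "2 simplex f" "\<And>p1 p2 p3. ccw_vertices T f [p1, p2, p3] \<Longrightarrow> face_jacobian T lam f p1 p2 x = 1 / (2 * planar_area f)"
  | "parallelogram f" "\<And>p1 p2 p3 p4. ccw_vertices T f [p1, p2, p3, p4] \<Longrightarrow>
      face_jacobian T lam f p2 p3 x + face_jacobian T lam f p4 p1 x = 1 / planar_area f"
    using face_cond f x unfolding face_conditions_def Let_def by blast
  then show ?thesis
  proof cases
    case 1
    show ?thesis by (rule comb_jacobian_triangle[OF f x ij 1])
  next
    case 2
    show ?thesis by (rule comb_jacobian_parallelogram[OF f x ij 2])
  qed
qed

text \<open>The delicate terms are diagonals from an end of the edge to a vertex in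
  \<open>f\<close>. That vertex also lies on a face along the edge, which is not \<open>f\<close>;
  two faces with two common points share an edge, and it joins just these points, so the supposed
  diagonal is an edge.\<close>

lemma comb_jacobian_off_face:
  assumes f: "f \<in> faces T" and x: "x \<in> f" and ij: "(i, j) \<in> dir_edges T" and off: "\<not> closed_segment i j \<subseteq> f"
  shows "whitney_comb T C (\<lambda>p q. face_jacobian T lam f p q x) i j = 0"
proof -
  have v: "i \<in> verts T" "j \<in> verts T" using ij by (auto simp: dir_edges_def)
  have nb: "\<not> (i \<in> f \<and> j \<in> f)" using off closed_segment_subset[OF _ _ faceD(7)[OF f]] by blast
  have z: "face_jacobian T lam f p k x = 0"
    if p: "p = i \<or> p = j" and k: "k \<in> adjacent_verts T i j" "(p, k) \<in> face_diagonals T" "k \<in> f" for p k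
  proof (cases "p \<in> f")
    case True
    obtain g where g: "g \<in> faces T" "closed_segment i j \<subseteq> g" "k \<in> verts g"
      using k(1) by (auto simp: adjacent_verts_def)
    have gf: "f \<noteq> g" using g(2) off by blast
    have pk: "p \<noteq> k" "p \<in> verts T" "k \<in> verts T" using k(2) by (auto simp: face_diagonals_def)
    have mem: "p \<in> f \<inter> g" "k \<in> f \<inter> g"
      using True k(3) g p verts_face[OF g(1)] ends_in_segment[of i j] by auto
    have fg: "f \<inter> g \<in> edges T" by (rule facet_Int_edge[OF f g(1) gf mem pk(1)])
    then obtain r s where rs: "f \<inter> g = closed_segment r s" "verts (f \<inter> g) = {r, s}" using edgeE by metis
    have F: "(f \<inter> g) face_of T" using fg by (auto simp: edges_def edge_of_def)
    have "p \<in> verts (f \<inter> g)" "k \<in> verts (f \<inter> g)"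
      using extreme_point_of_face[OF F] mem pk by (auto simp: verts_def)
    then have "f \<inter> g = closed_segment p k" using rs pk(1) closed_segment_commute by auto
    then have "(p, k) \<in> dir_edges T" using fg pk by (simp add: dir_edges_def)
    then show ?thesis using k(2) by (auto simp: face_diagonals_def)
  next
    case False
    then show ?thesis using jacobian_zero(1)[OF f _ _ x] p v by blast
  qed
  have "face_jacobian T lam f i j x = 0" using jacobian_zero[OF f _ _ x] v nb by blast
  then show ?thesis unfolding comb_jacobian[OF f x] using z by simp
qed

text \<open>Incidence number of a directed edge with the oriented boundary of a face.\<close>

definition boundary_sign :: "(real^3) set \<Rightarrow> (real^3) \<times> (real^3) \<Rightarrow> real" where
  "boundary_sign f e = (if e \<in> face_boundary T f then 1 else 0) - (if prod.swap e \<in> face_boundary T f then 1 else 0)"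

lemma comb_jacobian_sign:
  assumes f: "f \<in> faces T" and x: "x \<in> f" and ij: "(i, j) \<in> dir_edges T"
  shows "whitney_comb T C (\<lambda>p q. face_jacobian T lam f p q x) i j = boundary_sign f (i, j) / (2 * planar_area f)"
proof (cases "closed_segment i j \<subseteq> f")
  case True
  then have d: "(i, j) \<in> dir_edges f" using ij dir_edges_face[OF f] by blast
  show ?thesis
  proof (cases "(i, j) \<in> face_boundary T f")
    case True
    then show ?thesis using comb_jacobian_boundary[OF f x True] face_boundary_flip[OF f d] by (simp add: boundary_sign_def)
  next
    case False
    then have ji: "(j, i) \<in> face_boundary T f" using face_boundary_flip[OF f d] by blast
    have "whitney_comb T C (\<lambda>p q. face_jacobian T lam f p q x) i j = - whitney_comb T C (\<lambda>p q. face_jacobian T lam f p q x) j i"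
      by (rule whitney_comb_skew) (rule jacobian_skew)
    then show ?thesis using comb_jacobian_boundary[OF f x ji] False ji by (simp add: boundary_sign_def)
  qed
next
  case False
  then have "(i, j) \<notin> face_boundary T f" "(j, i) \<notin> face_boundary T f"
    using face_boundaryD(2)[OF f, of i j] face_boundaryD(2)[OF f, of j i] closed_segment_commute[of i j] by auto
  then show ?thesis using comb_jacobian_off_face[OF f x ij False] by (simp add: boundary_sign_def)
qed

end

section \<open>Spans of finite families\<close>

lemma span_family:
  fixes v :: "'i \<Rightarrow> 'a::real_vector"
  assumes "finite I"
  shows "span (v ` I) = range (\<lambda>c. \<Sum>i\<in>I. c i *\<^sub>R v i)"
proof
  show "span (v ` I) \<subseteq> range (\<lambda>c. \<Sum>i\<in>I. c i *\<^sub>R v i)"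
  proof (rule span_minimal)
    show "v ` I \<subseteq> range (\<lambda>c. \<Sum>i\<in>I. c i *\<^sub>R v i)"
    proof
      fix x assume "x \<in> v ` I"
      then obtain j where j: "j \<in> I" "x = v j" by blast
      have "x = (\<Sum>i\<in>I. (if i = j then 1 else 0) *\<^sub>R v i)"
        using assms j by (simp add: if_distrib[of "\<lambda>c. c *\<^sub>R _"] cong: if_cong)
      then show "x \<in> range (\<lambda>c. \<Sum>i\<in>I. c i *\<^sub>R v i)" by (intro range_eqI[of _ _ "\<lambda>i. if i = j then 1 else 0"])
    qed
    show "subspace (range (\<lambda>c. \<Sum>i\<in>I. c i *\<^sub>R v i))"
    proof (rule subspaceI)
      show "0 \<in> range (\<lambda>c. \<Sum>i\<in>I. c i *\<^sub>R v i)" by (rule range_eqI[of _ _ "\<lambda>_. 0"]) simp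
      fix x assume "x \<in> range (\<lambda>c. \<Sum>i\<in>I. c i *\<^sub>R v i)"
      then obtain c where c: "x = (\<Sum>i\<in>I. c i *\<^sub>R v i)" by blast
      show "k *\<^sub>R x \<in> range (\<lambda>c. \<Sum>i\<in>I. c i *\<^sub>R v i)" for k
        by (rule range_eqI[of _ _ "\<lambda>i. k * c i"]) (simp add: c scaleR_sum_right)
      fix y assume "y \<in> range (\<lambda>c. \<Sum>i\<in>I. c i *\<^sub>R v i)"
      then obtain d where d: "y = (\<Sum>i\<in>I. d i *\<^sub>R v i)" by blast
      show "x + y \<in> range (\<lambda>c. \<Sum>i\<in>I. c i *\<^sub>R v i)"
        by (rule range_eqI[of _ _ "\<lambda>i. c i + d i"]) (simp add: c d scaleR_add_left sum.distrib)
    qed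
  qed
  show "range (\<lambda>c. \<Sum>i\<in>I. c i *\<^sub>R v i) \<subseteq> span (v ` I)"
    by (rule image_subsetI) (intro span_sum span_scale span_base imageI)
qed

lemma dim_span_family:
  fixes v :: "'i \<Rightarrow> 'a::real_vector"
  assumes fin: "finite I" and indep: "\<And>c i. (\<Sum>i\<in>I. c i *\<^sub>R v i) = 0 \<Longrightarrow> i \<in> I \<Longrightarrow> c i = 0"
  shows "dim (span (v ` I)) = card I"
proof -
  have inj: "inj_on v I"
  proof (rule inj_onI, rule ccontr)
    fix i j assume ij: "i \<in> I" "j \<in> I" "v i = v j" "i \<noteq> j"
    \<comment> \<open>Equal vectors at two indices would give a relation with coefficients
      \<open>1\<close> and \<open>- 1\<close>, so the family is injective.\<close>
    let ?c = "\<lambda>k. (if k = i then 1 else 0) - (if k = j then 1 else 0 :: real)"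
    have "(\<Sum>k\<in>I. ?c k *\<^sub>R v k) = (\<Sum>k\<in>I. if k = i then v k else 0) - (\<Sum>k\<in>I. if k = j then v k else 0)"
      by (simp add: sum_subtractf[symmetric]) (auto intro!: sum.cong)
    also have "\<dots> = 0" using fin ij by simp
    finally have "?c i = 0" by (rule indep[of ?c i, OF _ ij(1)])
    then show False using ij(4) by simp
  qed
  have "independent (v ` I)"
  proof (rule independent_if_scalars_zero)
    show "finite (v ` I)" using fin by simp
    fix g x assume g: "(\<Sum>x\<in>v ` I. g x *\<^sub>R x) = 0" and x: "x \<in> v ` I"
    then have sum0: "(\<Sum>i\<in>I. g (v i) *\<^sub>R v i) = 0" by (simp add: sum.reindex[OF inj])
    obtain i where i: "i \<in> I" "x = v i" using x by blast
    show "g x = 0" unfolding i(2) by (rule indep[of "\<lambda>i. g (v i)", OF sum0 i(1)])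
  qed
  then have "dim (span (v ` I)) = card (v ` I)" by (simp add: dim_eq_card_independent)
  then show ?thesis using card_image[OF inj] by simp
qed

lemma span_family_drop:
  fixes v :: "'i \<Rightarrow> 'a::real_vector"
  assumes "finite I" "i0 \<in> I" "(\<Sum>i\<in>I. v i) = 0"
  shows "span (v ` (I - {i0})) = span (v ` I)"
proof
  show "span (v ` (I - {i0})) \<subseteq> span (v ` I)" by (intro span_mono image_mono) blast
  have "v i0 = - (\<Sum>i\<in>I - {i0}. v i)"
    using assms by (simp add: sum.remove[of I i0] eq_neg_iff_add_eq_0)
  also have "\<dots> \<in> span (v ` (I - {i0}))" by (intro span_neg span_sum span_base) blast
  finally have i0: "v i0 \<in> span (v ` (I - {i0}))" .
  have "v ` I \<subseteq> span (v ` (I - {i0}))"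
  proof
    fix x assume "x \<in> v ` I"
    then obtain i where i: "i \<in> I" "x = v i" by blast
    show "x \<in> span (v ` (I - {i0}))"
    proof (cases "i = i0")
      case True
      then show ?thesis using i0 i(2) by simp
    next
      case False
      then have "x \<in> v ` (I - {i0})" using i by blast
      then show ?thesis by (rule span_base)
    qed
  qed
  then show "span (v ` I) \<subseteq> span (v ` (I - {i0}))" by (intro span_minimal subspace_span)
qed

lemma span_plus_span: "span A + span B = span (A \<union> B)" for A :: "'a::real_vector set"
  by (auto simp: span_Un set_plus_def)

lemma image_case_sum_Plus: "case_sum v w ` (I <+> J) = v ` I \<union> w ` J"
  by (simp add: Plus_def image_Un image_image)

lemma eq_minus_self_imp_zero: "S = - S \<Longrightarrow> S = 0" for S :: "'a::real_vector"
proof -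
  assume "S = - S"
  then have "S + S = 0" by (metis add.right_inverse)
  then have "2 *\<^sub>R S = 0" by (simp add: scaleR_2)
  then show ?thesis by simp
qed

context convex_body3 begin

lemma weak_curl_pair_diff:
  assumes "weak_curl_pair u w" "weak_curl_pair u' w'"
  shows "weak_curl_pair (u - u') (w - w')"
  using weak_curl_pair_add[OF assms(1) weak_curl_pair_scale[OF assms(2), of "- 1"]] by simp

lemma weak_curl_grad: "C1_on T b \<Longrightarrow> weak_curl_pair (grad T b) 0"
  using weak_curl_mult_grad[OF C1_on_const(1)[of 1], of b] by (simp add: C1_on_const(2) zero_fun_def)

lemma weak_div_free_add: "weak_div_pair u 0 \<Longrightarrow> weak_div_pair u' 0 \<Longrightarrow> weak_div_pair (u + u') 0"
  and weak_div_free_scale: "weak_div_pair u 0 \<Longrightarrow> weak_div_pair (c *\<^sub>R u) 0"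
  and weak_div_free_diff: "weak_div_pair u 0 \<Longrightarrow> weak_div_pair u' 0 \<Longrightarrow> weak_div_pair (u - u') 0"
  using weak_div_pair_add[of u 0 u' 0] weak_div_pair_scale[of u 0 c]
    weak_div_pair_add[of u 0 "- 1 *\<^sub>R u'" "- 1 *\<^sub>R 0"] weak_div_pair_scale[of u' 0 "- 1"] by simp_all

lemma weak_div_free_sum: "(\<And>i. i \<in> I \<Longrightarrow> weak_div_pair (u i) 0) \<Longrightarrow> weak_div_pair (\<Sum>i\<in>I. u i) 0"
  by (induction I rule: infinite_finite_induct) (auto simp: weak_div_pair_zero weak_div_free_add)

end

section \<open>The space of face forms\<close>

context solid_polytope begin

lemma swap_dir_edges: "prod.swap ` dir_edges T = dir_edges T"
  using dir_edges_commute by (force simp: image_iff)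

lemma sum_dir_edges_swap: "(\<Sum>e\<in>dir_edges T. F (prod.swap e)) = (\<Sum>e\<in>dir_edges T. F e)"
  using sum.reindex[of prod.swap "dir_edges T" F] swap_dir_edges by (simp add: o_def)

text \<open>Of the two faces along the edge, the other one traverses it backwards.\<close>

lemma ex1_left_face: "e \<in> dir_edges T \<Longrightarrow> \<exists>!f. f \<in> faces T \<and> e \<in> face_boundary T f"
proof -
  assume e: "e \<in> dir_edges T"
  obtain p q where pq: "e = (p, q)" by fastforce
  obtain f g where fg: "f \<in> faces T" "g \<in> faces T" "{f \<in> faces T. closed_segment p q \<subseteq> f} = {f, g}"
    "(p, q) \<in> face_boundary T f" "(q, p) \<in> face_boundary T g"
    by (rule two_faces_of_dir_edge[OF e[unfolded pq]])
  have "f' = f" if f': "f' \<in> faces T" "(p, q) \<in> face_boundary T f'" for f'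
  proof -
    have "(p, q) \<in> dir_edges f'" using f'(2) by (simp add: face_boundary_def)
    then have "f' \<in> {f \<in> faces T. closed_segment p q \<subseteq> f}" using f'(1) dir_edges_face by blast
    moreover have "f' \<noteq> g"
      using face_boundary_flip[OF f'(1) \<open>(p, q) \<in> dir_edges f'\<close>] f'(2) fg(5) by blast
    ultimately show ?thesis using fg(3) by blast
  qed
  then show ?thesis using fg pq by blast
qed

text \<open>The oriented boundaries of the faces partition the directed edges of
  \<open>T\<close>.\<close>

lemma sum_face_boundaries:
  fixes M :: "(real^3) \<times> (real^3) \<Rightarrow> 'b::comm_monoid_add"
  shows "(\<Sum>f\<in>faces T. \<Sum>e\<in>face_boundary T f. M e) = (\<Sum>e\<in>dir_edges T. M e)"
proof -
  have U: "(\<Union>f\<in>faces T. face_boundary T f) = dir_edges T"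
  proof
    show "(\<Union>f\<in>faces T. face_boundary T f) \<subseteq> dir_edges T" by (rule UN_least) (rule face_boundary_subset)
    show "dir_edges T \<subseteq> (\<Union>f\<in>faces T. face_boundary T f)"
    proof
      fix e assume "e \<in> dir_edges T"
      then obtain f where "f \<in> faces T" "e \<in> face_boundary T f" using ex1_implies_ex[OF ex1_left_face] by blast
      then show "e \<in> (\<Union>f\<in>faces T. face_boundary T f)" by blast
    qed
  qed
  have "finite (face_boundary T f)" if "f \<in> faces T" for f
    using face_boundary_subset[OF that] finite_dir_edges finite_subset by blast
  moreover have "face_boundary T f \<inter> face_boundary T g = {}" if fg: "f \<in> faces T" "g \<in> faces T" "f \<noteq> g" for f g
  proof (rule ccontr)
    assume "face_boundary T f \<inter> face_boundary T g \<noteq> {}"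
    then obtain e where e: "e \<in> face_boundary T f" "e \<in> face_boundary T g" by blast
    then have "e \<in> dir_edges T" using face_boundary_subset[OF fg(1)] by blast
    from ex1_left_face[OF this] show False using e fg by (auto elim!: ex1E)
  qed
  ultimately show ?thesis unfolding U[symmetric]
    by (intro sum.UNION_disjoint[symmetric] finite_faces) auto
qed

end

context gbc_polytope begin

definition whitney_curl :: "real^3 \<Rightarrow> real^3 \<Rightarrow> real^3 \<Rightarrow> real^3" where
  "whitney_curl p q = (\<lambda>x. 2 *\<^sub>R cross3 (grad T (lam p) x) (grad T (lam q) x))"

text \<open>Explicit candidate for the curl of the face form: the same combination, with each
  Whitney form replaced by its curl.\<close>

definition face_curl :: "(real^3) set \<Rightarrow> real^3 \<Rightarrow> real^3" where
  "face_curl f = (\<Sum>e\<in>face_boundary T f. whitney_comb T C whitney_curl (fst e) (snd e))"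

lemma weak_curl_whitney:
  assumes "p \<in> verts T" "q \<in> verts T"
  shows "weak_curl_pair (whitney T lam p q) (whitney_curl p q)"
proof -
  have "weak_curl_pair ((\<lambda>x. lam p x *\<^sub>R grad T (lam q) x) - (\<lambda>x. lam q x *\<^sub>R grad T (lam p) x))
    ((\<lambda>x. cross3 (grad T (lam p) x) (grad T (lam q) x)) - (\<lambda>x. cross3 (grad T (lam q) x) (grad T (lam p) x)))"
    by (intro weak_curl_pair_diff weak_curl_mult_grad lam_C1 assms)
  moreover have "(\<lambda>x. cross3 (grad T (lam p) x) (grad T (lam q) x)) - (\<lambda>x. cross3 (grad T (lam q) x) (grad T (lam p) x)) = whitney_curl p q"
    unfolding whitney_curl_def
  proof (rule ext)
    fix x
    show "((\<lambda>x. cross3 (grad T (lam p) x) (grad T (lam q) x)) - (\<lambda>x. cross3 (grad T (lam q) x) (grad T (lam p) x))) x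
      = 2 *\<^sub>R cross3 (grad T (lam p) x) (grad T (lam q) x)"
      using cross_skew[of "grad T (lam q) x" "grad T (lam p) x"] by (simp add: scaleR_2)
  qed
  moreover have "(\<lambda>x. lam p x *\<^sub>R grad T (lam q) x) - (\<lambda>x. lam q x *\<^sub>R grad T (lam p) x) = whitney T lam p q"
    by (simp add: fun_eq_iff whitney_def)
  ultimately show ?thesis by simp
qed

lemma finite_inner_diagonals: "finite {k. (i, k) \<in> inner_diagonals T}"
  by (rule finite_subset[OF _ finite_verts]) (auto simp: inner_diagonals_def)

lemma weak_curl_comb:
  assumes "\<And>p q. p \<in> verts T \<Longrightarrow> q \<in> verts T \<Longrightarrow> weak_curl_pair (F p q) (G p q)" "i \<in> verts T" "j \<in> verts T"
  shows "weak_curl_pair (whitney_comb T C F i j) (whitney_comb T C G i j)"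
  unfolding whitney_comb_def
  by (intro weak_curl_pair_add weak_curl_pair_scale weak_curl_pair_diff weak_curl_pair_sum assms
      finite_adjacent finite_inner_diagonals) (auto simp: face_diagonals_def inner_diagonals_def)

lemma weak_div_comb:
  assumes "\<And>p q. p \<in> verts T \<Longrightarrow> q \<in> verts T \<Longrightarrow> weak_div_pair (F p q) 0" "i \<in> verts T" "j \<in> verts T"
  shows "weak_div_pair (whitney_comb T C F i j) 0"
  unfolding whitney_comb_def
  by (intro weak_div_free_add weak_div_free_scale weak_div_free_diff weak_div_free_sum assms)
    (auto simp: face_diagonals_def inner_diagonals_def)

lemma mod_whitney_comb: "mod_whitney T lam C i j = whitney_comb T C (whitney T lam) i j"
  by (rule ext) (simp add: mod_whitney_eq_comb linear_whitney_comb[OF linear_fun_apply])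

lemma face_whitney_sum: "face_whitney T lam C f = (\<Sum>e\<in>face_boundary T f. mod_whitney T lam C (fst e) (snd e))"
  by (rule ext) (simp add: face_whitney_def sum_fun_apply case_prod_unfold)

lemma face_boundary_verts:
  assumes "f \<in> faces T" "e \<in> face_boundary T f"
  shows "fst e \<in> verts T" "snd e \<in> verts T"
  using face_boundary_subset[OF assms(1)] assms(2) by (auto simp: dir_edges_def)

lemma finite_face_boundary: "f \<in> faces T \<Longrightarrow> finite (face_boundary T f)"
  using face_boundary_subset finite_dir_edges finite_subset by blast

lemma weak_curl_face: "f \<in> faces T \<Longrightarrow> weak_curl_pair (face_whitney T lam C f) (face_curl f)"
  unfolding face_whitney_sum face_curl_def mod_whitney_comb
  by (intro weak_curl_pair_sum weak_curl_comb weak_curl_whitney finite_face_boundary face_boundary_verts)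

lemma weak_div_face: "f \<in> faces T \<Longrightarrow> weak_div_pair (face_curl f) 0"
proof -
  assume f: "f \<in> faces T"
  have "weak_div_pair (whitney_curl p q) 0" if "p \<in> verts T" "q \<in> verts T" for p q
    using weak_div_free_scale[OF weak_div_cross_grad[OF lam_C1[OF that(1)] lam_C1[OF that(2)]], of 2]
    by (simp add: whitney_curl_def scaleR_fun_def)
  then show ?thesis unfolding face_curl_def
    by (intro weak_div_free_sum weak_div_comb face_boundary_verts[OF f]) auto
qed

text \<open>The factor \<open>2\<close> in the curl of a Whitney form cancels that in the value of
  the Jacobian combination, so each boundary edge contributes its incidence number over the
  area.\<close>

lemma face_curl_flux:
  assumes f: "f \<in> faces T" and g: "g \<in> faces T" and x: "x \<in> g"
  shows "face_curl f x \<bullet> outward_normal T g = (\<Sum>e\<in>face_boundary T f. boundary_sign g e) / planar_area g"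
proof -
  let ?n = "outward_normal T g"
  have lin: "linear (\<lambda>F :: real^3 \<Rightarrow> real^3. F x \<bullet> ?n)"
    by (rule linearI) (auto simp: inner_add_left scaleR_fun_def)
  have "whitney_comb T C whitney_curl (fst e) (snd e) x \<bullet> ?n = boundary_sign g e / planar_area g"
    if e: "e \<in> face_boundary T f" for e
  proof -
    have "whitney_comb T C whitney_curl (fst e) (snd e) x \<bullet> ?n
        = whitney_comb T C (\<lambda>p q. whitney_curl p q x \<bullet> ?n) (fst e) (snd e)"
      by (rule linear_whitney_comb[OF lin])
    also have "\<dots> = whitney_comb T C (\<lambda>p q. 2 *\<^sub>R face_jacobian T lam g p q x) (fst e) (snd e)"
      by (simp add: whitney_curl_def face_jacobian_def)
    also have "\<dots> = 2 *\<^sub>R whitney_comb T C (\<lambda>p q. face_jacobian T lam g p q x) (fst e) (snd e)"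
      by (rule linear_whitney_comb[symmetric, OF linear_scale_self])
    also have "whitney_comb T C (\<lambda>p q. face_jacobian T lam g p q x) (fst e) (snd e) = boundary_sign g e / (2 * planar_area g)"
      using comb_jacobian_sign[OF g x, of "fst e" "snd e"] face_boundary_subset[OF f] e by auto
    finally show ?thesis by simp
  qed
  then show ?thesis
    by (simp add: face_curl_def linear_sum[OF lin] sum_divide_distrib)
qed

text \<open>Testing a vanishing combination of the curls with the fluxes through the faces, weighted by
  its own coefficients, gives the Dirichlet form of the dual graph.\<close>

lemma face_curl_kernel:
  assumes z: "(\<Sum>f\<in>faces T. c f *\<^sub>R face_curl f) = 0" and fg: "f \<in> faces T" "g \<in> faces T"
  shows "c f = c g"
proof -
  \<comment> \<open>Each directed edge lies in the boundary of exactly one face, so coefficients on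
    faces become coefficients \<open>a\<close> on directed edges; the value at the reversed edge
    belongs to the face on the other side.\<close>
  define left where "left e = (THE f. f \<in> faces T \<and> e \<in> face_boundary T f)" for e
  have left: "left e = f" if "f \<in> faces T" "e \<in> face_boundary T f" for e f
    unfolding left_def using ex1_left_face[of e] face_boundary_subset[OF that(1)] that by (intro the1_equality) auto
  define a where "a e = c (left e)" for e
  have a_sum: "(\<Sum>f\<in>faces T. if e \<in> face_boundary T f then c f else 0) = a e" if e: "e \<in> dir_edges T" for e
  proof -
    obtain f where f: "f \<in> faces T" "e \<in> face_boundary T f" using ex1_implies_ex[OF ex1_left_face[OF e]] by blast
    then have "e \<in> face_boundary T f' \<longleftrightarrow> f' = f" if "f' \<in> faces T" for f' using left that by blast
    then have "(\<Sum>f\<in>faces T. if e \<in> face_boundary T f then c f else 0) = (\<Sum>f'\<in>faces T. if f' = f then c f' else 0)"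
      by (intro sum.cong) auto
    also have "\<dots> = c f" using f(1) finite_faces by simp
    finally show ?thesis using left[OF f] by (simp add: a_def)
  qed
  have flux: "(\<Sum>f\<in>faces T. c f * (\<Sum>e\<in>face_boundary T f. boundary_sign g e)) = 0" if g: "g \<in> faces T" for g
  proof -
    obtain x where x: "x \<in> g" using faceD(6)[OF g] by blast
    have lin: "linear (\<lambda>F :: real^3 \<Rightarrow> real^3. F x \<bullet> outward_normal T g)"
      by (rule linearI) (auto simp: inner_add_left scaleR_fun_def)
    have "0 = (\<Sum>f\<in>faces T. c f *\<^sub>R face_curl f) x \<bullet> outward_normal T g" by (simp add: z)
    also have "\<dots> = (\<Sum>f\<in>faces T. c f * (face_curl f x \<bullet> outward_normal T g))"
      by (simp add: linear_sum[OF lin] linear_cmul[OF lin])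
    also have "\<dots> = (\<Sum>f\<in>faces T. c f * ((\<Sum>e\<in>face_boundary T f. boundary_sign g e) / planar_area g))"
      by (rule sum.cong) (simp_all add: face_curl_flux[OF _ g x])
    also have "\<dots> = (\<Sum>f\<in>faces T. c f * (\<Sum>e\<in>face_boundary T f. boundary_sign g e)) / planar_area g"
      unfolding times_divide_eq_right by (rule sum_divide_distrib[symmetric])
    finally show ?thesis using planar_area_pos[OF g] by simp
  qed
  have "0 = (\<Sum>g\<in>faces T. c g * (\<Sum>f\<in>faces T. c f * (\<Sum>e\<in>face_boundary T f. boundary_sign g e)))"
    using flux by simp
  also have "\<dots> = (\<Sum>g\<in>faces T. c g * (\<Sum>f\<in>faces T. \<Sum>e\<in>face_boundary T f. a e * boundary_sign g e))"
  proof (intro sum.cong refl arg_cong2[where f = "(*)"])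
    fix f assume f: "f \<in> faces T"
    show "c f * (\<Sum>e\<in>face_boundary T f. boundary_sign g e) = (\<Sum>e\<in>face_boundary T f. a e * boundary_sign g e)" for g
      unfolding sum_distrib_left by (rule sum.cong) (simp_all add: a_def left[OF f])
  qed
  also have "\<dots> = (\<Sum>g\<in>faces T. \<Sum>e\<in>dir_edges T. a e * (c g * boundary_sign g e))"
    unfolding sum_face_boundaries sum_distrib_left by (simp add: mult.left_commute)
  also have "\<dots> = (\<Sum>e\<in>dir_edges T. \<Sum>g\<in>faces T. a e * (c g * boundary_sign g e))" by (rule sum.swap)
  also have "\<dots> = (\<Sum>e\<in>dir_edges T. a e * (a e - a (prod.swap e)))"
  proof (rule sum.cong)
    fix e assume e: "e \<in> dir_edges T"
    then have e': "prod.swap e \<in> dir_edges T" using swap_dir_edges by blast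
    have "(\<Sum>g\<in>faces T. c g * boundary_sign g e)
      = (\<Sum>f\<in>faces T. if e \<in> face_boundary T f then c f else 0) - (\<Sum>f\<in>faces T. if prod.swap e \<in> face_boundary T f then c f else 0)"
      unfolding sum_subtractf[symmetric] by (rule sum.cong) (auto simp: boundary_sign_def)
    then show "(\<Sum>g\<in>faces T. a e * (c g * boundary_sign g e)) = a e * (a e - a (prod.swap e))"
      by (simp add: sum_distrib_left[symmetric] a_sum[OF e] a_sum[OF e'])
  qed simp
  finally have S: "(\<Sum>e\<in>dir_edges T. a e * (a e - a (prod.swap e))) = 0" by simp
  \<comment> \<open>Reversal permutes the directed edges; adding the sum to its reversed form
    produces a sum of squares.\<close>
  then have S': "(\<Sum>e\<in>dir_edges T. a (prod.swap e) * (a (prod.swap e) - a e)) = 0"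
    using sum_dir_edges_swap[of "\<lambda>e. a e * (a e - a (prod.swap e))"] by simp
  have "(\<Sum>e\<in>dir_edges T. (a e - a (prod.swap e))\<^sup>2)
    = (\<Sum>e\<in>dir_edges T. a e * (a e - a (prod.swap e)) + a (prod.swap e) * (a (prod.swap e) - a e))"
    by (rule sum.cong) (auto simp: power2_eq_square algebra_simps)
  also have "\<dots> = 0" by (simp only: sum.distrib S S')
  finally have eq: "a e = a (prod.swap e)" if "e \<in> dir_edges T" for e
    using sum_nonneg_eq_0_iff[OF finite_dir_edges, of "\<lambda>e. (a e - a (prod.swap e))\<^sup>2"] that by simp
  show ?thesis
  proof (rule constant_across_edges_imp_constant[of c, OF _ fg])
    fix f g assume F: "f \<in> faces T" "g \<in> faces T" "f \<noteq> g" "f \<inter> g \<in> edges T"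
    obtain p q where pq: "f \<inter> g = closed_segment p q" "(p, q) \<in> dir_edges T" using edgeE[OF F(4)] by metis
    obtain f1 g1 where fg1: "f1 \<in> faces T" "g1 \<in> faces T" "{f \<in> faces T. closed_segment p q \<subseteq> f} = {f1, g1}"
      "(p, q) \<in> face_boundary T f1" "(q, p) \<in> face_boundary T g1"
      by (rule two_faces_of_dir_edge[OF pq(2)])
    have "c f1 = c g1" using eq[OF pq(2)] left[OF fg1(1,4)] left[OF fg1(2,5)] by (simp add: a_def)
    moreover have "f \<in> {f \<in> faces T. closed_segment p q \<subseteq> f}" "g \<in> {f \<in> faces T. closed_segment p q \<subseteq> f}"
      using F pq(1) by auto
    then have "f \<in> {f1, g1}" "g \<in> {f1, g1}" unfolding fg1(3) .
    ultimately show "c f = c g" by auto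
  qed
qed

lemma face_whitney_total: "(\<Sum>f\<in>faces T. face_whitney T lam C f) = 0"
proof -
  let ?M = "\<lambda>e. mod_whitney T lam C (fst e) (snd e)"
  have skew: "?M (prod.swap e) = - ?M e" for e
    unfolding mod_whitney_comb fst_swap snd_swap
    by (rule whitney_comb_skew) (simp add: fun_eq_iff whitney_def)
  have "(\<Sum>e\<in>dir_edges T. ?M e) = (\<Sum>e\<in>dir_edges T. ?M (prod.swap e))" by (rule sum_dir_edges_swap[symmetric])
  also have "\<dots> = - (\<Sum>e\<in>dir_edges T. ?M e)" unfolding skew sum_negf ..
  finally have "(\<Sum>e\<in>dir_edges T. ?M e) = 0" by (rule eq_minus_self_imp_zero)
  then show ?thesis unfolding face_whitney_sum sum_face_boundaries .
qed

text \<open>The relation among the face forms passes to their curls by uniqueness of the curl of the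
  zero field.\<close>

lemma face_curl_total: "(\<Sum>f\<in>faces T. face_curl f) = 0"
proof -
  have "weak_curl_pair (\<Sum>f\<in>faces T. face_whitney T lam C f) (\<Sum>f\<in>faces T. face_curl f)"
    by (intro weak_curl_pair_sum finite_faces weak_curl_face)
  then have "weak_curl_pair 0 (\<Sum>f\<in>faces T. face_curl f)" by (simp only: face_whitney_total)
  from curl_eqI[OF this] curl_eqI[OF weak_curl_pair_zero] show ?thesis by simp
qed

end

section \<open>Exactness and dimensions\<close>

context gbc_polytope begin

lemma M0_eq: "M0 T lam = range (\<lambda>a. \<Sum>p\<in>verts T. a p *\<^sub>R zext T (lam p))"
  unfolding M0_def by (rule span_family[OF finite_verts])

lemma M1_eq: "M1 T lam C = {(\<Sum>p\<in>verts T. a p *\<^sub>R grad T (lam p)) + (\<Sum>f\<in>faces T. c f *\<^sub>R face_whitney T lam C f) | a c. True}"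
  unfolding M1_def span_family[OF finite_verts] span_family[OF finite_faces] by (auto simp: set_plus_def)

lemma curl_face_whitney: "f \<in> faces T \<Longrightarrow> curl T (face_whitney T lam C f) = face_curl f"
  by (rule curl_eqI[OF weak_curl_face])

lemma M2_eq: "M2 T lam C xs = {(\<Sum>f\<in>faces T. c f *\<^sub>R face_curl f) + k *\<^sub>R zext T (\<lambda>x. x - xs) | c k. True}"
proof -
  have "(\<lambda>f. curl T (face_whitney T lam C f)) ` faces T = face_curl ` faces T"
    using curl_face_whitney by (rule image_cong[OF refl])
  then show ?thesis unfolding M2_def span_singleton
    by (simp add: span_family[OF finite_faces]) (auto simp: set_plus_def)
qed

lemma M0_pointwise: "(\<Sum>p\<in>verts T. a p *\<^sub>R zext T (lam p)) = zext T (\<lambda>x. \<Sum>p\<in>verts T. a p * lam p x)"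
  by (rule ext) (simp add: sum_fun_apply scaleR_fun_def zext_def)

lemma C1_combination: "C1_on T (\<lambda>x. \<Sum>p\<in>verts T. a p * lam p x)"
  and grad_combination: "grad T (\<Sum>p\<in>verts T. a p *\<^sub>R zext T (lam p)) = (\<Sum>p\<in>verts T. a p *\<^sub>R grad T (lam p))"
proof -
  show "C1_on T (\<lambda>x. \<Sum>p\<in>verts T. a p * lam p x)"
    by (rule C1_on_sum(1)[OF finite_verts]) (rule C1_on_scale(1)[OF lam_C1])
  have "grad T (\<Sum>p\<in>verts T. a p *\<^sub>R zext T (lam p)) = grad T (\<lambda>x. \<Sum>p\<in>verts T. a p * lam p x)"
    unfolding M0_pointwise by (rule grad_zext(1))
  also have "\<dots> = (\<lambda>x. \<Sum>p\<in>verts T. grad T (\<lambda>x. a p * lam p x) x)"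
    by (rule C1_on_sum(2)[OF finite_verts]) (rule C1_on_scale(1)[OF lam_C1])
  also have "\<dots> = (\<Sum>p\<in>verts T. a p *\<^sub>R grad T (lam p))"
    by (rule ext) (simp add: sum_fun_apply scaleR_fun_def C1_on_scale(2)[OF lam_C1])
  finally show "grad T (\<Sum>p\<in>verts T. a p *\<^sub>R zext T (lam p)) = (\<Sum>p\<in>verts T. a p *\<^sub>R grad T (lam p))" .
qed

lemma weak_curl_M1:
  "weak_curl_pair ((\<Sum>p\<in>verts T. a p *\<^sub>R grad T (lam p)) + (\<Sum>f\<in>faces T. c f *\<^sub>R face_whitney T lam C f))
     (\<Sum>f\<in>faces T. c f *\<^sub>R face_curl f)"
proof -
  have "weak_curl_pair (\<Sum>p\<in>verts T. a p *\<^sub>R grad T (lam p)) (\<Sum>p\<in>verts T. a p *\<^sub>R 0)"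
    by (intro weak_curl_pair_sum finite_verts weak_curl_pair_scale weak_curl_grad lam_C1)
  moreover have "weak_curl_pair (\<Sum>f\<in>faces T. c f *\<^sub>R face_whitney T lam C f) (\<Sum>f\<in>faces T. c f *\<^sub>R face_curl f)"
    by (intro weak_curl_pair_sum finite_faces weak_curl_pair_scale weak_curl_face)
  ultimately show ?thesis using weak_curl_pair_add by fastforce
qed

lemma weak_div_M2:
  "weak_div_pair ((\<Sum>f\<in>faces T. c f *\<^sub>R face_curl f) + k *\<^sub>R zext T (\<lambda>x. x - xs)) (k *\<^sub>R zext T (\<lambda>_. 3))"
proof -
  have "weak_div_pair (\<Sum>f\<in>faces T. c f *\<^sub>R face_curl f) 0"
    by (intro weak_div_free_sum weak_div_free_scale weak_div_face)
  from weak_div_pair_add[OF this weak_div_pair_scale[OF weak_div_position, of k xs]] show ?thesis by simp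
qed

lemma zext_const_eq_zero: "zext T (\<lambda>_. c) = 0 \<longleftrightarrow> c = (0::real)"
proof
  assume "zext T (\<lambda>_. c) = 0"
  moreover obtain x where "x \<in> T" using interior_nonempty interior_subset by blast
  ultimately have "zext T (\<lambda>_. c) x = 0" by simp
  then show "c = 0" using \<open>x \<in> T\<close> by (simp add: zext_def)
qed (auto simp: zext_def)

text \<open>The coefficients are all equal and the face forms sum to zero; hence \<open>curl\<close>
  is injective on the span of the face forms.\<close>

lemma face_curl_combination_zero:
  assumes "(\<Sum>f\<in>faces T. c f *\<^sub>R face_curl f) = 0"
  shows "(\<Sum>f\<in>faces T. c f *\<^sub>R face_whitney T lam C f) = 0"
proof (cases "faces T = {}")
  case False
  then obtain f0 where "f0 \<in> faces T" by blast
  then have "c f = c f0" if "f \<in> faces T" for f using face_curl_kernel[OF assms that] by blast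
  then have "(\<Sum>f\<in>faces T. c f *\<^sub>R face_whitney T lam C f) = c f0 *\<^sub>R (\<Sum>f\<in>faces T. face_whitney T lam C f)"
    unfolding scaleR_sum_right by (intro sum.cong) auto
  then show ?thesis by (simp add: face_whitney_total)
qed simp

text \<open>A zero gradient on the convex set \<open>T\<close> makes the combination a constant
  \<open>k\<close>, and the Lagrange property reads off the coefficients at the vertices.\<close>

lemma grad_combination_zero:
  assumes "(\<Sum>p\<in>verts T. a p *\<^sub>R grad T (lam p)) = 0"
  obtains k where "(\<Sum>p\<in>verts T. a p *\<^sub>R zext T (lam p)) = zext T (\<lambda>_. k)" "\<And>p. p \<in> verts T \<Longrightarrow> a p = k"
proof -
  let ?u = "\<lambda>x. \<Sum>p\<in>verts T. a p * lam p x"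
  have "grad T ?u = 0"
    using grad_combination[of a] assms unfolding M0_pointwise grad_zext(1) by simp
  then have "(?u has_derivative (\<lambda>h. 0)) (at x within T)" if "x \<in> T" for x
    using C1_on_grad(2)[OF C1_combination that, of a] by simp
  then obtain k where k: "\<And>x. x \<in> T \<Longrightarrow> ?u x = k"
    using has_derivative_zero_constant[OF convex, of ?u] by blast
  have "a p = k" if p: "p \<in> verts T" for p
  proof -
    have "?u p = (\<Sum>q\<in>verts T. if q = p then a q else 0)"
      by (rule sum.cong) (use lam_lagrange p in auto)
    then show ?thesis using k[of p] p verts_subset finite_verts by auto
  qed
  moreover have "(\<Sum>p\<in>verts T. a p *\<^sub>R zext T (lam p)) = zext T (\<lambda>_. k)"
    unfolding M0_pointwise using k by (auto simp: zext_def)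
  ultimately show ?thesis using that by blast
qed

lemma const_in_M0: "zext T (\<lambda>_. k) = (\<Sum>p\<in>verts T. k *\<^sub>R zext T (lam p))"
  unfolding M0_pointwise sum_distrib_left[symmetric] using lam_sum by (auto simp: zext_def)

lemma subspace_consts: "subspace (consts_on T)"
proof (rule subspaceI)
  show "0 \<in> consts_on T" unfolding consts_on_def by (rule range_eqI[of _ _ 0]) (auto simp: zext_def)
  fix x y :: "real^3 \<Rightarrow> real" and c :: real
  assume "x \<in> consts_on T"
  then obtain k where k: "x = zext T (\<lambda>_. k)" by (auto simp: consts_on_def)
  show "c *\<^sub>R x \<in> consts_on T" unfolding consts_on_def k
    by (rule range_eqI[of _ _ "c * k"]) (auto simp: zext_def scaleR_fun_def)
  assume "y \<in> consts_on T"
  then obtain l where l: "y = zext T (\<lambda>_. l)" by (auto simp: consts_on_def)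
  show "x + y \<in> consts_on T" unfolding consts_on_def k l
    by (rule range_eqI[of _ _ "k + l"]) (auto simp: zext_def)
qed

lemma subspace_M: "subspace (M0 T lam)" "subspace (M1 T lam C)" "subspace (M2 T lam C xs)"
  unfolding M0_def M1_def M2_def span_plus_span by (rule subspace_span)+

lemma consts_subset_M0: "consts_on T \<subseteq> M0 T lam"
  unfolding M0_eq consts_on_def using const_in_M0 by auto

lemma M0E:
  assumes "u \<in> M0 T lam"
  obtains a where "u = (\<Sum>p\<in>verts T. a p *\<^sub>R zext T (lam p))"
  using assms unfolding M0_eq by blast

lemma M1E:
  assumes "u \<in> M1 T lam C"
  obtains a c where "u = (\<Sum>p\<in>verts T. a p *\<^sub>R grad T (lam p)) + (\<Sum>f\<in>faces T. c f *\<^sub>R face_whitney T lam C f)"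
    "curl T u = (\<Sum>f\<in>faces T. c f *\<^sub>R face_curl f)" "weak_curl_pair u (curl T u)"
  using assms weak_curl_M1 curl_eqI[OF weak_curl_M1] unfolding M1_eq by force

lemma M2E:
  assumes "w \<in> M2 T lam C xs"
  obtains c k where "w = (\<Sum>f\<in>faces T. c f *\<^sub>R face_curl f) + k *\<^sub>R zext T (\<lambda>x. x - xs)"
    "divergence T w = zext T (\<lambda>_. 3 * k)" "weak_div_pair w (divergence T w)"
proof -
  obtain c k where w: "w = (\<Sum>f\<in>faces T. c f *\<^sub>R face_curl f) + k *\<^sub>R zext T (\<lambda>x. x - xs)"
    using assms unfolding M2_eq by blast
  have d: "weak_div_pair w (k *\<^sub>R zext T (\<lambda>_. 3))" unfolding w by (rule weak_div_M2)
  then have "divergence T w = k *\<^sub>R zext T (\<lambda>_. 3)" by (rule divergence_eqI)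
  moreover have "k *\<^sub>R zext T (\<lambda>_. 3) = zext T (\<lambda>_. 3 * k)" by (auto simp: zext_def scaleR_fun_def)
  ultimately show ?thesis using that[OF w] d by simp
qed

lemma grad_M0_in_M1: "(\<Sum>p\<in>verts T. a p *\<^sub>R grad T (lam p)) \<in> M1 T lam C"
proof -
  have "(\<Sum>p\<in>verts T. a p *\<^sub>R grad T (lam p)) + (\<Sum>f\<in>faces T. 0 *\<^sub>R face_whitney T lam C f) \<in> M1 T lam C"
    unfolding M1_eq by (intro CollectI exI conjI TrueI) (rule refl)
  then show ?thesis by simp
qed

lemma face_whitney_in_M1: "(\<Sum>f\<in>faces T. c f *\<^sub>R face_whitney T lam C f) \<in> M1 T lam C"
proof -
  have "(\<Sum>p\<in>verts T. 0 *\<^sub>R grad T (lam p)) + (\<Sum>f\<in>faces T. c f *\<^sub>R face_whitney T lam C f) \<in> M1 T lam C"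
    unfolding M1_eq by (intro CollectI exI conjI TrueI) (rule refl)
  then show ?thesis by simp
qed

lemma face_curl_in_M2: "(\<Sum>f\<in>faces T. c f *\<^sub>R face_curl f) \<in> M2 T lam C xs"
proof -
  have "(\<Sum>f\<in>faces T. c f *\<^sub>R face_curl f) + 0 *\<^sub>R zext T (\<lambda>x. x - xs) \<in> M2 T lam C xs"
    unfolding M2_eq by blast
  then show ?thesis by simp
qed

lemma linear_grad: "linear_map_on (M0 T lam) (M1 T lam C) (grad T)"
  unfolding linear_map_on_def
proof (intro conjI ballI allI subspace_M)
  show "grad T ` M0 T lam \<subseteq> M1 T lam C"
    by (auto elim!: M0E simp: grad_combination grad_M0_in_M1)
  have C1: "C1_on T u" if "u \<in> M0 T lam" for u
    using that C1_combination by (auto elim!: M0E simp: M0_pointwise grad_zext(2))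
  fix u assume u: "u \<in> M0 T lam"
  show "grad T (c *\<^sub>R u) = c *\<^sub>R grad T u" for c
    using C1_on_scale(2)[OF C1[OF u], of c] by (simp add: scaleR_fun_def)
  fix v assume v: "v \<in> M0 T lam"
  show "grad T (u + v) = grad T u + grad T v"
    using C1_on_add(2)[OF C1[OF u] C1[OF v]] by (simp add: plus_fun_def)
qed

lemma linear_curl: "linear_map_on (M1 T lam C) (M2 T lam C xs) (curl T)"
  unfolding linear_map_on_def
proof (intro conjI ballI allI subspace_M)
  show "curl T ` M1 T lam C \<subseteq> M2 T lam C xs"
  proof
    fix w assume "w \<in> curl T ` M1 T lam C"
    then obtain u where u: "u \<in> M1 T lam C" "w = curl T u" by blast
    obtain c where "curl T u = (\<Sum>f\<in>faces T. c f *\<^sub>R face_curl f)" using M1E[OF u(1)] by metis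
    then show "w \<in> M2 T lam C xs" using face_curl_in_M2 u(2) by simp
  qed
  have pair: "weak_curl_pair u (curl T u)" if "u \<in> M1 T lam C" for u using M1E[OF that] by metis
  fix u assume u: "u \<in> M1 T lam C"
  show "curl T (c *\<^sub>R u) = c *\<^sub>R curl T u" for c by (rule curl_eqI[OF weak_curl_pair_scale[OF pair[OF u]]])
  fix v assume v: "v \<in> M1 T lam C"
  show "curl T (u + v) = curl T u + curl T v" by (rule curl_eqI[OF weak_curl_pair_add[OF pair[OF u] pair[OF v]]])
qed

lemma linear_divergence: "linear_map_on (M2 T lam C xs) (consts_on T) (divergence T)"
  unfolding linear_map_on_def
proof (intro conjI ballI allI subspace_M subspace_consts)
  show "divergence T ` M2 T lam C xs \<subseteq> consts_on T"
  proof
    fix g assume "g \<in> divergence T ` M2 T lam C xs"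
    then obtain w where w: "w \<in> M2 T lam C xs" "g = divergence T w" by blast
    obtain k where "divergence T w = zext T (\<lambda>_. 3 * k)" using M2E[OF w(1)] by metis
    then show "g \<in> consts_on T" using w(2) by (auto simp: consts_on_def)
  qed
  have pair: "weak_div_pair w (divergence T w)" if "w \<in> M2 T lam C xs" for w using M2E[OF that] by metis
  fix u assume u: "u \<in> M2 T lam C xs"
  show "divergence T (c *\<^sub>R u) = c *\<^sub>R divergence T u" for c
    by (rule divergence_eqI[OF weak_div_pair_scale[OF pair[OF u]]])
  fix v assume v: "v \<in> M2 T lam C xs"
  show "divergence T (u + v) = divergence T u + divergence T v"
    by (rule divergence_eqI[OF weak_div_pair_add[OF pair[OF u] pair[OF v]]])
qed

section \<open>Exactness at each term of the sequence\<close>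

lemma exact_consts: "exact_at {0} id (consts_on T) id (M0 T lam)"
  using subspace_consts subspace_M(1) consts_subset_M0 subspace_0[OF subspace_consts]
  by (auto simp: exact_at_def linear_map_on_def subspace_single_0)

lemma exact_M0: "exact_at (consts_on T) id (M0 T lam) (grad T) (M1 T lam C)"
  unfolding exact_at_def
proof (intro conjI)
  show "linear_map_on (consts_on T) (M0 T lam) id"
    using subspace_consts subspace_M(1) consts_subset_M0 by (simp add: linear_map_on_def)
  show "linear_map_on (M0 T lam) (M1 T lam C) (grad T)" by (rule linear_grad)
  show "id ` consts_on T = {v \<in> M0 T lam. grad T v = 0}"
  proof (intro equalityI subsetI)
    fix v assume "v \<in> id ` consts_on T"
    then have v: "v \<in> consts_on T" by simp
    then obtain k where "v = zext T (\<lambda>_. k)" by (auto simp: consts_on_def)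
    then have "grad T v = 0" by (simp add: grad_zext(1) C1_on_const(2) zero_fun_def)
    then show "v \<in> {v \<in> M0 T lam. grad T v = 0}" using v consts_subset_M0 by blast
  next
    fix v assume "v \<in> {v \<in> M0 T lam. grad T v = 0}"
    then obtain a where a: "v = (\<Sum>p\<in>verts T. a p *\<^sub>R zext T (lam p))" "grad T v = 0" by (auto elim: M0E)
    then obtain k where "v = zext T (\<lambda>_. k)"
      using grad_combination_zero[of a] by (metis grad_combination)
    then show "v \<in> id ` consts_on T" by (auto simp: consts_on_def)
  qed
qed

lemma exact_M1: "exact_at (M0 T lam) (grad T) (M1 T lam C) (curl T) (M2 T lam C xs)"
  unfolding exact_at_def
proof (intro conjI linear_grad linear_curl equalityI subsetI)
  fix u assume "u \<in> grad T ` M0 T lam"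
  then obtain a where u: "u = (\<Sum>p\<in>verts T. a p *\<^sub>R grad T (lam p))"
    by (auto elim!: M0E simp: grad_combination)
  have "weak_curl_pair u 0" using weak_curl_M1[of a "\<lambda>_. 0"] by (simp add: u)
  then have "curl T u = 0" by (rule curl_eqI)
  then show "u \<in> {v \<in> M1 T lam C. curl T v = 0}" using grad_M0_in_M1 u by simp
next
  fix u assume u: "u \<in> {v \<in> M1 T lam C. curl T v = 0}"
  then obtain a c where ac: "u = (\<Sum>p\<in>verts T. a p *\<^sub>R grad T (lam p)) + (\<Sum>f\<in>faces T. c f *\<^sub>R face_whitney T lam C f)"
    "curl T u = (\<Sum>f\<in>faces T. c f *\<^sub>R face_curl f)" by (auto elim: M1E)
  \<comment> \<open>A vanishing curl kills the whole contribution of the face forms, and only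
    gradients remain.\<close>
  then have "u = grad T (\<Sum>p\<in>verts T. a p *\<^sub>R zext T (lam p))"
    using face_curl_combination_zero[of c] u grad_combination[of a] by simp
  then show "u \<in> grad T ` M0 T lam" unfolding M0_eq by blast
qed

lemma exact_M2: "exact_at (M1 T lam C) (curl T) (M2 T lam C xs) (divergence T) (consts_on T)"
  unfolding exact_at_def
proof (intro conjI linear_curl linear_divergence equalityI subsetI)
  fix w assume "w \<in> curl T ` M1 T lam C"
  then obtain c where w: "w = (\<Sum>f\<in>faces T. c f *\<^sub>R face_curl f)" by (auto elim: M1E)
  have "weak_div_pair w 0" unfolding w by (intro weak_div_free_sum weak_div_free_scale weak_div_face)
  then have "divergence T w = 0" by (rule divergence_eqI)
  then show "w \<in> {v \<in> M2 T lam C xs. divergence T v = 0}" using face_curl_in_M2 w by simp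
next
  fix w assume w: "w \<in> {v \<in> M2 T lam C xs. divergence T v = 0}"
  then obtain c k where ck: "w = (\<Sum>f\<in>faces T. c f *\<^sub>R face_curl f) + k *\<^sub>R zext T (\<lambda>x. x - xs)"
    "divergence T w = zext T (\<lambda>_. 3 * k)" by (auto elim: M2E)
  \<comment> \<open>Curls have divergence zero, so the divergence sees only the coefficient of the
    position field.\<close>
  then have "k = 0" using w zext_const_eq_zero[of "3 * k"] by simp
  then have "w = curl T (\<Sum>f\<in>faces T. c f *\<^sub>R face_whitney T lam C f)"
    using ck(1) curl_eqI[OF weak_curl_M1[of "\<lambda>_. 0" c]] by simp
  then show "w \<in> curl T ` M1 T lam C" using face_whitney_in_M1 by blast
qed

lemma exact_end: "exact_at (M2 T lam C xs) (divergence T) (consts_on T) (\<lambda>_. 0) ({0} :: (real^3 \<Rightarrow> real) set)"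
  unfolding exact_at_def
proof (intro conjI linear_divergence)
  show "linear_map_on (consts_on T) {0} (\<lambda>_. 0 :: real^3 \<Rightarrow> real)"
    using subspace_consts by (auto simp: linear_map_on_def subspace_single_0)
  have "g \<in> divergence T ` M2 T lam C xs" if "g \<in> consts_on T" for g
  proof -
    obtain k where k: "g = zext T (\<lambda>_. k)" using \<open>g \<in> consts_on T\<close> by (auto simp: consts_on_def)
    \<comment> \<open>The position field has divergence \<open>3\<close>, hence the factor
      \<open>k / 3\<close>.\<close>
    have "zext T (\<lambda>_. k) = (k / 3) *\<^sub>R zext T (\<lambda>_. 3)" by (auto simp: zext_def scaleR_fun_def)
    then have "g = divergence T ((\<Sum>f\<in>faces T. 0 *\<^sub>R face_curl f) + (k / 3) *\<^sub>R zext T (\<lambda>x. x - xs))"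
      using divergence_eqI[OF weak_div_M2[of "\<lambda>_. 0" "k / 3" xs]] k by simp
    moreover have "(\<Sum>f\<in>faces T. 0 *\<^sub>R face_curl f) + (k / 3) *\<^sub>R zext T (\<lambda>x. x - xs) \<in> M2 T lam C xs"
      unfolding M2_eq by (intro CollectI exI conjI TrueI) (rule refl)
    ultimately show ?thesis by blast
  qed
  then show "divergence T ` M2 T lam C xs = {v \<in> consts_on T. 0 = (0 :: real^3 \<Rightarrow> real)}"
    using linear_divergence unfolding linear_map_on_def by blast
qed

section \<open>Dimensions of the three spaces\<close>

lemma ex_vertex: obtains p0 where "p0 \<in> verts T"
  using card_verts_ge2[OF polytope] aff_dim by fastforce

text \<open>A vertex is a proper face, and a proper nonempty face lies in a facet.\<close>

lemma ex_face: obtains f0 where "f0 \<in> faces T"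
proof -
  obtain p q where pq: "p \<in> verts T" "q \<in> verts T" "p \<noteq> q"
    using card_verts_ge2[OF polytope] aff_dim card_le_Suc0_iff_eq[OF finite_verts] by force
  have "{p} face_of T" using pq(1) by (simp add: verts_def face_of_singleton)
  moreover have "{p} \<noteq> T" using pq verts_subset by blast
  ultimately obtain f where "f facet_of T"
    using face_of_polyhedron_subset_facet[OF polytope_imp_polyhedron[OF polytope]] by blast
  then show ?thesis using that by (simp add: faces_def)
qed

lemma dim_M0: "dim (M0 T lam) = card (verts T)"
  unfolding M0_def
proof (rule dim_span_family[OF finite_verts])
  fix c q assume z: "(\<Sum>p\<in>verts T. c p *\<^sub>R zext T (lam p)) = 0" and q: "q \<in> verts T"
  have "(\<Sum>p\<in>verts T. c p * lam p q) = 0"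
    using fun_cong[OF z[unfolded M0_pointwise], of q] q verts_subset by (auto simp: zext_def)
  moreover have "(\<Sum>p\<in>verts T. c p * lam p q) = (\<Sum>p\<in>verts T. if p = q then c p else 0)"
    by (rule sum.cong) (use lam_lagrange q in auto)
  ultimately show "c q = 0" using q finite_verts by simp
qed

lemma face_curl_independent:
  assumes f0: "f0 \<in> faces T" and z: "(\<Sum>f\<in>faces T - {f0}. c f *\<^sub>R face_curl f) = 0" and f: "f \<in> faces T - {f0}"
  shows "c f = 0"
proof -
  \<comment> \<open>Completed by the coefficient \<open>0\<close> at \<open>f0\<close>, the
    combination still vanishes, and then all coefficients agree with that one.\<close>
  let ?c = "\<lambda>f. if f = f0 then 0 else c f"
  have "(\<Sum>f\<in>faces T. ?c f *\<^sub>R face_curl f) = (\<Sum>f\<in>faces T - {f0}. c f *\<^sub>R face_curl f)"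
    using f0 finite_faces by (auto simp: sum.remove[of "faces T" f0] intro!: sum.cong)
  then have "?c f = ?c f0" using face_curl_kernel[of ?c f f0] f0 f z by simp
  then show ?thesis using f by simp
qed

lemma dim_M1: "dim (M1 T lam C) = card (edges T)"
proof -
  obtain p0 where p0: "p0 \<in> verts T" by (rule ex_vertex)
  obtain f0 where f0: "f0 \<in> faces T" by (rule ex_face)
  \<comment> \<open>Each of the two families sums to zero, so one vertex and one face can be left
    out without changing the spans.\<close>
  let ?V = "verts T - {p0}" and ?F = "faces T - {f0}"
  let ?g = "\<lambda>p. grad T (lam p)" and ?W = "face_whitney T lam C"
  \<comment> \<open>Indexing by the disjoint sum lets the independence argument show at the same
    time that no gradient coincides with a face form.\<close>
  let ?v = "case_sum ?g ?W"
  have g0: "(\<Sum>p\<in>verts T. ?g p) = 0" by (rule ext) (simp add: sum_fun_apply grad_lam_sum)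
  have fin: "finite ?V" "finite ?F" using finite_verts finite_faces by auto
  have "M1 T lam C = span (?g ` ?V) + span (?W ` ?F)"
    unfolding M1_def span_family_drop[OF finite_verts p0 g0]
      span_family_drop[OF finite_faces f0 face_whitney_total] ..
  then have M: "M1 T lam C = span (?v ` (?V <+> ?F))"
    unfolding span_plus_span image_case_sum_Plus .
  have "dim (M1 T lam C) = card (?V <+> ?F)"
    unfolding M
  proof (rule dim_span_family)
    show "finite (?V <+> ?F)" using fin by simp
    fix c i assume z: "(\<Sum>i\<in>?V <+> ?F. c i *\<^sub>R ?v i) = 0" and i: "i \<in> ?V <+> ?F"
    define a where "a p = (if p = p0 then 0 else c (Inl p))" for p
    define b where "b f = (if f = f0 then 0 else c (Inr f))" for f
    have A: "(\<Sum>p\<in>verts T. a p *\<^sub>R ?g p) = (\<Sum>p\<in>?V. c (Inl p) *\<^sub>R ?g p)"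
      using p0 finite_verts by (auto simp: a_def sum.remove[of "verts T" p0] intro!: sum.cong)
    have B: "(\<Sum>f\<in>faces T. b f *\<^sub>R ?W f) = (\<Sum>f\<in>?F. c (Inr f) *\<^sub>R ?W f)"
      using f0 finite_faces by (auto simp: b_def sum.remove[of "faces T" f0] intro!: sum.cong)
    have z': "(\<Sum>p\<in>verts T. a p *\<^sub>R ?g p) + (\<Sum>f\<in>faces T. b f *\<^sub>R ?W f) = 0"
      using z unfolding A B by (simp add: sum.Plus[OF fin])
    then have "(\<Sum>f\<in>faces T. b f *\<^sub>R face_curl f) = 0"
      using curl_eqI[OF weak_curl_M1[of a b]] curl_eqI[OF weak_curl_pair_zero] by simp
    note ker = face_curl_kernel[OF this _ f0] and W0 = face_curl_combination_zero[OF this]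
    have b0: "c (Inr f) = 0" if "f \<in> ?F" for f using ker[of f] that by (simp add: b_def)
    have "(\<Sum>p\<in>verts T. a p *\<^sub>R ?g p) = 0" using z' W0 by simp
    then obtain k where "(\<Sum>p\<in>verts T. a p *\<^sub>R zext T (lam p)) = zext T (\<lambda>_. k)"
      and k: "\<And>p. p \<in> verts T \<Longrightarrow> a p = k" by (rule grad_combination_zero) blast
    \<comment> \<open>The coefficient at \<open>p0\<close> was set to \<open>0\<close>, so the
      common value \<open>k\<close> is \<open>0\<close>.\<close>
    have a0: "c (Inl p) = 0" if "p \<in> ?V" for p
      using k[of p] k[OF p0] that by (simp add: a_def)
    show "c i = 0" using i a0 b0 by (auto simp: Plus_def)
  qed
  also have "\<dots> = card (verts T) - 1 + (card (faces T) - 1)"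
    using fin p0 f0 finite_verts finite_faces by (simp add: card_Plus)
  also have "\<dots> = card (edges T)"
  proof -
    have "card (verts T) \<ge> 1" "card (faces T) \<ge> 1"
      using p0 f0 finite_verts finite_faces by (simp_all add: Suc_le_eq card_gt_0_iff) blast+
    then show ?thesis using Euler by linarith
  qed
  finally show ?thesis .
qed

lemma dim_M2: "dim (M2 T lam C xs) = card (faces T)"
proof -
  obtain f0 where f0: "f0 \<in> faces T" by (rule ex_face)
  \<comment> \<open>The position field is a family with one member, indexed by \<open>()\<close>; it
    makes up for the face left out, so the count is again \<open>card (faces T)\<close>.\<close>
  let ?F = "faces T - {f0}" and ?U = "{()}"
  let ?z = "\<lambda>_ :: unit. zext T (\<lambda>x. x - xs)"
  let ?v = "case_sum face_curl ?z"
  have fin: "finite ?F" "finite ?U" using finite_faces by auto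
  have "(\<lambda>f. curl T (face_whitney T lam C f)) ` faces T = face_curl ` faces T"
    using curl_face_whitney by (rule image_cong[OF refl])
  then have "M2 T lam C xs = span (face_curl ` ?F) + span (?z ` ?U)"
    unfolding M2_def span_family_drop[OF finite_faces f0 face_curl_total] by simp
  then have M: "M2 T lam C xs = span (?v ` (?F <+> ?U))"
    unfolding span_plus_span image_case_sum_Plus .
  have "dim (M2 T lam C xs) = card (?F <+> ?U)"
    unfolding M
  proof (rule dim_span_family)
    show "finite (?F <+> ?U)" using fin by simp
    fix c i assume z: "(\<Sum>i\<in>?F <+> ?U. c i *\<^sub>R ?v i) = 0" and i: "i \<in> ?F <+> ?U"
    define b where "b f = (if f = f0 then 0 else c (Inl f))" for f
    let ?k = "c (Inr ())"
    have B: "(\<Sum>f\<in>faces T. b f *\<^sub>R face_curl f) = (\<Sum>f\<in>?F. c (Inl f) *\<^sub>R face_curl f)"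
      using f0 finite_faces by (auto simp: b_def sum.remove[of "faces T" f0] intro!: sum.cong)
    have z': "(\<Sum>f\<in>faces T. b f *\<^sub>R face_curl f) + ?k *\<^sub>R zext T (\<lambda>x. x - xs) = 0"
      using z unfolding B by (simp add: sum.Plus[OF fin])
    \<comment> \<open>Taking the divergence isolates the coefficient of the position field.\<close>
    then have "?k *\<^sub>R zext T (\<lambda>_. 3 :: real) = 0"
      using divergence_eqI[OF weak_div_M2[of b ?k xs]] divergence_eqI[OF weak_div_pair_zero] by simp
    then have k: "?k = 0" using zext_const_eq_zero[of 3] by simp
    then have "(\<Sum>f\<in>?F. c (Inl f) *\<^sub>R face_curl f) = 0" using z' B by simp
    from face_curl_independent[OF f0 this] show "c i = 0" using i k by (auto simp: Plus_def)
  qed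
  also have "\<dots> = card (faces T)"
  proof -
    have "card (faces T) > 0" using f0 finite_faces card_gt_0_iff by blast
    then show ?thesis using fin f0 by (simp add: card_Plus)
  qed
  finally show ?thesis .
qed

end

theorem mainTheorem7:
  fixes T :: "(real^3) set"
    and lam :: "real^3 \<Rightarrow> real^3 \<Rightarrow> real"
    and C :: "real^3 \<Rightarrow> real^3 \<Rightarrow> real^3 \<Rightarrow> real"
    and xs :: "real^3"
  assumes "polytope T" and "interior T \<noteq> {}"
    and "regular_coordinates T lam"
    and "face_conditions T lam"
    and "diagonal_coeffs T C"
    and "xs \<in> interior T"
  shows "exact_at {0} id (consts_on T) id (M0 T lam) \<and>
         exact_at (consts_on T) id (M0 T lam) (grad T) (M1 T lam C) \<and>
         exact_at (M0 T lam) (grad T) (M1 T lam C) (curl T) (M2 T lam C xs) \<and>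
         exact_at (M1 T lam C) (curl T) (M2 T lam C xs) (divergence T) (consts_on T) \<and>
         exact_at (M2 T lam C xs) (divergence T) (consts_on T) (\<lambda>_. 0) ({0} :: (real^3 \<Rightarrow> real) set) \<and>
         dim (M0 T lam) = card (verts T) \<and>
         dim (M1 T lam C) = card (edges T) \<and>
         dim (M2 T lam C xs) = card (faces T)"
proof -
  interpret gbc_polytope T lam C
    by unfold_locales (use assms in auto)
  show ?thesis
    by (intro conjI exact_consts exact_M0 exact_M1 exact_M2 exact_end dim_M0 dim_M1 dim_M2)
qed

end
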